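(* Let $M$ be an oriented $d$-dimensional topological manifold with fundamental class $[M]\in{}^sH_d(M;\mathbb Z)$. Every thin compactification $\overline M$ of $M$ has a fundamental class $[\overline M]\in{}^sH_d(\overline M;\mathbb Z)$ uniquely characterized by the requirement that $\rho_M([\overline M])=[M]$, where $\rho_M:{}^sH_d(\overline M;\mathbb Z)\to{}^sH_d(M;\mathbb Z)$ is the restriction map to the open subset $M\subseteq\overline M$.
   Context: For a locally compact Hausdorff space $X$, ${}^sH_p(X;G)$ is (type II) Steenrod homology in Massey's sense, $H_p(\mathrm{Hom}(C_c^*(X;\mathbb Z),G))$, where $C_c^*(X;\mathbb Z)$ is the (free abelian) complex of finitely-valued Alexander–Spanier cochains with compact support; $G=\mathbb Z$ when omitted. It is covariant for proper continuous maps, has restriction maps $\rho:{}^sH_p(X)\to{}^sH_p(U)$ for $U\subseteq X$ open, and for $A\subseteq X$ closed a natural long exact sequence $\cdots\to{}^sH_p(A)\to{}^sH_p(X)\xrightarrow{\rho}{}^sH_p(X\setminus A)\xrightarrow{\partial}{}^sH_{p-1}(A)\to\cdots$. A $d$-manifold is a Hausdorff space in which each point has an open neighborhood homeomorphic to $\mathbb R^d$ (no compactness, connectedness or second countability assumed). An oriented $d$-manifold $M$ has a fundamental class $[M]\in{}^sH_d(M;\mathbb Z)$ restricting to the orientation generator of ${}^sH_d(B;\mathbb Z)\cong\mathbb Z$ for each open ball $B\subseteq M$. A thin compactification of an oriented $d$-manifold $M$ is a compact Hausdorff space $\overline M$ containing $M$ such that $S=\overline M\setminus M$ is a closed subset with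 ${}^sH_p(S)=0$ for all $p>d-2$. *)

theory Defs
  imports "HOL-Homology.Homology"
begin

section \<open>Alexander-Spanier cochains with compact support\<close>

text \<open>
  A point of \<open>A\<^sup>p\<^sup>+\<^sup>1\<close> is a list of length \<open>p + 1\<close> with entries in \<open>A\<close>, and a function
  \<open>A\<^sup>p\<^sup>+\<^sup>1 \<rightarrow> \<int>\<close> is encoded as a function on all lists that is \<open>0\<close> off \<open>A\<^sup>p\<^sup>+\<^sup>1\<close>.
  Under this encoding, extension by zero from a subspace is the identity on functions.
\<close>

definition tuples :: "nat \<Rightarrow> 'a set \<Rightarrow> 'a list set" where
  "tuples p A = {xs. length xs = Suc p \<and> set xs \<subseteq> A}"

definition as_support :: "nat \<Rightarrow> 'a topology \<Rightarrow> ('a list \<Rightarrow> int) \<Rightarrow> 'a set" where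
  "as_support p X \<phi> =
     {x \<in> topspace X. \<not> (\<exists>V. openin X V \<and> x \<in> V \<and> (\<forall>xs \<in> tuples p V. \<phi> xs = 0))}"

definition as_function_group :: "nat \<Rightarrow> 'a topology \<Rightarrow> ('a list \<Rightarrow> int) monoid" where
  "as_function_group p X =
     \<lparr>carrier = {\<phi>. (\<forall>xs. xs \<notin> tuples p (topspace X) \<longrightarrow> \<phi> xs = 0) \<and>
                    finite (range \<phi>) \<and> compactin X (as_support p X \<phi>)},
      mult = (\<lambda>\<phi> \<psi> xs. \<phi> xs + \<psi> xs),
      one = (\<lambda>xs. 0)\<rparr>"

definition as_null :: "nat \<Rightarrow> 'a topology \<Rightarrow> ('a list \<Rightarrow> int) set" where
  "as_null p X = {\<phi> \<in> carrier (as_function_group p X). as_support p X \<phi> = {}}"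

text \<open>The free abelian group \<open>C\<^sub>c\<^sup>p(X; \<int>)\<close>, and the class in it of a function.\<close>

definition as_cochain_group :: "nat \<Rightarrow> 'a topology \<Rightarrow> ('a list \<Rightarrow> int) set monoid" where
  "as_cochain_group p X = as_function_group p X Mod as_null p X"

definition as_class :: "nat \<Rightarrow> 'a topology \<Rightarrow> ('a list \<Rightarrow> int) \<Rightarrow> ('a list \<Rightarrow> int) set" where
  "as_class p X \<phi> = as_null p X #>\<^bsub>as_function_group p X\<^esub> \<phi>"

definition as_function_coboundary ::
    "nat \<Rightarrow> 'a topology \<Rightarrow> ('a list \<Rightarrow> int) \<Rightarrow> 'a list \<Rightarrow> int" where
  "as_function_coboundary p X \<phi> xs =
     (if xs \<in> tuples (Suc p) (topspace X)
      then \<Sum>i\<le>Suc p. (-1) ^ i * \<phi> (take i xs @ drop (Suc i) xs)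
      else 0)"

text \<open>
  Maps induced on quotient groups are given on a coset as the union of the cosets determined by
  its representatives; these all coincide.
\<close>

definition as_coboundary ::
    "nat \<Rightarrow> 'a topology \<Rightarrow> ('a list \<Rightarrow> int) set \<Rightarrow> ('a list \<Rightarrow> int) set" where
  "as_coboundary p X c = (\<Union>\<phi>\<in>c. as_class (Suc p) X (as_function_coboundary p X \<phi>))"

text \<open>
  The map \<open>C\<^sub>c\<^sup>p(U; \<int>) \<rightarrow> C\<^sub>c\<^sup>p(X; \<int>)\<close> for \<open>U\<close> open in the locally compact Hausdorff space \<open>X\<close>.
  A function on \<open>U\<^sup>p\<^sup>+\<^sup>1\<close> with compact support need not have compact support when extended by zero
  to \<open>X\<^sup>p\<^sup>+\<^sup>1\<close>, so one first chooses a representative vanishing off \<open>K\<^sup>p\<^sup>+\<^sup>1\<close> for some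
  compact \<open>K\<close> contained in \<open>U\<close>.
\<close>

definition as_extension ::
    "nat \<Rightarrow> 'a topology \<Rightarrow> 'a set \<Rightarrow> ('a list \<Rightarrow> int) set \<Rightarrow> ('a list \<Rightarrow> int) set" where
  "as_extension p X U c =
     (\<Union>\<phi>\<in>{\<phi> \<in> c. \<exists>K. compactin X K \<and> K \<subseteq> U \<and> (\<forall>xs. xs \<notin> tuples p K \<longrightarrow> \<phi> xs = 0)}.
        as_class p X \<phi>)"


section \<open>Steenrod homology\<close>

text \<open>
  Homology of the chain complex \<open>Hom(C\<^sub>c\<^sup>*(X; \<int>), G)\<close> for an abelian group \<open>G\<close>. The complex is
  zero in negative degrees, hence so is the homology, and degrees are taken in \<^typ>\<open>nat\<close>.
\<close>

type_synonym ('a, 'g) steenrod_chain = "('a list \<Rightarrow> int) set \<Rightarrow> 'g"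

definition steenrod_chain_group ::
    "nat \<Rightarrow> 'a topology \<Rightarrow> 'g monoid \<Rightarrow> ('a, 'g) steenrod_chain monoid" where
  "steenrod_chain_group p X G =
     \<lparr>carrier = hom (as_cochain_group p X) G \<inter> extensional (carrier (as_cochain_group p X)),
      mult = (\<lambda>f g. \<lambda>c \<in> carrier (as_cochain_group p X). f c \<otimes>\<^bsub>G\<^esub> g c),
      one = (\<lambda>c \<in> carrier (as_cochain_group p X). \<one>\<^bsub>G\<^esub>)\<rparr>"

text \<open>The boundary from degree \<open>p + 1\<close> to degree \<open>p\<close>.\<close>

definition steenrod_boundary ::
    "nat \<Rightarrow> 'a topology \<Rightarrow> ('a, 'g) steenrod_chain \<Rightarrow> ('a, 'g) steenrod_chain" where
  "steenrod_boundary p X f = (\<lambda>c \<in> carrier (as_cochain_group p X). f (as_coboundary p X c))"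

definition steenrod_cycles ::
    "nat \<Rightarrow> 'a topology \<Rightarrow> 'g monoid \<Rightarrow> ('a, 'g) steenrod_chain set" where
  "steenrod_cycles p X G =
     {f \<in> carrier (steenrod_chain_group p X G).
        \<forall>q. p = Suc q \<longrightarrow> steenrod_boundary q X f = \<one>\<^bsub>steenrod_chain_group q X G\<^esub>}"

definition steenrod_boundaries ::
    "nat \<Rightarrow> 'a topology \<Rightarrow> 'g monoid \<Rightarrow> ('a, 'g) steenrod_chain set" where
  "steenrod_boundaries p X G =
     steenrod_boundary p X ` carrier (steenrod_chain_group (Suc p) X G)"

definition steenrod_homology_group ::
    "nat \<Rightarrow> 'a topology \<Rightarrow> 'g monoid \<Rightarrow> ('a, 'g) steenrod_chain set monoid" where
  "steenrod_homology_group p X G =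
     (steenrod_chain_group p X G)\<lparr>carrier := steenrod_cycles p X G\<rparr> Mod
       steenrod_boundaries p X G"

text \<open>The restriction \<open>\<rho>\<close> from \<open>X\<close> to an open subset \<open>U\<close>, on chains and on homology classes.\<close>

definition steenrod_chain_restriction ::
    "nat \<Rightarrow> 'a topology \<Rightarrow> 'a set \<Rightarrow> ('a, 'g) steenrod_chain \<Rightarrow> ('a, 'g) steenrod_chain" where
  "steenrod_chain_restriction p X U f =
     (\<lambda>c \<in> carrier (as_cochain_group p (subtopology X U)). f (as_extension p X U c))"

definition steenrod_restriction ::
    "nat \<Rightarrow> 'a topology \<Rightarrow> 'a set \<Rightarrow> 'g monoid \<Rightarrow>
     ('a, 'g) steenrod_chain set \<Rightarrow> ('a, 'g) steenrod_chain set" where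
  "steenrod_restriction p X U G h =
     (\<Union>f\<in>h. steenrod_boundaries p (subtopology X U) G
              #>\<^bsub>steenrod_chain_group p (subtopology X U) G\<^esub>
              steenrod_chain_restriction p X U f)"


section \<open>Oriented manifolds and thin compactifications\<close>

definition open_balls :: "nat \<Rightarrow> 'a topology \<Rightarrow> 'a set set" where
  "open_balls d M =
     {B. openin M B \<and> subtopology M B homeomorphic_space Euclidean_space d}"

definition topological_manifold :: "nat \<Rightarrow> 'a topology \<Rightarrow> bool" where
  "topological_manifold d M \<longleftrightarrow>
     Hausdorff_space M \<and> (\<forall>x \<in> topspace M. \<exists>B \<in> open_balls d M. x \<in> B)"

text \<open>
  An orientation is a choice, compatible with restriction, of a generator of the infinite cyclic
  group \<open>\<^sup>sH\<^sub>d(B; \<int>)\<close> for every open ball \<open>B\<close> of \<open>M\<close>.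
\<close>

definition manifold_orientation ::
    "nat \<Rightarrow> 'a topology \<Rightarrow> ('a set \<Rightarrow> ('a, int) steenrod_chain set) \<Rightarrow> bool" where
  "manifold_orientation d M ori \<longleftrightarrow>
     (\<forall>B \<in> open_balls d M.
        ori B \<in> carrier (steenrod_homology_group d (subtopology M B) integer_group) \<and>
        generate (steenrod_homology_group d (subtopology M B) integer_group) {ori B} =
          carrier (steenrod_homology_group d (subtopology M B) integer_group)) \<and>
     (\<forall>B \<in> open_balls d M. \<forall>B' \<in> open_balls d M. B' \<subseteq> B \<longrightarrow>
        steenrod_restriction d (subtopology M B) B' integer_group (ori B) = ori B')"

definition fundamental_class ::
    "nat \<Rightarrow> 'a topology \<Rightarrow> ('a set \<Rightarrow> ('a, int) steenrod_chain set) \<Rightarrow>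
     ('a, int) steenrod_chain set \<Rightarrow> bool" where
  "fundamental_class d M ori \<mu> \<longleftrightarrow>
     \<mu> \<in> carrier (steenrod_homology_group d M integer_group) \<and>
     (\<forall>B \<in> open_balls d M. steenrod_restriction d M B integer_group \<mu> = ori B)"

text \<open>
  The comparison \<open>p > d - 2\<close> is made in \<^typ>\<open>int\<close>, so that for \<open>d \<le> 1\<close> it holds in all degrees.
\<close>

definition thin_compactification :: "nat \<Rightarrow> 'a topology \<Rightarrow> 'a topology \<Rightarrow> bool" where
  "thin_compactification d M X \<longleftrightarrow>
     compact_space X \<and> Hausdorff_space X \<and>
     topspace M \<subseteq> topspace X \<and> subtopology X (topspace M) = M \<and>
     closedin X (topspace X - topspace M) \<and>
     (\<forall>p. int p > int d - 2 \<longrightarrow>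
        trivial_group
          (steenrod_homology_group p (subtopology X (topspace X - topspace M)) integer_group))"

end

theory Submission
  imports Defs "HOL-Library.Function_Algebras" "HOL-Analysis.Abstract_Topological_Spaces"
begin

text \<open>
  The two groups next to \<open>\<^sup>sH\<^sub>d(X) \<rightarrow> \<^sup>sH\<^sub>d(M)\<close> in the long exact sequence of the pair
  \<open>(X, S)\<close>, \<open>S = X - M\<close>, are \<open>\<^sup>sH\<^sub>d(S)\<close> and \<open>\<^sup>sH\<^sub>d\<^sub>-\<^sub>1(S)\<close>, and both vanish. Exactness has two
  sources. First, \<open>Hom(-, \<int>)\<close> preserves the relevant short exact sequences of cochain groups
  because these groups of finitely-valued functions split: this is the theorem of Noebeling, in
  the form that functions with support in an ideal of sets have an additive retraction,
  proved by transfinite induction over a well-ordered family of generating sets. Secondly, cochains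
  on \<open>S\<close> may be replaced by germs at \<open>S\<close> of cochains on \<open>X\<close>: Alexander-Spanier cohomology is taut,
  since compactness of \<open>S\<close> gives discontinuous retractions onto \<open>S\<close> that are as close to the
  identity near \<open>S\<close> as a given cover requires, and these are homotopic to the identity on cochains.
\<close>

section \<open>Additive retractions\<close>

text \<open>Splittings are needed because Hom(-, Z) is only left exact: a functional given on
  compactly supported cochains, or on relative cocycles, has to be extended to all functions. A
  retraction is all that such an extension uses, so no basis is ever built. The obstacle in the
  transfinite induction is that in a + b 1_e the coefficient b is determined only up to functions
  supported in an ideal other than the given one, so a choice of b is additive only modulo these.
  The induction therefore carries an arbitrary subgroup \<open>H\<close>, an arbitrary ideal
  \<open>J\<close>, and a map \<delta> on \<open>H\<close> that is additive only modulo functions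
  supported in \<open>J\<close>; the retraction is onto the preimage of these functions under
  \<delta>. This generality pays off again in the duality: with the coboundary as \<delta> it splits
  off relative cocycles, without any appeal to freeness of subgroups of free abelian groups.
  Everything is computed with representing functions on lists; cosets and homology classes enter
  only at the end.\<close>

definition add_subgroup :: "'g::ab_group_add set \<Rightarrow> bool" where
  "add_subgroup H \<longleftrightarrow> 0 \<in> H \<and> (\<forall>x\<in>H. \<forall>y\<in>H. x - y \<in> H)"

definition additive_on :: "'g::ab_group_add set \<Rightarrow> ('g \<Rightarrow> 'h::ab_group_add) \<Rightarrow> bool" where
  "additive_on H f \<longleftrightarrow> (\<forall>x\<in>H. \<forall>y\<in>H. f (x + y) = f x + f y)"

text \<open>A splitting expressed by subsets of one additive type, so that neither quotients nor
  carriers have to be formed; \<rho> matters only on \<open>H\<close> and \<open>K\<close>.\<close>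

definition add_retract :: "'g::ab_group_add set \<Rightarrow> 'g set \<Rightarrow> bool" where
  "add_retract H K \<longleftrightarrow>
     (\<exists>\<rho>. additive_on H \<rho> \<and> (\<forall>x\<in>H. \<rho> x \<in> K) \<and> (\<forall>x\<in>K. \<rho> x = x))"

lemma add_subgroup_zero: "add_subgroup H \<Longrightarrow> 0 \<in> H"
  by (simp add: add_subgroup_def)

lemma add_subgroup_diff: "add_subgroup H \<Longrightarrow> x \<in> H \<Longrightarrow> y \<in> H \<Longrightarrow> x - y \<in> H"
  by (simp add: add_subgroup_def)

lemma add_subgroup_uminus: "add_subgroup H \<Longrightarrow> x \<in> H \<Longrightarrow> - x \<in> H"
  using add_subgroup_diff[of H 0 x] by (simp add: add_subgroup_zero)

lemma add_subgroup_add: "add_subgroup H \<Longrightarrow> x \<in> H \<Longrightarrow> y \<in> H \<Longrightarrow> x + y \<in> H"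
  using add_subgroup_diff[of H x "- y"] by (simp add: add_subgroup_uminus)

lemma additive_onD: "additive_on H f \<Longrightarrow> x \<in> H \<Longrightarrow> y \<in> H \<Longrightarrow> f (x + y) = f x + f y"
  by (simp add: additive_on_def)

lemma additive_on_zero: "additive_on H f \<Longrightarrow> add_subgroup H \<Longrightarrow> f 0 = 0"
  using additive_onD[of H f 0 0] by (simp add: add_subgroup_zero)

lemma additive_on_diff:
  assumes "additive_on H f" "add_subgroup H" "x \<in> H" "y \<in> H"
  shows "f (x - y) = f x - f y"
  using additive_onD[OF assms(1), of "x - y" y] add_subgroup_diff[OF assms(2-4)] assms(4)
  by (simp add: algebra_simps)

lemma additive_on_subset: "additive_on H f \<Longrightarrow> K \<subseteq> H \<Longrightarrow> additive_on K f"
  unfolding additive_on_def by blast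

lemma additive_on_add: "additive_on H f \<Longrightarrow> additive_on H g \<Longrightarrow> additive_on H (\<lambda>x. f x + g x)"
  by (simp add: additive_on_def algebra_simps)

lemma additive_on_minus: "additive_on H f \<Longrightarrow> additive_on H g \<Longrightarrow> additive_on H (\<lambda>x. f x - g x)"
  by (simp add: additive_on_def algebra_simps)

lemma add_retract_refl: "add_retract H H"
  unfolding add_retract_def additive_on_def by (rule exI[of _ "\<lambda>x. x"]) auto

lemma add_retract_trans:
  assumes "add_retract H K" "add_retract K L" "L \<subseteq> K"
  shows "add_retract H L"
proof -
  obtain \<rho> where \<rho>: "additive_on H \<rho>" "\<forall>x\<in>H. \<rho> x \<in> K" "\<forall>x\<in>K. \<rho> x = x"
    using assms(1) unfolding add_retract_def by blast
  obtain \<sigma> where \<sigma>: "additive_on K \<sigma>" "\<forall>x\<in>K. \<sigma> x \<in> L" "\<forall>x\<in>L. \<sigma> x = x"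
    using assms(2) unfolding add_retract_def by blast
  show ?thesis unfolding add_retract_def
    using \<rho> \<sigma> assms(3) by (intro exI[of _ "\<sigma> \<circ> \<rho>"]) (auto simp: additive_on_def)
qed

text \<open>Precomposition with the retraction extends \<open>f\<close>. All splittings enter the
  duality arguments through this extension property.\<close>

lemma add_retract_extension:
  assumes "add_retract H K" "K \<subseteq> H" "additive_on K f"
  obtains g where "additive_on H g" "\<And>x. x \<in> K \<Longrightarrow> g x = f x"
proof -
  obtain \<rho> where \<rho>: "additive_on H \<rho>" "\<forall>x\<in>H. \<rho> x \<in> K" "\<forall>x\<in>K. \<rho> x = x"
    using assms(1) unfolding add_retract_def by blast
  show ?thesis
    by (rule that[of "f \<circ> \<rho>"]) (use \<rho> assms in \<open>auto simp: additive_on_def\<close>)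
qed

section \<open>Transfinite composition of retractions\<close>

inductive chain_reduces ::
    "'i set \<Rightarrow> ('i \<Rightarrow> 'g set) \<Rightarrow> ('i \<Rightarrow> 'g \<Rightarrow> 'g) \<Rightarrow> 'g set \<Rightarrow> 'g \<Rightarrow> 'g \<Rightarrow> bool"
  for D L \<rho> K where
  base: "x \<in> K \<Longrightarrow> chain_reduces D L \<rho> K x x"
| step: "e \<in> D \<Longrightarrow> x \<in> L e \<Longrightarrow> chain_reduces D L \<rho> K (\<rho> e x) z \<Longrightarrow> chain_reduces D L \<rho> K x z"

text \<open>An element is pushed down by the \<rho> of some stage containing it, again and again,
  until it lies in \<open>K\<close>; well-foundedness makes this stop after finitely many steps. The
  stage is not unique, hence \<open>chain_reduces\<close> is a relation, shown to be single-valued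
  afterwards. The hypotheses on \<open>M\<close> and \<open>H\<close> speak of pairs because
  additivity has to compare two elements at a common stage.\<close>

lemma add_retract_chain:
  fixes lt :: "'i \<Rightarrow> 'i \<Rightarrow> bool" and L M :: "'i \<Rightarrow> 'g::ab_group_add set"
  assumes wf: "wfp lt" and tot: "\<And>a b. a \<in> D \<Longrightarrow> b \<in> D \<Longrightarrow> a = b \<or> lt a b \<or> lt b a"
    and K: "add_subgroup K" and KM: "\<And>e. e \<in> D \<Longrightarrow> K \<subseteq> M e"
    and mono: "\<And>e e'. e \<in> D \<Longrightarrow> e' \<in> D \<Longrightarrow> lt e' e \<Longrightarrow> L e' \<subseteq> M e"
    and M: "\<And>e x y. e \<in> D \<Longrightarrow> x \<in> M e \<Longrightarrow> y \<in> M e \<Longrightarrow>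
              (x \<in> K \<and> y \<in> K) \<or> (\<exists>e'\<in>D. lt e' e \<and> x \<in> L e' \<and> y \<in> L e')"
    and L: "\<And>e. e \<in> D \<Longrightarrow> add_subgroup (L e)"
    and H: "\<And>x y. x \<in> H \<Longrightarrow> y \<in> H \<Longrightarrow>
              (x \<in> K \<and> y \<in> K) \<or> (\<exists>e\<in>D. x \<in> L e \<and> y \<in> L e)"
    and retr: "\<And>e. e \<in> D \<Longrightarrow> add_retract (L e) (M e)"
  shows "add_retract H K"
proof -
  have "\<exists>\<rho>. \<forall>e\<in>D. additive_on (L e) (\<rho> e) \<and> (\<forall>x\<in>L e. \<rho> e x \<in> M e) \<and> (\<forall>x\<in>M e. \<rho> e x = x)"
    using retr unfolding add_retract_def by (intro bchoice) blast
  then obtain \<rho> where add: "\<And>e. e \<in> D \<Longrightarrow> additive_on (L e) (\<rho> e)"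
    and into: "\<And>e x. e \<in> D \<Longrightarrow> x \<in> L e \<Longrightarrow> \<rho> e x \<in> M e"
    and fixed: "\<And>e x. e \<in> D \<Longrightarrow> x \<in> M e \<Longrightarrow> \<rho> e x = x" by blast
  let ?R = "chain_reduces D L \<rho> K"
  have red_K: "z = x" if "?R x z" "x \<in> K" for x z
    using that by (induction rule: chain_reduces.induct) (use fixed KM in \<open>fastforce+\<close>)
  have red_K': "z \<in> K" if "?R x z" for x z
    using that by (induction rule: chain_reduces.induct)
  \<comment> \<open>Inserting one more retraction does not change the outcome: if two different
    stages contain x, then x already lies in \<open>M\<close> of the larger one, whose retraction
    fixes it.\<close>
  have red_step: "?R (\<rho> e x) z" if "?R x z" "e \<in> D" "x \<in> L e" for x z e
    using that
  proof (induction arbitrary: e rule: chain_reduces.induct)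
    case (base x)
    then have "\<rho> e x = x" using fixed KM by blast
    then show ?case using base chain_reduces.base by metis
  next
    case (step e' x z)
    consider "e' = e" | "lt e' e" | "lt e e'" using tot step.hyps step.prems by blast
    then show ?case
    proof cases
      case 1 then show ?thesis using step by simp
    next
      case 2
      then have "\<rho> e x = x" using mono step.hyps step.prems fixed by blast
      then show ?thesis using step.hyps chain_reduces.step by metis
    next
      case 3
      then have "\<rho> e' x = x" using mono step.hyps step.prems fixed by blast
      then show ?thesis using step.IH step.prems by simp
    qed
  qed
  have ex: "\<exists>z. ?R x z" if "e \<in> D" "x \<in> L e" for e x
    using wf that
  proof (induction e arbitrary: x rule: wfp_induct_rule)
    case (less e)
    have "\<rho> e x \<in> M e" using into less.prems by blast
    then have "\<exists>z. ?R (\<rho> e x) z" using M[of e "\<rho> e x" "\<rho> e x"] less chain_reduces.base by metis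
    then show ?case using less.prems chain_reduces.step by metis
  qed
  \<comment> \<open>This yields additivity and, with the second summand 0, also uniqueness of the
    outcome.\<close>
  have sum: "z = x' + y'" if "e \<in> D" "x \<in> L e" "y \<in> L e" "?R x x'" "?R y y'" "?R (x + y) z"
    for e x y x' y' z
    using wf that
  proof (induction e arbitrary: x y rule: wfp_induct_rule)
    case (less e)
    have "x + y \<in> L e" using L less.prems add_subgroup_add by blast
    then have R: "?R (\<rho> e x) x'" "?R (\<rho> e y) y'" "?R (\<rho> e x + \<rho> e y) z"
      using red_step less.prems additive_onD[OF add[of e]] by metis+
    have "\<rho> e x \<in> M e" "\<rho> e y \<in> M e" using into less.prems by blast+
    from M[OF less.prems(1) this] show ?case
    proof
      assume K2: "\<rho> e x \<in> K \<and> \<rho> e y \<in> K"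
      then have "\<rho> e x + \<rho> e y \<in> K" using K add_subgroup_add by blast
      then show ?thesis using red_K K2 R by metis
    qed (use less.IH R in blast)
  qed
  define R where "R x = (SOME z. ?R x z)" for x
  have R: "?R x (R x)" if "x \<in> H" for x
  proof -
    have "\<exists>z. ?R x z" using H[OF that that] ex chain_reduces.base by metis
    then show ?thesis unfolding R_def by (rule someI_ex)
  qed
  have R': "R x = z" if "?R x z" "x \<in> K \<or> (\<exists>e\<in>D. x \<in> L e)" for x z
  proof -
    have "?R x (R x)" unfolding R_def using that(1) by (rule someI)
    show ?thesis using that(2)
    proof
      assume "x \<in> K" then show ?thesis using red_K that \<open>?R x (R x)\<close> by metis
    next
      assume "\<exists>e\<in>D. x \<in> L e"
      then obtain e where e: "e \<in> D" "x \<in> L e" by blast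
      have 0: "?R 0 0" by (rule chain_reduces.base[OF add_subgroup_zero[OF K]])
      have "0 \<in> L e" by (rule add_subgroup_zero[OF L[OF e(1)]])
      then show ?thesis using sum[OF e(1,2) _ that(1) 0, of "R x"] \<open>?R x (R x)\<close> by simp
    qed
  qed
  show ?thesis
    unfolding add_retract_def
  proof (intro exI conjI ballI)
    show "additive_on H R"
      unfolding additive_on_def
    proof (intro ballI)
      fix x y assume xy: "x \<in> H" "y \<in> H"
      from H[OF this] show "R (x + y) = R x + R y"
      proof
        assume K2: "x \<in> K \<and> y \<in> K"
        then have "x + y \<in> K" using K add_subgroup_add by blast
        then show ?thesis using R' K2 chain_reduces.base by metis
      next
        assume "\<exists>e\<in>D. x \<in> L e \<and> y \<in> L e"
        then obtain e where e: "e \<in> D" "x \<in> L e" "y \<in> L e" by blast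
        have l: "x + y \<in> L e" using L e add_subgroup_add by blast
        obtain z where z: "?R (x + y) z" using ex e l by blast
        then have "z = R x + R y" using sum e R xy by blast
        then show ?thesis using R' z e l by blast
      qed
    qed
    show "R x \<in> K" if "x \<in> H" for x using R red_K' that by blast
    show "R x = x" if "x \<in> K" for x using R' chain_reduces.base that by metis
  qed
qed


section \<open>Finitely-valued functions over an algebra of sets\<close>

inductive_set gen_algebra :: "'b set set \<Rightarrow> 'b set set" for D where
  gen_algebra_UNIV: "UNIV \<in> gen_algebra D"
| gen_algebra_gen: "S \<in> D \<Longrightarrow> S \<in> gen_algebra D"
| gen_algebra_Compl: "S \<in> gen_algebra D \<Longrightarrow> - S \<in> gen_algebra D"
| gen_algebra_Int: "S \<in> gen_algebra D \<Longrightarrow> T \<in> gen_algebra D \<Longrightarrow> S \<inter> T \<in> gen_algebra D"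

lemma gen_algebra_empty: "{} \<in> gen_algebra D"
  using gen_algebra_Compl[OF gen_algebra_UNIV] by simp

lemma gen_algebra_Un: "S \<in> gen_algebra D \<Longrightarrow> T \<in> gen_algebra D \<Longrightarrow> S \<union> T \<in> gen_algebra D"
  using gen_algebra_Compl[OF gen_algebra_Int[OF gen_algebra_Compl gen_algebra_Compl], of S D T]
  by simp

lemma gen_algebra_UN:
  "finite I \<Longrightarrow> (\<And>i. i \<in> I \<Longrightarrow> S i \<in> gen_algebra D) \<Longrightarrow> (\<Union>i\<in>I. S i) \<in> gen_algebra D"
  by (induction rule: finite_induct) (auto intro: gen_algebra_Un gen_algebra_empty)

lemma gen_algebra_mono: "D \<subseteq> E \<Longrightarrow> gen_algebra D \<subseteq> gen_algebra E"
proof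
  fix S assume "S \<in> gen_algebra D" "D \<subseteq> E"
  then show "S \<in> gen_algebra E" by induction (auto intro: gen_algebra.intros)
qed

lemma gen_algebra_finitary:
  assumes "S \<in> gen_algebra D" obtains F where "finite F" "F \<subseteq> D" "S \<in> gen_algebra F"
proof -
  have "\<exists>F. finite F \<and> F \<subseteq> D \<and> S \<in> gen_algebra F" using assms
  proof induction
    case gen_algebra_UNIV
    then show ?case by (intro exI[of _ "{}"]) (auto intro: gen_algebra.intros)
  next
    case (gen_algebra_gen S)
    then show ?case by (intro exI[of _ "{S}"]) (auto intro: gen_algebra.intros)
  next
    case (gen_algebra_Compl S)
    then show ?case by (meson gen_algebra.gen_algebra_Compl)
  next
    case (gen_algebra_Int S T)
    then obtain F G where "finite F" "F \<subseteq> D" "S \<in> gen_algebra F"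
      "finite G" "G \<subseteq> D" "T \<in> gen_algebra G" by blast
    then show ?case
      using gen_algebra_mono[of F "F \<union> G"] gen_algebra_mono[of G "F \<union> G"]
      by (intro exI[of _ "F \<union> G"]) (auto intro: gen_algebra.gen_algebra_Int)
  qed
  then show ?thesis using that by blast
qed

text \<open>A set of this form is given by independent traces on \<open>e\<close> and off
  \<open>e\<close>; complements and intersections act on the two traces separately.\<close>

lemma gen_algebra_insert:
  assumes "S \<in> gen_algebra (insert e D)"
  obtains A B where "A \<in> gen_algebra D" "B \<in> gen_algebra D" "S = (A \<inter> e) \<union> (B - e)"
proof -
  have "\<exists>A\<in>gen_algebra D. \<exists>B\<in>gen_algebra D. S = (A \<inter> e) \<union> (B - e)" using assms
  proof induction
    case gen_algebra_UNIV
    then show ?case by (rule bexI[of _ UNIV], rule bexI[of _ UNIV]) (auto intro: gen_algebra.intros)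
  next
    case (gen_algebra_gen S)
    show ?case
    proof (cases "S = e")
      case True
      then show ?thesis
        by (intro bexI[of _ UNIV] bexI[of _ "{}"]) (auto intro: gen_algebra.intros gen_algebra_empty)
    next
      case False
      then show ?thesis using gen_algebra_gen
        by (intro bexI[of _ S]) (auto intro: gen_algebra.intros)
    qed
  next
    case (gen_algebra_Compl S)
    then obtain A B where "A \<in> gen_algebra D" "B \<in> gen_algebra D" "S = (A \<inter> e) \<union> (B - e)" by blast
    then show ?case
      by (intro bexI[of _ "- A"] bexI[of _ "- B"]) (auto intro: gen_algebra.intros)
  next
    case (gen_algebra_Int S T)
    then obtain A B A' B' where "A \<in> gen_algebra D" "B \<in> gen_algebra D" "S = (A \<inter> e) \<union> (B - e)"
      "A' \<in> gen_algebra D" "B' \<in> gen_algebra D" "T = (A' \<inter> e) \<union> (B' - e)" by blast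
    then show ?case
      by (intro bexI[of _ "A \<inter> A'"] bexI[of _ "B \<inter> B'"]) (auto intro: gen_algebra.intros)
  qed
  then show ?thesis using that by blast
qed

section \<open>Integer-valued simple functions\<close>

definition simple_functions :: "'b set set \<Rightarrow> ('b \<Rightarrow> int) set" where
  "simple_functions D = {x. finite (range x) \<and> (\<forall>k. x -` {k} \<in> gen_algebra D)}"

text \<open>Multiplication by the indicator of \<open>e\<close>. On sets of tuples the same
  operation restricts a cochain to a subspace, since functions on a subspace are encoded by
  extension by zero.\<close>

definition restrict0 :: "'b set \<Rightarrow> ('b \<Rightarrow> int) \<Rightarrow> 'b \<Rightarrow> int" where
  "restrict0 e x = (\<lambda>t. if t \<in> e then x t else 0)"

lemma restrict0_add: "restrict0 e (x + y) = restrict0 e x + restrict0 e y"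
  and restrict0_diff: "restrict0 e (x - y) = restrict0 e x - restrict0 e y"
  by (auto simp: restrict0_def fun_eq_iff)

lemma finite_range_binop:
  assumes "finite (range x)" "finite (range y)"
  shows "finite (range (\<lambda>t. h (x t) (y t)))"
proof (rule finite_subset)
  show "range (\<lambda>t. h (x t) (y t)) \<subseteq> (\<lambda>(a, b). h a b) ` (range x \<times> range y)" by auto
  show "finite ((\<lambda>(a, b). h a b) ` (range x \<times> range y))"
    by (rule finite_imageI, rule finite_cartesian_product) (fact assms)+
qed

text \<open>Each level set of the combination is a finite union of intersections of level sets of
  \<open>x\<close> and \<open>y\<close>, one for each pair of values that \<open>h\<close> sends to
  k.\<close>

lemma simple_functions_binop:
  assumes "x \<in> simple_functions D" "y \<in> simple_functions D"
  shows "(\<lambda>t. h (x t) (y t)) \<in> simple_functions D"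
proof -
  have fin: "finite (range x)" "finite (range y)"
    using assms by (auto simp: simple_functions_def)
  have "(\<lambda>t. h (x t) (y t)) -` {k} \<in> gen_algebra D" for k
  proof -
    define P where "P = {p \<in> range x \<times> range y. h (fst p) (snd p) = k}"
    have "finite P" unfolding P_def by (intro finite_Collect_conjI disjI1) (simp add: fin finite_cartesian_product)
    then have "(\<Union>p\<in>P. x -` {fst p} \<inter> y -` {snd p}) \<in> gen_algebra D"
      using assms by (intro gen_algebra_UN) (auto simp: simple_functions_def intro: gen_algebra_Int)
    moreover have "(\<lambda>t. h (x t) (y t)) -` {k} = (\<Union>p\<in>P. x -` {fst p} \<inter> y -` {snd p})"
    proof (rule subset_antisym; rule subsetI)
      fix t assume "t \<in> (\<lambda>t. h (x t) (y t)) -` {k}"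
      then show "t \<in> (\<Union>p\<in>P. x -` {fst p} \<inter> y -` {snd p})"
        by (intro UN_I[of "(x t, y t)"]) (auto simp: P_def)
    qed (auto simp: P_def)
    ultimately show ?thesis by simp
  qed
  then show ?thesis using finite_range_binop[OF fin] by (simp add: simple_functions_def)
qed

lemma simple_functions_const: "(\<lambda>_. c) \<in> simple_functions D"
proof -
  have "(\<lambda>_::'a. c) -` {k} \<in> gen_algebra D" for k
    by (cases "c = k") (auto intro: gen_algebra_UNIV gen_algebra_empty)
  then show ?thesis by (simp add: simple_functions_def)
qed

lemma simple_functions_zero: "0 \<in> simple_functions D"
  using simple_functions_const[of 0] by (simp add: zero_fun_def)

lemma simple_functions_add:
  "x \<in> simple_functions D \<Longrightarrow> y \<in> simple_functions D \<Longrightarrow> x + y \<in> simple_functions D"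
  using simple_functions_binop[of x D y "(+)"] by (simp add: plus_fun_def)

lemma simple_functions_diff:
  "x \<in> simple_functions D \<Longrightarrow> y \<in> simple_functions D \<Longrightarrow> x - y \<in> simple_functions D"
  using simple_functions_binop[of x D y "(-)"] by (simp add: fun_diff_def)

lemma simple_functions_indicator:
  assumes "S \<in> gen_algebra D" shows "restrict0 S (\<lambda>_. c) \<in> simple_functions D"
proof -
  have "restrict0 S (\<lambda>_. c) -` {k} =
      (if c = k then S else {}) \<union> (if k = 0 then - S else {})" for k
    by (auto simp: restrict0_def split: if_splits)
  moreover have "finite (range (restrict0 S (\<lambda>_. c)))"
    by (rule finite_subset[of _ "{c, 0}"]) (auto simp: restrict0_def)
  ultimately show ?thesis
    using assms by (auto simp: simple_functions_def intro: gen_algebra.intros gen_algebra_empty gen_algebra_Un)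
qed

lemma simple_functions_restrict0:
  assumes "S \<in> gen_algebra D" "x \<in> simple_functions D"
  shows "restrict0 S x \<in> simple_functions D"
proof -
  have "restrict0 S x = (\<lambda>t. restrict0 S (\<lambda>_. 1) t * x t)" by (auto simp: restrict0_def)
  then show ?thesis
    using simple_functions_binop[OF simple_functions_indicator[OF assms(1), of 1] assms(2), of "(*)"]
    by simp
qed

lemma simple_functions_sum:
  "(\<And>i. i \<in> I \<Longrightarrow> x i \<in> simple_functions D) \<Longrightarrow> (\<Sum>i\<in>I. x i) \<in> simple_functions D"
  by (induction I rule: infinite_finite_induct) (auto intro: simple_functions_add simple_functions_zero)

lemma simple_functions_support:
  assumes "x \<in> simple_functions D" shows "{t. x t \<noteq> 0} \<in> gen_algebra D"
proof -
  have "{t. x t \<noteq> 0} = - (x -` {0})" by auto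
  then show ?thesis using assms by (auto simp: simple_functions_def intro: gen_algebra.intros)
qed

lemma simple_functions_mono: "D \<subseteq> E \<Longrightarrow> simple_functions D \<subseteq> simple_functions E"
  using gen_algebra_mono[of D E] by (auto simp: simple_functions_def)

text \<open>There are finitely many nonempty level sets, and each involves finitely many generators.
  In a total order these have a greatest one, which later determines a stage of the
  filtration.\<close>

lemma simple_functions_finitary:
  assumes "x \<in> simple_functions D"
  obtains F where "finite F" "F \<subseteq> D" "x \<in> simple_functions F"
proof -
  have "\<forall>k. \<exists>F. finite F \<and> F \<subseteq> D \<and> x -` {k} \<in> gen_algebra F"
    using assms gen_algebra_finitary unfolding simple_functions_def by (metis (mono_tags, lifting) mem_Collect_eq)
  then obtain F where F: "\<And>k. finite (F k) \<and> F k \<subseteq> D \<and> x -` {k} \<in> gen_algebra (F k)" by metis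
  have fin: "finite (range x)" using assms by (simp add: simple_functions_def)
  have "x -` {k} \<in> gen_algebra (\<Union>k\<in>range x. F k)" for k
  proof (cases "k \<in> range x")
    case True
    then show ?thesis using F gen_algebra_mono[of "F k" "\<Union>k\<in>range x. F k"] by blast
  next
    case False
    then have "x -` {k} = {}" by auto
    then show ?thesis by (simp add: gen_algebra_empty)
  qed
  then have "x \<in> simple_functions (\<Union>k\<in>range x. F k)"
    using fin by (simp add: simple_functions_def)
  moreover have "finite (\<Union>k\<in>range x. F k)" using F fin by (intro finite_UN_I) auto
  ultimately show ?thesis using F by (intro that[of "\<Union>k\<in>range x. F k"]) auto
qed

text \<open>A level set of \<open>x\<close> is given by \<open>A k\<close> on \<open>e\<close> and
  by \<open>B k\<close> off \<open>e\<close>. The sets \<open>A k\<close> are a partition only on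
  \<open>e\<close> and the sets \<open>B k\<close> only off \<open>e\<close>, so the two sums of k
  times indicator recover \<open>x\<close> each on its own side; the coefficient of the indicator of
  \<open>e\<close> is their difference.\<close>

lemma simple_functions_insert:
  assumes "x \<in> simple_functions (insert e D)"
  obtains a b where "a \<in> simple_functions D" "b \<in> simple_functions D" "x = a + restrict0 e b"
proof -
  have "\<forall>k. \<exists>A B. A \<in> gen_algebra D \<and> B \<in> gen_algebra D \<and> x -` {k} = (A \<inter> e) \<union> (B - e)"
    using assms gen_algebra_insert unfolding simple_functions_def
    by (metis (mono_tags, lifting) mem_Collect_eq)
  then obtain A B where AB: "\<And>k. A k \<in> gen_algebra D" "\<And>k. B k \<in> gen_algebra D"
    "\<And>k. x -` {k} = (A k \<inter> e) \<union> (B k - e)" by metis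
  define a where "a = (\<Sum>k\<in>range x. restrict0 (A k) (\<lambda>_. k))"
  define b where "b = (\<Sum>k\<in>range x. restrict0 (B k) (\<lambda>_. k))"
  have fin: "finite (range x)" using assms by (simp add: simple_functions_def)
  have sum_apply: "(\<Sum>k\<in>I. f k) t = (\<Sum>k\<in>I. f k t)" for I and f :: "int \<Rightarrow> 'a \<Rightarrow> int" and t
    by (induction I rule: infinite_finite_induct) auto
  have "x t = b t + restrict0 e (a - b) t" for t
  proof (cases "t \<in> e")
    case True
    then have iff: "t \<in> A k \<longleftrightarrow> k = x t" for k using AB(3)[of k] by auto
    have "a t = (\<Sum>k\<in>range x. if k = x t then k else 0)"
      by (auto simp: a_def sum_apply restrict0_def iff intro!: sum.cong)
    then show ?thesis using True fin by (simp add: restrict0_def)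
  next
    case False
    then have iff: "t \<in> B k \<longleftrightarrow> k = x t" for k using AB(3)[of k] by auto
    have "b t = (\<Sum>k\<in>range x. if k = x t then k else 0)"
      by (auto simp: b_def sum_apply restrict0_def iff intro!: sum.cong)
    then show ?thesis using False fin by (simp add: restrict0_def)
  qed
  then have "x = b + restrict0 e (a - b)" by (auto simp: fun_eq_iff)
  moreover have "a \<in> simple_functions D" "b \<in> simple_functions D"
    unfolding a_def b_def by (intro simple_functions_sum simple_functions_indicator AB)+
  ultimately show ?thesis using that[of b "a - b"] simple_functions_diff by blast
qed

lemma simple_functions_gen_UNIV: "simple_functions UNIV = {x. finite (range x)}"
  by (auto simp: simple_functions_def intro: gen_algebra_gen)

lemma simple_functions_gen_empty:
  assumes "x \<in> simple_functions {}" obtains c where "x = (\<lambda>_. c)"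
proof -
  have *: "S = {} \<or> S = UNIV" if "S \<in> gen_algebra {}" for S :: "'a set"
    using that by induction auto
  have "x = (\<lambda>_. x undefined)"
  proof
    fix t
    have "x -` {x undefined} \<noteq> {}" by auto
    then have "x -` {x undefined} = UNIV" using assms *[of "x -` {x undefined}"]
      by (auto simp: simple_functions_def)
    then show "x t = x undefined" by auto
  qed
  then show ?thesis by (rule that)
qed

section \<open>Ideals of sets and the functions supported in them\<close>

definition set_ideal :: "'b set set \<Rightarrow> bool" where
  "set_ideal J \<longleftrightarrow> {} \<in> J \<and> (\<forall>S\<in>J. \<forall>T\<in>J. S \<union> T \<in> J) \<and> (\<forall>S\<in>J. \<forall>T. T \<subseteq> S \<longrightarrow> T \<in> J)"

definition null_functions :: "'b set set \<Rightarrow> ('b \<Rightarrow> int) set" where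
  "null_functions J = {x. {t. x t \<noteq> 0} \<in> J}"

lemma null_functions_vanish:
  assumes "set_ideal J" "x \<in> null_functions J" "y \<in> null_functions J"
    "\<And>t. x t = 0 \<Longrightarrow> y t = 0 \<Longrightarrow> z t = 0"
  shows "z \<in> null_functions J"
proof -
  have "{t. z t \<noteq> 0} \<subseteq> {t. x t \<noteq> 0} \<union> {t. y t \<noteq> 0}" using assms(4) by blast
  then show ?thesis using assms(1-3) unfolding set_ideal_def null_functions_def
    by (metis mem_Collect_eq)
qed

lemma null_functions_subgroup:
  assumes "set_ideal J" shows "add_subgroup (null_functions J)"
  unfolding add_subgroup_def
proof (intro conjI ballI)
  show "0 \<in> null_functions J" using assms by (simp add: null_functions_def set_ideal_def)
  show "x - y \<in> null_functions J" if "x \<in> null_functions J" "y \<in> null_functions J" for x y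
    by (rule null_functions_vanish[OF assms that]) simp
qed


section \<open>Splitting off the functions supported in an ideal\<close>

text \<open>
  Adjoining \<open>e\<close> to \<open>D\<close> gives the functions \<open>a + b 1\<^sub>e\<close> with \<open>a\<close>, \<open>b\<close> simple over \<open>D\<close>. Modulo the
  functions supported in \<open>J\<close> and those simple over \<open>D\<close>, the coefficient \<open>b\<close> is determined up to
  functions supported in the following ideal.
\<close>

definition step_ideal :: "'b set set \<Rightarrow> 'b set \<Rightarrow> 'b set set \<Rightarrow> 'b set set" where
  "step_ideal D e J =
     {S. \<exists>A\<in>gen_algebra D. \<exists>B\<in>gen_algebra D. S \<subseteq> A \<and> (A \<inter> e - B) \<union> (B - A \<inter> e) \<in> J}"

lemma set_idealD:
  assumes "set_ideal J"
  shows "{} \<in> J" "\<And>S T. S \<in> J \<Longrightarrow> T \<in> J \<Longrightarrow> S \<union> T \<in> J" "\<And>S T. S \<in> J \<Longrightarrow> T \<subseteq> S \<Longrightarrow> T \<in> J"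
  using assms by (auto simp: set_ideal_def)

lemma set_ideal_step:
  assumes J: "set_ideal J" shows "set_ideal (step_ideal D e J)"
  unfolding set_ideal_def
proof (intro conjI ballI allI impI)
  show "{} \<in> step_ideal D e J"
    unfolding step_ideal_def using set_idealD(1)[OF J] gen_algebra_empty
    by (intro CollectI bexI[of _ "{}"]) auto
  fix S assume "S \<in> step_ideal D e J"
  then obtain A B where S: "A \<in> gen_algebra D" "B \<in> gen_algebra D" "S \<subseteq> A"
    "(A \<inter> e - B) \<union> (B - A \<inter> e) \<in> J" unfolding step_ideal_def by blast
  show "T \<in> step_ideal D e J" if "T \<subseteq> S" for T
    using S that unfolding step_ideal_def by blast
  fix T assume "T \<in> step_ideal D e J"
  then obtain A' B' where T: "A' \<in> gen_algebra D" "B' \<in> gen_algebra D" "T \<subseteq> A'"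
    "(A' \<inter> e - B') \<union> (B' - A' \<inter> e) \<in> J" unfolding step_ideal_def by blast
  have "((A \<union> A') \<inter> e - (B \<union> B')) \<union> ((B \<union> B') - (A \<union> A') \<inter> e) \<in> J"
    by (rule set_idealD(3)[OF J set_idealD(2)[OF J S(4) T(4)]]) auto
  then show "S \<union> T \<in> step_ideal D e J"
    unfolding step_ideal_def using S(1-3) T(1-3)
    by (intro CollectI bexI[of _ "A \<union> A'"] bexI[of _ "B \<union> B'"]) (auto intro: gen_algebra_Un)
qed

text \<open>If the support of \<open>b\<close> lies in A, and A \<inter> e agrees with B up to a set
  in \<open>J\<close>, then \<open>restrict0 e b\<close> may be replaced by
  \<open>restrict0 B b\<close>, which is simple over \<open>D\<close>. Conversely the supports of
  \<open>b\<close> and \<open>a\<close> serve as A and B: where the supports of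
  \<open>restrict0 e b\<close> and \<open>a\<close> differ, so do the functions.\<close>

lemma null_functions_step:
  assumes J: "set_ideal J" and b: "b \<in> simple_functions D"
  shows "b \<in> null_functions (step_ideal D e J) \<longleftrightarrow>
         (\<exists>a\<in>simple_functions D. restrict0 e b - a \<in> null_functions J)"
proof
  assume "b \<in> null_functions (step_ideal D e J)"
  then obtain A B where AB: "A \<in> gen_algebra D" "B \<in> gen_algebra D" "{t. b t \<noteq> 0} \<subseteq> A"
    "(A \<inter> e - B) \<union> (B - A \<inter> e) \<in> J"
    unfolding step_ideal_def null_functions_def by blast
  have "{t. (restrict0 e b - restrict0 B b) t \<noteq> 0} \<subseteq> (A \<inter> e - B) \<union> (B - A \<inter> e)"
    using AB(3) by (auto simp: restrict0_def split: if_splits)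
  then have "restrict0 e b - restrict0 B b \<in> null_functions J"
    unfolding null_functions_def using set_idealD(3)[OF J AB(4)] by blast
  then show "\<exists>a\<in>simple_functions D. restrict0 e b - a \<in> null_functions J"
    using simple_functions_restrict0[OF AB(2) b] by blast
next
  assume "\<exists>a\<in>simple_functions D. restrict0 e b - a \<in> null_functions J"
  then obtain a where a: "a \<in> simple_functions D" "{t. (restrict0 e b - a) t \<noteq> 0} \<in> J"
    unfolding null_functions_def by blast
  let ?A = "{t. b t \<noteq> 0}" and ?B = "{t. a t \<noteq> 0}"
  have "(?A \<inter> e - ?B) \<union> (?B - ?A \<inter> e) \<subseteq> {t. (restrict0 e b - a) t \<noteq> 0}"
    by (auto simp: restrict0_def split: if_splits)
  then have "(?A \<inter> e - ?B) \<union> (?B - ?A \<inter> e) \<in> J" using set_idealD(3)[OF J a(2)] by blast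
  then show "b \<in> null_functions (step_ideal D e J)"
    unfolding null_functions_def step_ideal_def
    using simple_functions_support[OF a(1)] simple_functions_support[OF b] by blast
qed

lemma add_subgroup_scale:
  fixes H :: "('t \<Rightarrow> int) set"
  assumes "add_subgroup H" "x \<in> H" shows "(\<lambda>t. k * x t) \<in> H"
proof (induction k rule: int_induct[where k = 0])
  case base
  then show ?case using add_subgroup_zero[OF assms(1)] by (simp add: zero_fun_def)
next
  case (step1 i)
  have "(\<lambda>t. (i + 1) * x t) = (\<lambda>t. i * x t) + x" by (auto simp: algebra_simps)
  then show ?case using add_subgroup_add[OF assms(1) step1(2) assms(2)] by simp
next
  case (step2 i)
  have "(\<lambda>t. (i - 1) * x t) = (\<lambda>t. i * x t) - x" by (auto simp: algebra_simps)
  then show ?case using add_subgroup_diff[OF assms(1) step2(2) assms(2)] by simp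
qed

lemma additive_on_scale:
  fixes H :: "('t \<Rightarrow> int) set" and f :: "('t \<Rightarrow> int) \<Rightarrow> int"
  assumes "add_subgroup H" "additive_on H f" "x \<in> H" shows "f (\<lambda>t. k * x t) = k * f x"
proof (induction k rule: int_induct[where k = 0])
  case base
  then show ?case using additive_on_zero[OF assms(2,1)] by (simp add: zero_fun_def)
next
  case (step1 i)
  have "(\<lambda>t. (i + 1) * x t) = (\<lambda>t. i * x t) + x" by (auto simp: algebra_simps)
  then show ?case
    using additive_onD[OF assms(2) add_subgroup_scale[OF assms(1,3)] assms(3), of i] step1
    by (simp add: algebra_simps)
next
  case (step2 i)
  have "(\<lambda>t. (i - 1) * x t) = (\<lambda>t. i * x t) - x" by (auto simp: algebra_simps)
  then show ?case
    using additive_on_diff[OF assms(2,1) add_subgroup_scale[OF assms(1,3)] assms(3), of i] step2(2)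
    by (simp only: left_diff_distrib mult_1)
qed

text \<open>The values of \<open>f\<close> form a subgroup of the integers. If it is nonzero, let m
  be its least positive element and g a preimage of m: subtracting (f y div m) g from y cancels f y
  exactly.\<close>

lemma add_retract_int_kernel:
  fixes H :: "('t \<Rightarrow> int) set" and f :: "('t \<Rightarrow> int) \<Rightarrow> int"
  assumes H: "add_subgroup H" and f: "additive_on H f"
  shows "add_retract H {x \<in> H. f x = 0}"
proof (cases "\<forall>x\<in>H. f x = 0")
  case True
  then have "{x \<in> H. f x = 0} = H" by blast
  then show ?thesis by (simp add: add_retract_refl)
next
  case False
  then obtain x where x: "x \<in> H" "f x \<noteq> 0" by blast
  define P where "P n \<longleftrightarrow> 0 < n \<and> (\<exists>g\<in>H. f g = int n)" for n
  have "P (nat \<bar>f x\<bar>)"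
  proof (cases "f x > 0")
    case True then show ?thesis using x by (auto simp: P_def)
  next
    case False
    have "f (\<lambda>t. (-1) * x t) = - f x" using additive_on_scale[OF H f x(1), of "-1"] by simp
    then show ?thesis using False x add_subgroup_scale[OF H x(1), of "-1"]
      unfolding P_def by (intro conjI bexI[of _ "\<lambda>t. (-1) * x t"]) auto
  qed
  then have "P (Least P)" by (rule LeastI)
  then obtain g where g: "g \<in> H" "f g = int (Least P)" "0 < Least P" unfolding P_def by blast
  define m where "m = f g"
  have m: "0 < m" using g by (simp add: m_def)
  have red: "(\<lambda>t. k * g t) \<in> H" "f (\<lambda>t. k * g t) = k * m" for k
    using add_subgroup_scale[OF H g(1)] additive_on_scale[OF H f g(1)] by (auto simp: m_def)
  have div: "f y = (f y div m) * m" if "y \<in> H" for y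
  proof (rule ccontr)
    assume "f y \<noteq> (f y div m) * m"
    then have "f y mod m \<noteq> 0" by (metis add.right_neutral div_mult_mod_eq)
    then have pos: "0 < f y mod m" using m by (simp add: order_less_le)
    have "f (y - (\<lambda>t. (f y div m) * g t)) = f y mod m"
      using additive_on_diff[OF f H that red(1)] red(2) by (simp add: minus_div_mult_eq_mod)
    then have "P (nat (f y mod m))"
      unfolding P_def using pos add_subgroup_diff[OF H that red(1)] by (metis int_nat_eq less_le_not_le zero_less_nat_eq)
    then have "Least P \<le> nat (f y mod m)" by (rule Least_le)
    moreover have "f y mod m < m" using m by simp
    ultimately show False using g m_def by linarith
  qed
  have dadd: "(f y + f z) div m = f y div m + f z div m" if "y \<in> H" "z \<in> H" for y z
    by (subst div[OF that(1)], subst div[OF that(2)]) (use m in \<open>simp flip: distrib_right\<close>)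
  show ?thesis
    unfolding add_retract_def
  proof (intro exI[of _ "\<lambda>y. y - (\<lambda>t. (f y div m) * g t)"] conjI ballI)
    show "additive_on H (\<lambda>y. y - (\<lambda>t. (f y div m) * g t))"
      unfolding additive_on_def
      by (auto simp: additive_onD[OF f] dadd fun_eq_iff algebra_simps)
    show "y - (\<lambda>t. (f y div m) * g t) \<in> {x \<in> H. f x = 0}" if "y \<in> H" for y
      using additive_on_diff[OF f H that red(1)] red(2) div[OF that] add_subgroup_diff[OF H that red(1)]
      by simp
    show "y - (\<lambda>t. (f y div m) * g t) = y" if "y \<in> {x \<in> H. f x = 0}" for y
      using that by (auto simp: fun_eq_iff)
  qed
qed

text \<open>The form of additivity that survives an arbitrary choice of values: a choice of
  representatives respects sums only modulo the ambiguity \<open>N\<close>.\<close>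

definition additive_mod :: "'g::ab_group_add set \<Rightarrow> 'h::ab_group_add set \<Rightarrow> ('g \<Rightarrow> 'h) \<Rightarrow> bool" where
  "additive_mod H N \<delta> \<longleftrightarrow> (\<forall>x\<in>H. \<forall>y\<in>H. \<delta> (x + y) - \<delta> x - \<delta> y \<in> N)"

text \<open>Modulo \<open>N\<close> the map \<delta> is a homomorphism, and the set in question is
  the preimage of the subgroup A + N.\<close>

lemma additive_mod_preimage:
  assumes H: "add_subgroup H" and N: "add_subgroup N" and A: "add_subgroup A"
    and \<delta>: "additive_mod H N \<delta>"
  shows "add_subgroup {x \<in> H. \<exists>a\<in>A. \<delta> x - a \<in> N}"
  unfolding add_subgroup_def
proof (intro conjI ballI)
  have "\<delta> (0 + 0) - \<delta> 0 - \<delta> 0 \<in> N" using \<delta> add_subgroup_zero[OF H] unfolding additive_mod_def by blast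
  then have "- (\<delta> (0 + 0) - \<delta> 0 - \<delta> 0) \<in> N" by (rule add_subgroup_uminus[OF N])
  then have "\<delta> 0 - 0 \<in> N" by simp
  then show "0 \<in> {x \<in> H. \<exists>a\<in>A. \<delta> x - a \<in> N}"
    using add_subgroup_zero[OF A] add_subgroup_zero[OF H] by blast
  fix x y assume "x \<in> {x \<in> H. \<exists>a\<in>A. \<delta> x - a \<in> N}" "y \<in> {x \<in> H. \<exists>a\<in>A. \<delta> x - a \<in> N}"
  then obtain a b where xy: "x \<in> H" "y \<in> H" "a \<in> A" "b \<in> A" "\<delta> x - a \<in> N" "\<delta> y - b \<in> N" by blast
  have d: "x - y \<in> H" using add_subgroup_diff H xy by blast
  have "\<delta> ((x - y) + y) - \<delta> (x - y) - \<delta> y \<in> N" using \<delta> d xy unfolding additive_mod_def by blast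
  from add_subgroup_diff[OF N add_subgroup_diff[OF N xy(5,6)] this] have "\<delta> (x - y) - (a - b) \<in> N" by (simp add: algebra_simps)
  then show "x - y \<in> {x \<in> H. \<exists>a\<in>A. \<delta> x - a \<in> N}"
    using d add_subgroup_diff[OF A xy(3,4)] by blast
qed

lemma simple_functions_subgroup: "add_subgroup (simple_functions D)"
  by (simp add: add_subgroup_def simple_functions_zero simple_functions_diff)

text \<open>The bottom of the filtration, where only constants are available. If \<open>J\<close>
  contains the whole set, both sides coincide. Otherwise the constant congruent to \<delta> x is
  unique, so it is an integer functional of x, and its kernel splits off.\<close>

lemma add_retract_constants:
  fixes H :: "('t \<Rightarrow> int) set" and \<delta> :: "('t \<Rightarrow> int) \<Rightarrow> 'b \<Rightarrow> int"
  assumes H: "add_subgroup H" and J: "set_ideal J" and \<delta>: "additive_mod H (null_functions J) \<delta>"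
  shows "add_retract {x \<in> H. \<exists>a\<in>simple_functions {}. \<delta> x - a \<in> null_functions J}
           {x \<in> H. \<delta> x \<in> null_functions J}"
proof (cases "UNIV \<in> J")
  case True
  then have "null_functions J = UNIV" using set_idealD(3)[OF J True] by (auto simp: null_functions_def)
  then have eq: "{x \<in> H. \<exists>a\<in>simple_functions {}. \<delta> x - a \<in> null_functions J} =
      {x \<in> H. \<delta> x \<in> null_functions J}"
    using simple_functions_zero[of "{}"] by auto
  show ?thesis unfolding eq by (rule add_retract_refl)
next
  case False
  let ?N = "null_functions J" and ?L = "{x \<in> H. \<exists>a\<in>simple_functions {}. \<delta> x - a \<in> null_functions J}"
  note N = null_functions_subgroup[OF J]
  have L: "add_subgroup ?L" by (rule additive_mod_preimage[OF H N simple_functions_subgroup \<delta>])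
  have const0: "c = 0" if "(\<lambda>_. c) \<in> ?N" for c
    using that False by (auto simp: null_functions_def split: if_splits)
  have "\<forall>x\<in>?L. \<exists>c. \<delta> x - (\<lambda>_. c) \<in> ?N"
  proof
    fix x assume "x \<in> ?L"
    then obtain a where a: "a \<in> simple_functions {}" "\<delta> x - a \<in> ?N" by blast
    from a(1) obtain c where "a = (\<lambda>_. c)" by (rule simple_functions_gen_empty)
    with a(2) show "\<exists>c. \<delta> x - (\<lambda>_. c) \<in> ?N" by blast
  qed
  from bchoice[OF this] obtain c where c: "\<And>x. x \<in> ?L \<Longrightarrow> \<delta> x - (\<lambda>_. c x) \<in> ?N" by blast
  have cadd: "additive_on ?L c"
    unfolding additive_on_def
  proof (intro ballI)
    fix x y assume xy: "x \<in> ?L" "y \<in> ?L"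
    then have s: "x + y \<in> ?L" using add_subgroup_add[OF L] by blast
    have "\<delta> (x + y) - \<delta> x - \<delta> y \<in> ?N" using \<delta> xy unfolding additive_mod_def by blast
    then have "(\<delta> (x + y) - \<delta> x - \<delta> y) + (\<delta> x - (\<lambda>_. c x)) + (\<delta> y - (\<lambda>_. c y)) - (\<delta> (x + y) - (\<lambda>_. c (x + y))) \<in> ?N"
      by (rule add_subgroup_diff[OF N add_subgroup_add[OF N add_subgroup_add[OF N _ c[OF xy(1)]] c[OF xy(2)]] c[OF s]])
    also have "(\<delta> (x + y) - \<delta> x - \<delta> y) + (\<delta> x - (\<lambda>_. c x)) + (\<delta> y - (\<lambda>_. c y)) - (\<delta> (x + y) - (\<lambda>_. c (x + y)))
        = (\<lambda>_. c (x + y) - c x - c y)" by (auto simp: fun_eq_iff)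
    finally have "c (x + y) - c x - c y = 0" by (rule const0)
    then show "c (x + y) = c x + c y" by simp
  qed
  have eq: "{x \<in> H. \<delta> x \<in> ?N} = {x \<in> ?L. c x = 0}"
  proof (rule subset_antisym; rule subsetI)
    fix x assume x: "x \<in> {x \<in> H. \<delta> x \<in> ?N}"
    have "\<delta> x - 0 \<in> ?N" using x by simp
    then have xL: "x \<in> ?L" using x simple_functions_zero by blast
    have "\<delta> x - (\<delta> x - (\<lambda>_. c x)) \<in> ?N" by (rule add_subgroup_diff[OF N _ c[OF xL]]) (use x in simp)
    then have "(\<lambda>_. c x) \<in> ?N" by simp
    then show "x \<in> {x \<in> ?L. c x = 0}" using xL const0 by blast
  next
    fix x assume x: "x \<in> {x \<in> ?L. c x = 0}"
    then have "(\<lambda>_::'b. c x) = 0" by (simp add: zero_fun_def)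
    moreover have "\<delta> x - (\<lambda>_. c x) \<in> ?N" using x by (intro c) blast
    ultimately have "\<delta> x - 0 \<in> ?N" by (simp only:)
    then show "x \<in> {x \<in> H. \<delta> x \<in> ?N}" using x by simp
  qed
  show ?thesis unfolding eq by (rule add_retract_int_kernel[OF L cadd])
qed

lemma finite_has_greatest:
  assumes "finite F" "F \<noteq> {}" "transp lt" "totalp lt"
  obtains m where "m \<in> F" "\<And>x. x \<in> F \<Longrightarrow> x = m \<or> lt x m"
proof -
  have "\<exists>m\<in>F. \<forall>x\<in>F. x = m \<or> lt x m" using assms(1,2)
  proof (induction rule: finite_ne_induct)
    case (insert a F)
    then obtain m where m: "m \<in> F" "\<forall>x\<in>F. x = m \<or> lt x m" by blast
    consider "a = m" | "lt a m" | "lt m a" using totalpD[OF assms(4)] by metis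
    then show ?case
    proof cases
      case 3
      then have "lt x a" if "x \<in> F" for x
        using m(2) that transpD[OF assms(3), of x m a] by metis
      then show ?thesis by blast
    qed (use m in blast)+
  qed simp
  then show ?thesis using that by blast
qed

text \<open>\<open>H\<close> is filtered by the generators needed to represent \<delta> x modulo
  null functions. Between \<open>below e\<close> and \<open>insert e (below e)\<close> the
  obstruction is the coefficient of the indicator of e. That coefficient is simple over the proper
  initial segment \<open>below e\<close>, so the induction hypothesis applies to it, with the stage
  in place of \<open>H\<close>, \<open>step_ideal\<close> in place of \<open>J\<close> and the
  coefficient in place of \<delta>.\<close>

lemma simple_functions_retract_step:
  fixes lt :: "'b set \<Rightarrow> 'b set \<Rightarrow> bool" and H :: "('t \<Rightarrow> int) set"
    and \<delta> :: "('t \<Rightarrow> int) \<Rightarrow> 'b \<Rightarrow> int"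
  assumes wf: "wfp lt" and trans: "transp lt" and tot: "totalp lt"
    and D: "\<And>e e'. e \<in> D \<Longrightarrow> lt e' e \<Longrightarrow> e' \<in> D"
    and IH: "\<And>e J H (\<delta> :: ('t \<Rightarrow> int) \<Rightarrow> 'b \<Rightarrow> int). e \<in> D \<Longrightarrow> set_ideal J \<Longrightarrow> add_subgroup H \<Longrightarrow>
           \<delta> ` H \<subseteq> simple_functions {e'. lt e' e} \<Longrightarrow> additive_mod H (null_functions J) \<delta> \<Longrightarrow>
           add_retract H {x \<in> H. \<delta> x \<in> null_functions J}"
    and J: "set_ideal J" and H: "add_subgroup H" and \<delta>D: "\<delta> ` H \<subseteq> simple_functions D"
    and \<delta>: "additive_mod H (null_functions J) \<delta>"
  shows "add_retract H {x \<in> H. \<delta> x \<in> null_functions J}"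
proof -
  let ?N = "null_functions J"
  note N = null_functions_subgroup[OF J]
  define pre where "pre E = {x \<in> H. \<exists>a\<in>simple_functions E. \<delta> x - a \<in> ?N}" for E
  define below where "below e = {e'. lt e' e}" for e
  have pre: "add_subgroup (pre E)" for E
    unfolding pre_def by (rule additive_mod_preimage[OF H N simple_functions_subgroup \<delta>])
  have pre_mono: "pre E \<subseteq> pre E'" if "E \<subseteq> E'" for E E'
    using simple_functions_mono[OF that] unfolding pre_def by blast
  \<comment> \<open>Two elements are represented over one finite set of generators; its greatest
    member is a common stage, as the transfinite composition requires.\<close>
  have fin: "(x \<in> pre {} \<and> y \<in> pre {}) \<or>
      (\<exists>e\<in>E. x \<in> pre (insert e (below e)) \<and> y \<in> pre (insert e (below e)))"
    if "x \<in> pre E" "y \<in> pre E" for x y E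
  proof -
    from that obtain a b where ab: "a \<in> simple_functions E" "\<delta> x - a \<in> ?N"
      "b \<in> simple_functions E" "\<delta> y - b \<in> ?N"
      unfolding pre_def by auto
    obtain F where F: "finite F" "F \<subseteq> E" "a \<in> simple_functions F"
      using simple_functions_finitary[OF ab(1)] by blast
    obtain G where G: "finite G" "G \<subseteq> E" "b \<in> simple_functions G"
      using simple_functions_finitary[OF ab(3)] by blast
    have FG: "x \<in> pre (F \<union> G)" "y \<in> pre (F \<union> G)"
      using that ab F G simple_functions_mono[of F "F \<union> G"] simple_functions_mono[of G "F \<union> G"]
      unfolding pre_def by blast+
    show ?thesis
    proof (cases "F \<union> G = {}")
      case True then show ?thesis using FG by simp
    next
      case False
      then obtain m where m: "m \<in> F \<union> G" "\<And>x. x \<in> F \<union> G \<Longrightarrow> x = m \<or> lt x m"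
        using finite_has_greatest[of "F \<union> G" lt] F G trans tot by auto
      then have "F \<union> G \<subseteq> insert m (below m)" unfolding below_def by blast
      from pre_mono[OF this] show ?thesis using FG m(1) F(2) G(2) by blast
    qed
  qed
  have HD: "x \<in> pre D" if "x \<in> H" for x
  proof -
    have "\<delta> x \<in> simple_functions D" "\<delta> x - \<delta> x \<in> ?N"
      using that \<delta>D add_subgroup_zero[OF N] by auto
    then show ?thesis using that unfolding pre_def by blast
  qed
  have "add_retract H (pre {})"
  proof (rule add_retract_chain[where D = D and lt = lt and M = "\<lambda>e. pre (below e)"
        and L = "\<lambda>e. pre (insert e (below e))"])
    show "a = b \<or> lt a b \<or> lt b a" for a b using totalpD[OF tot] by blast
    show "pre {} \<subseteq> pre (below e)" for e by (rule pre_mono) simp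
    show "pre (insert e' (below e')) \<subseteq> pre (below e)" if "lt e' e" for e e'
      using that transpD[OF trans] unfolding below_def by (intro pre_mono) blast
    show "(x \<in> pre {} \<and> y \<in> pre {}) \<or>
        (\<exists>e'\<in>D. lt e' e \<and> x \<in> pre (insert e' (below e')) \<and> y \<in> pre (insert e' (below e')))"
      if "e \<in> D" "x \<in> pre (below e)" "y \<in> pre (below e)" for e x y
      using fin[OF that(2,3)] D[OF that(1)] unfolding below_def by blast
    show "(x \<in> pre {} \<and> y \<in> pre {}) \<or>
        (\<exists>e\<in>D. x \<in> pre (insert e (below e)) \<and> y \<in> pre (insert e (below e)))"
      if "x \<in> H" "y \<in> H" for x y
      by (rule fin[OF HD[OF that(1)] HD[OF that(2)]])
    fix e assume e: "e \<in> D"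
    let ?A = "simple_functions (below e)" and ?L = "pre (insert e (below e))"
    let ?J = "step_ideal (below e) e J"
    have J': "set_ideal ?J" by (rule set_ideal_step[OF J])
    \<comment> \<open>One coefficient is chosen for each x. The choice cannot be expected to be
      additive, but the defect is a coefficient of a function already represented without e, hence
      supported in the step ideal.\<close>
    have "\<forall>x\<in>?L. \<exists>b. b \<in> ?A \<and> (\<exists>a\<in>?A. \<delta> x - (a + restrict0 e b) \<in> ?N)"
      unfolding pre_def using simple_functions_insert by (smt (verit, best) mem_Collect_eq)
    from bchoice[OF this] obtain \<beta> where \<beta>: "\<And>x. x \<in> ?L \<Longrightarrow> \<beta> x \<in> ?A"
      and \<beta>': "\<And>x. x \<in> ?L \<Longrightarrow> \<exists>a\<in>?A. \<delta> x - (a + restrict0 e (\<beta> x)) \<in> ?N" by blast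
    have \<beta>_add: "additive_mod ?L (null_functions ?J) \<beta>"
      unfolding additive_mod_def
    proof (intro ballI)
      fix x y assume xy: "x \<in> ?L" "y \<in> ?L"
      then have s: "x + y \<in> ?L" using add_subgroup_add[OF pre] by blast
      obtain a where a: "a \<in> ?A" "\<delta> x - (a + restrict0 e (\<beta> x)) \<in> ?N" using \<beta>'[OF xy(1)] by blast
      obtain b where b: "b \<in> ?A" "\<delta> y - (b + restrict0 e (\<beta> y)) \<in> ?N" using \<beta>'[OF xy(2)] by blast
      obtain c where c: "c \<in> ?A" "\<delta> (x + y) - (c + restrict0 e (\<beta> (x + y))) \<in> ?N" using \<beta>'[OF s] by blast
      have 0: "\<delta> (x + y) - \<delta> x - \<delta> y \<in> ?N"
        using \<delta> xy unfolding additive_mod_def pre_def by blast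
      have "(\<delta> (x + y) - \<delta> x - \<delta> y) + (\<delta> x - (a + restrict0 e (\<beta> x))) + (\<delta> y - (b + restrict0 e (\<beta> y)))
          - (\<delta> (x + y) - (c + restrict0 e (\<beta> (x + y)))) \<in> ?N"
        by (rule add_subgroup_diff[OF N add_subgroup_add[OF N add_subgroup_add[OF N 0 a(2)] b(2)] c(2)])
      also have "(\<delta> (x + y) - \<delta> x - \<delta> y) + (\<delta> x - (a + restrict0 e (\<beta> x))) + (\<delta> y - (b + restrict0 e (\<beta> y)))
          - (\<delta> (x + y) - (c + restrict0 e (\<beta> (x + y)))) = restrict0 e (\<beta> (x + y) - \<beta> x - \<beta> y) - (a + b - c)"
        by (simp add: restrict0_diff restrict0_add algebra_simps)
      finally have "restrict0 e (\<beta> (x + y) - \<beta> x - \<beta> y) - (a + b - c) \<in> ?N" .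
      moreover have "a + b - c \<in> ?A"
        using a b c simple_functions_add simple_functions_diff by blast
      moreover have "\<beta> (x + y) - \<beta> x - \<beta> y \<in> ?A"
        using \<beta> xy s simple_functions_diff by blast
      ultimately show "\<beta> (x + y) - \<beta> x - \<beta> y \<in> null_functions ?J"
        using null_functions_step[OF J] by blast
    qed
    \<comment> \<open>An element drops below stage e exactly when the term with its coefficient can
      be rewritten without e, which is what the step ideal measures.\<close>
    have eq: "{x \<in> ?L. \<beta> x \<in> null_functions ?J} = pre (below e)"
    proof (rule subset_antisym; rule subsetI)
      fix x assume x: "x \<in> {x \<in> ?L. \<beta> x \<in> null_functions ?J}"
      obtain a where a: "a \<in> ?A" "\<delta> x - (a + restrict0 e (\<beta> x)) \<in> ?N" using \<beta>' x by blast
      obtain b where b: "b \<in> ?A" "restrict0 e (\<beta> x) - b \<in> ?N"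
        using null_functions_step[OF J \<beta>] x by blast
      have "\<delta> x - (a + b) \<in> ?N" using add_subgroup_add[OF N a(2) b(2)] by (simp add: algebra_simps)
      moreover have "a + b \<in> ?A" using a b simple_functions_add by blast
      ultimately show "x \<in> pre (below e)" using x unfolding pre_def by blast
    next
      fix x assume x: "x \<in> pre (below e)"
      then have xL: "x \<in> ?L" using pre_mono[of "below e" "insert e (below e)"] by blast
      obtain a where a: "a \<in> ?A" "\<delta> x - (a + restrict0 e (\<beta> x)) \<in> ?N" using \<beta>' xL by blast
      obtain b where b: "b \<in> ?A" "\<delta> x - b \<in> ?N" using x unfolding pre_def by blast
      have "restrict0 e (\<beta> x) - (b - a) \<in> ?N"
        using add_subgroup_diff[OF N b(2) a(2)] by (simp add: algebra_simps)
      moreover have "b - a \<in> ?A" using a b simple_functions_diff by blast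
      ultimately show "x \<in> {x \<in> ?L. \<beta> x \<in> null_functions ?J}"
        using null_functions_step[OF J \<beta>[OF xL]] xL by blast
    qed
    have "add_retract ?L {x \<in> ?L. \<beta> x \<in> null_functions ?J}"
      by (rule IH[OF e J' pre _ \<beta>_add]) (use \<beta> in \<open>auto simp: below_def\<close>)
    then show "add_retract ?L (pre (below e))" unfolding eq .
  qed (use wf pre in auto)
  moreover have sub: "{x \<in> H. \<delta> x \<in> ?N} \<subseteq> pre {}"
  proof
    fix x assume x: "x \<in> {x \<in> H. \<delta> x \<in> ?N}"
    then have "\<delta> x - 0 \<in> ?N" by simp
    then show "x \<in> pre {}" using x simple_functions_zero unfolding pre_def by blast
  qed
  moreover have "add_retract (pre {}) {x \<in> H. \<delta> x \<in> ?N}"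
    unfolding pre_def by (rule add_retract_constants[OF H J \<delta>])
  ultimately show ?thesis using sub add_retract_trans by blast
qed

text \<open>All subsets are taken as generators, so a function with finite range is automatically
  simple, and a well-order of the subsets provides the stages. Induction on e settles the segments
  below e; one further application of the step, with \<open>D\<close> everything, gives the
  result.\<close>

theorem null_functions_preimage_retract:
  fixes H :: "('t \<Rightarrow> int) set" and \<delta> :: "('t \<Rightarrow> int) \<Rightarrow> 'b \<Rightarrow> int"
  assumes J: "set_ideal J" and H: "add_subgroup H"
    and fin: "\<And>x. x \<in> H \<Longrightarrow> finite (range (\<delta> x))"
    and \<delta>: "additive_mod H (null_functions J) \<delta>"
  shows "add_retract H {x \<in> H. \<delta> x \<in> null_functions J}"
proof -
  obtain r :: "'b set rel" where r: "well_order_on UNIV r" using well_order_on by blast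
  define lt where "lt a b \<longleftrightarrow> (a, b) \<in> r - Id" for a b
  have "lt = (\<lambda>a b. (a, b) \<in> r - Id)" by (simp add: lt_def fun_eq_iff)
  then have wf: "wfp lt" using r unfolding well_order_on_def by (simp only: wfp_wf_eq)
  have lin: "trans r" "antisym r" "total_on UNIV r"
    using r unfolding well_order_on_def linear_order_on_def partial_order_on_def preorder_on_def by auto
  have trans: "transp lt"
    using trans_diff_Id[OF lin(1,2)] unfolding lt_def transp_def trans_def by blast
  have tot: "totalp lt" using lin(3) unfolding lt_def totalp_on_def total_on_def by auto
  have below: "add_retract H {x \<in> H. \<delta> x \<in> null_functions J}"
    if "set_ideal J" "add_subgroup H" "\<delta> ` H \<subseteq> simple_functions {e'. lt e' e}"
      "additive_mod H (null_functions J) \<delta>"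
    for e J and H :: "('t \<Rightarrow> int) set" and \<delta> :: "('t \<Rightarrow> int) \<Rightarrow> 'b \<Rightarrow> int"
    using wf that
  proof (induction e arbitrary: J H \<delta> rule: wfp_induct_rule)
    case (less e)
    show ?case
      by (rule simple_functions_retract_step[OF wf trans tot _ _ less.prems])
        (use less.IH transpD[OF trans] in blast)+
  qed
  show ?thesis
    by (rule simple_functions_retract_step[OF wf trans tot _ _ J H _ \<delta>, where D = UNIV])
      (use below fin in \<open>auto simp: simple_functions_gen_UNIV\<close>)
qed


section \<open>Tautness\<close>

fun list_coboundary :: "('a list \<Rightarrow> int) \<Rightarrow> 'a list \<Rightarrow> int" where
  "list_coboundary \<phi> [] = 0"
| "list_coboundary \<phi> (x # xs) = \<phi> xs - list_coboundary (\<lambda>ys. \<phi> (x # ys)) xs"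

text \<open>The face without the head is \<open>xs\<close> itself; every other face keeps the head
  and changes sign. The recursive form lets identities between alternating sums be proved by
  structural induction. It is the augmented coboundary: on \<open>[x]\<close> it takes the value
  \<phi> at the empty list.\<close>

lemma list_coboundary_sum:
  "list_coboundary \<phi> xs = (\<Sum>i<length xs. (-1) ^ i * \<phi> (take i xs @ drop (Suc i) xs))"
  by (induction xs arbitrary: \<phi>)
    (simp_all add: sum.lessThan_Suc_shift sum_negf del: sum.lessThan_Suc)

lemma list_coboundary_diff:
  "list_coboundary (\<lambda>ys. \<phi> ys - \<psi> ys) xs = list_coboundary \<phi> xs - list_coboundary \<psi> xs"
  by (induction xs arbitrary: \<phi> \<psi>) auto

lemma list_coboundary_uminus:
  "list_coboundary (\<lambda>ys. - \<phi> ys) xs = - list_coboundary \<phi> xs"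
  by (induction xs arbitrary: \<phi>) auto

lemma list_coboundary_add:
  "list_coboundary (\<lambda>ys. \<phi> ys + \<psi> ys) xs = list_coboundary \<phi> xs + list_coboundary \<psi> xs"
  by (induction xs arbitrary: \<phi> \<psi>) auto

lemma list_coboundary_map:
  "list_coboundary (\<lambda>ys. \<phi> (map r ys)) xs = list_coboundary \<phi> (map r xs)"
  by (induction xs arbitrary: \<phi>) (auto simp: o_def)

lemma list_coboundary_list_coboundary: "list_coboundary (list_coboundary \<phi>) xs = 0"
  by (induction xs arbitrary: \<phi>) (auto simp: list_coboundary_diff)

lemma list_coboundary_cong:
  assumes "\<And>ys. set ys \<subseteq> set xs \<Longrightarrow> Suc (length ys) = length xs \<Longrightarrow> \<phi> ys = \<psi> ys"
  shows "list_coboundary \<phi> xs = list_coboundary \<psi> xs"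
  unfolding list_coboundary_sum
proof (intro sum.cong refl arg_cong2[where f = "(*)"] assms)
  fix i assume "i \<in> {..<length xs}"
  then show "Suc (length (take i xs @ drop (Suc i) xs)) = length xs" by auto
  show "set (take i xs @ drop (Suc i) xs) \<subseteq> set xs"
    using set_take_subset set_drop_subset by fastforce
qed

lemma list_coboundary_vanish:
  assumes "\<And>ys. set ys \<subseteq> set xs \<Longrightarrow> Suc (length ys) = length xs \<Longrightarrow> \<phi> ys = 0"
  shows "list_coboundary \<phi> xs = 0"
proof -
  have "list_coboundary \<phi> xs = list_coboundary (\<lambda>_. 0) xs"
    by (rule list_coboundary_cong) (rule assms)
  also have "\<dots> = 0" by (simp add: list_coboundary_sum)
  finally show ?thesis .
qed

lemma list_coboundary_bound:
  assumes "\<And>ys. \<bar>\<phi> ys\<bar> \<le> B" shows "\<bar>list_coboundary \<phi> xs\<bar> \<le> int (length xs) * B"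
  using assms
proof (induction xs arbitrary: \<phi>)
  case (Cons x xs)
  have "\<bar>list_coboundary (\<lambda>ys. \<phi> (x # ys)) xs\<bar> \<le> int (length xs) * B"
    by (rule Cons.IH) (rule Cons.prems)
  moreover have "\<bar>\<phi> xs\<bar> \<le> B" by (rule Cons.prems)
  ultimately show ?case by (simp add: algebra_simps)
qed simp

text \<open>The prism operator, the alternating sum over i of \<phi> at (x_0, ..., x_i, r x_i, ...,
  r x_p). It makes sense for an arbitrary map r, continuous or not.\<close>

fun list_homotopy :: "('a \<Rightarrow> 'a) \<Rightarrow> ('a list \<Rightarrow> int) \<Rightarrow> 'a list \<Rightarrow> int" where
  "list_homotopy r \<phi> [] = 0"
| "list_homotopy r \<phi> (x # xs) =
     \<phi> (x # r x # map r xs) - list_homotopy r (\<lambda>ys. \<phi> (x # ys)) xs"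

lemma list_homotopy_diff:
  "list_homotopy r (\<lambda>ys. \<phi> ys - \<psi> ys) xs = list_homotopy r \<phi> xs - list_homotopy r \<psi> xs"
  by (induction xs arbitrary: \<phi> \<psi>) auto

text \<open>Pullback along r is chain homotopic to the identity. After splitting off the head x, the
  prism that doubles x is handled by naturality of the coboundary under \<open>map r\<close>, the
  others by the induction hypothesis for \<phi> with x prefixed.\<close>

lemma list_homotopy_identity:
  "list_coboundary (list_homotopy r \<phi>) xs + list_homotopy r (list_coboundary \<phi>) xs =
     \<phi> (map r xs) - \<phi> xs"
proof (induction xs arbitrary: \<phi>)
  case (Cons x xs)
  have "list_coboundary (\<lambda>ys. \<phi> (x # r x # map r ys)) xs =
      list_coboundary (\<lambda>ys. \<phi> (x # r x # ys)) (map r xs)"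
    by (rule list_coboundary_map)
  then show ?case
    using Cons[of "\<lambda>ys. \<phi> (x # ys)"]
    by (simp add: list_coboundary_diff list_homotopy_diff)
qed simp

lemma list_homotopy_vanish:
  assumes "\<And>ys. set ys \<subseteq> set xs \<union> r ` set xs \<Longrightarrow> length ys = Suc (length xs) \<Longrightarrow> \<phi> ys = 0"
  shows "list_homotopy r \<phi> xs = 0"
  using assms
proof (induction xs arbitrary: \<phi>)
  case (Cons x xs)
  have "list_homotopy r (\<lambda>ys. \<phi> (x # ys)) xs = 0"
    by (rule Cons.IH) (rule Cons.prems, auto)
  moreover have "\<phi> (x # r x # map r xs) = 0" by (rule Cons.prems) auto
  ultimately show ?case by simp
qed simp

lemma list_homotopy_bound:
  assumes "\<And>ys. \<bar>\<phi> ys\<bar> \<le> B" shows "\<bar>list_homotopy r \<phi> xs\<bar> \<le> int (length xs) * B"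
  using assms
proof (induction xs arbitrary: \<phi>)
  case (Cons x xs)
  have "\<bar>list_homotopy r (\<lambda>ys. \<phi> (x # ys)) xs\<bar> \<le> int (length xs) * B"
    by (rule Cons.IH) (rule Cons.prems)
  moreover have "\<bar>\<phi> (x # r x # map r xs)\<bar> \<le> B" by (rule Cons.prems)
  ultimately show ?case by (simp add: algebra_simps)
qed simp

lemma finite_range_int_iff: "finite (range \<phi>) \<longleftrightarrow> (\<exists>B::int. \<forall>x. \<bar>\<phi> x\<bar> \<le> B)"
proof
  assume "finite (range \<phi>)"
  then have "finite ((\<lambda>x. \<bar>\<phi> x\<bar>) ` UNIV)" by (metis finite_imageI image_image)
  then show "\<exists>B. \<forall>x. \<bar>\<phi> x\<bar> \<le> B" by (intro exI[of _ "Max (range (\<lambda>x. \<bar>\<phi> x\<bar>))"]) auto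
next
  assume "\<exists>B. \<forall>x. \<bar>\<phi> x\<bar> \<le> B"
  then obtain B where "\<forall>x. \<bar>\<phi> x\<bar> \<le> B" by blast
  then have "range \<phi> \<subseteq> {- B..B}" by (auto simp: abs_le_iff) (metis minus_le_iff)
  then show "finite (range \<phi>)" using finite_subset by blast
qed

lemma finite_range_restrict0: "finite (range \<phi>) \<Longrightarrow> finite (range (restrict0 A \<phi>))"
  by (rule finite_subset[of _ "insert 0 (range \<phi>)"]) (auto simp: restrict0_def)

text \<open>For integer functions finite range means boundedness, and on tuples of one fixed length
  the factor \<open>length xs\<close> in the bounds is a constant.\<close>

lemma finite_range_restrict0_list:
  assumes "finite (range \<phi>)" "\<And>B xs. (\<And>ys. \<bar>\<phi> ys\<bar> \<le> B) \<Longrightarrow> \<bar>\<psi> xs\<bar> \<le> int (length xs) * B"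
  shows "finite (range (restrict0 (tuples p A) \<psi>))"
proof -
  obtain B where B: "\<And>ys. \<bar>\<phi> ys\<bar> \<le> B" using assms(1) finite_range_int_iff by blast
  then have "0 \<le> B" using abs_ge_zero order_trans by blast
  then have "\<bar>restrict0 (tuples p A) \<psi> xs\<bar> \<le> int (Suc p) * B" for xs
    using assms(2)[OF B, of xs] by (auto simp: restrict0_def tuples_def)
  then show ?thesis using finite_range_int_iff by blast
qed

text \<open>Finitely many open sets \<open>W f\<close> cover \<open>S\<close>, each inside a closed
  \<open>C f\<close> inside a member of the cover. A point y is sent to some point of
  \<open>S\<close> that lies in every \<open>C f\<close> containing y, if there is one. Such a point
  is as close to y as the cover can detect.\<close>

lemma approximate_retraction:
  assumes X: "compact_space X" "Hausdorff_space X" and S: "closedin X S"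
    and \<V>: "\<And>V. V \<in> \<V> \<Longrightarrow> openin X V" "S \<subseteq> \<Union>\<V>"
  obtains r where "r ` topspace X \<subseteq> topspace X" "\<And>x. x \<in> S \<Longrightarrow> r x = x"
    "\<And>x. x \<in> S \<Longrightarrow> \<exists>U V. openin X U \<and> x \<in> U \<and> V \<in> \<V> \<and> U \<subseteq> V \<and> r ` U \<subseteq> V \<inter> S"
proof -
  have "neighbourhood_base_of (closedin X) X"
    using X compact_Hausdorff_imp_regular_space neighbourhood_base_of_closedin by blast
  then have "\<forall>x\<in>S. \<exists>W C V. openin X W \<and> closedin X C \<and> V \<in> \<V> \<and> x \<in> W \<and> W \<subseteq> C \<and> C \<subseteq> V"
    using \<V> unfolding neighbourhood_base_of by (metis Union_iff subsetD)
  from bchoice[OF this] obtain W where "\<forall>x\<in>S. \<exists>C V. openin X (W x) \<and> closedin X C \<and> V \<in> \<V> \<and>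
      x \<in> W x \<and> W x \<subseteq> C \<and> C \<subseteq> V" by blast
  from bchoice[OF this] obtain C where "\<forall>x\<in>S. \<exists>V. openin X (W x) \<and> closedin X (C x) \<and> V \<in> \<V> \<and>
      x \<in> W x \<and> W x \<subseteq> C x \<and> C x \<subseteq> V" by blast
  from bchoice[OF this] obtain V where WCV: "\<And>x. x \<in> S \<Longrightarrow> openin X (W x)"
    "\<And>x. x \<in> S \<Longrightarrow> closedin X (C x)" "\<And>x. x \<in> S \<Longrightarrow> V x \<in> \<V>" "\<And>x. x \<in> S \<Longrightarrow> x \<in> W x"
    "\<And>x. x \<in> S \<Longrightarrow> W x \<subseteq> C x" "\<And>x. x \<in> S \<Longrightarrow> C x \<subseteq> V x" by blast
  have "compactin X S" using X S closedin_compact_space by blast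
  then have "\<exists>\<F>. finite \<F> \<and> \<F> \<subseteq> W ` S \<and> S \<subseteq> \<Union>\<F>"
    by (rule compactinD) (use WCV in auto)
  then obtain F where F: "finite F" "F \<subseteq> S" "S \<subseteq> (\<Union>x\<in>F. W x)"
    by (metis finite_subset_image)
  define near where "near y t \<longleftrightarrow> t \<in> S \<and> (\<forall>f\<in>F. y \<in> C f \<longrightarrow> t \<in> C f)" for y t
  define r where "r y = (if y \<in> S then y else if \<exists>t. near y t then SOME t. near y t else y)" for y
  have near: "near y (r y)" if "\<exists>t. near y t" for y
  proof (cases "y \<in> S")
    case True then show ?thesis by (simp add: r_def near_def)
  next
    case False then show ?thesis using someI_ex[OF that] that by (simp add: r_def)
  qed
  have SX: "S \<subseteq> topspace X" using S by (rule closedin_subset)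
  show ?thesis
  proof (rule that[of r])
    show "r x = x" if "x \<in> S" for x using that by (simp add: r_def)
    show "r ` topspace X \<subseteq> topspace X"
    proof clarify
      fix y assume y: "y \<in> topspace X"
      show "r y \<in> topspace X"
      proof (cases "\<exists>t. near y t")
        case True then show ?thesis using near SX unfolding near_def by blast
      next
        case False then show ?thesis using y by (simp add: r_def)
      qed
    qed
    fix x assume x: "x \<in> S"
    then obtain f where f: "f \<in> F" "x \<in> W f" using F by blast
    \<comment> \<open>Removing the finitely many closed sets \<open>C g\<close> that miss x leaves
      an open set on which x itself is an admissible target: every \<open>C g\<close> containing a
      point of U also contains x.\<close>
    define U where "U = W f \<inter> (topspace X - \<Union>{C g |g. g \<in> F \<and> x \<notin> C g})"
    have fS: "f \<in> S" using f F by blast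
    have "closedin X (\<Union>{C g |g. g \<in> F \<and> x \<notin> C g})"
      by (rule closedin_Union) (use F WCV in auto)
    then have "openin X U" unfolding U_def using WCV(1)[OF fS] by blast
    moreover have "x \<in> U" unfolding U_def using f x SX by blast
    moreover have "U \<subseteq> V f" unfolding U_def using WCV(5,6)[OF fS] by blast
    moreover have "r ` U \<subseteq> V f \<inter> S"
    proof clarify
      fix y assume y: "y \<in> U"
      then have "near y x" unfolding near_def U_def using x by blast
      then have "near y (r y)" using near by blast
      moreover have "y \<in> C f" using y WCV(5)[OF fS] unfolding U_def by blast
      ultimately show "r y \<in> V f \<inter> S" using f WCV(6)[OF fS] unfolding near_def by blast
    qed
    ultimately show "\<exists>U V. openin X U \<and> x \<in> U \<and> V \<in> \<V> \<and> U \<subseteq> V \<and> r ` U \<subseteq> V \<inter> S"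
      using WCV(3)[OF fS] by blast
  qed
qed

text \<open>\<open>A\<close> is where the entries of the tuples live and \<open>B\<close> is where
  the neighborhoods are centered. Taking both equal to the space expresses the zero class on it,
  both equal to \<open>S\<close> the zero class on \<open>S\<close>, and the pair of the space and
  \<open>S\<close> the zero germ at \<open>S\<close>.\<close>

definition locally_zero ::
    "nat \<Rightarrow> 'a topology \<Rightarrow> 'a set \<Rightarrow> 'a set \<Rightarrow> ('a list \<Rightarrow> int) \<Rightarrow> bool" where
  "locally_zero p X A B \<phi> \<longleftrightarrow>
     (\<forall>x\<in>B. \<exists>V. openin X V \<and> x \<in> V \<and> (\<forall>xs\<in>tuples p (V \<inter> A). \<phi> xs = 0))"

lemma as_function_coboundary_list:
  "as_function_coboundary p X \<phi> = restrict0 (tuples (Suc p) (topspace X)) (list_coboundary \<phi>)"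
proof
  fix xs show "as_function_coboundary p X \<phi> xs = restrict0 (tuples (Suc p) (topspace X)) (list_coboundary \<phi>) xs"
  proof (cases "xs \<in> tuples (Suc p) (topspace X)")
    case True
    then have "{..<length xs} = {..Suc p}" by (auto simp: tuples_def)
    then show ?thesis using True
      by (simp add: as_function_coboundary_def restrict0_def list_coboundary_sum)
  qed (simp add: as_function_coboundary_def restrict0_def)
qed

text \<open>Choose r for the cover by open sets V on which \<phi> vanishes on tuples in
  \<open>S\<close> and its coboundary vanishes on all tuples. Near \<open>S\<close> the pullback of
  \<phi> along r and the homotopy of its coboundary are then zero, and the homotopy identity leaves
  \<phi> as the coboundary of minus its homotopy. This primitive vanishes locally on
  \<open>S\<close> because r fixes \<open>S\<close>, so that a prism over a tuple in
  \<open>S\<close> only repeats its entries.\<close>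

lemma tautness:
  assumes X: "compact_space X" "Hausdorff_space X" and S: "closedin X S"
    and fin: "finite (range \<phi>)" and \<phi>: "locally_zero p X S S \<phi>"
    and d\<phi>: "locally_zero (Suc p) X (topspace X) S (as_function_coboundary p X \<phi>)"
  shows "p = 0 \<Longrightarrow> locally_zero p X (topspace X) S \<phi>"
    and "p = Suc q \<Longrightarrow> \<exists>\<psi>. finite (range \<psi>) \<and> (\<forall>xs. xs \<notin> tuples q (topspace X) \<longrightarrow> \<psi> xs = 0) \<and>
           locally_zero q X S S \<psi> \<and>
           locally_zero p X (topspace X) S (\<phi> - as_function_coboundary q X \<psi>)"
proof -
  define \<V> where "\<V> = {V. openin X V \<and> (\<forall>xs\<in>tuples p (V \<inter> S). \<phi> xs = 0) \<and>
      (\<forall>xs\<in>tuples (Suc p) V. list_coboundary \<phi> xs = 0)}"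
  have "S \<subseteq> \<Union>\<V>"
  proof
    fix x assume x: "x \<in> S"
    obtain V where V: "openin X V" "x \<in> V" "\<forall>xs\<in>tuples p (V \<inter> S). \<phi> xs = 0"
      using \<phi> x unfolding locally_zero_def by blast
    obtain V' where V': "openin X V'" "x \<in> V'"
      "\<forall>xs\<in>tuples (Suc p) (V' \<inter> topspace X). as_function_coboundary p X \<phi> xs = 0"
      using d\<phi> x unfolding locally_zero_def by blast
    have "list_coboundary \<phi> xs = 0" if "xs \<in> tuples (Suc p) (V \<inter> V')" for xs
    proof -
      have "xs \<in> tuples (Suc p) (V' \<inter> topspace X)"
        using that openin_subset[OF V'(1)] by (auto simp: tuples_def)
      moreover from this have "xs \<in> tuples (Suc p) (topspace X)" by (auto simp: tuples_def)
      ultimately show ?thesis using V'(3) by (auto simp: as_function_coboundary_list restrict0_def)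
    qed
    then have "V \<inter> V' \<in> \<V>" unfolding \<V>_def using V V' by (auto simp: tuples_def)
    then show "x \<in> \<Union>\<V>" using V V' by blast
  qed
  moreover have "openin X V" if "V \<in> \<V>" for V using that by (simp add: \<V>_def)
  ultimately obtain r where r: "r ` topspace X \<subseteq> topspace X" "\<And>x. x \<in> S \<Longrightarrow> r x = x"
    "\<And>x. x \<in> S \<Longrightarrow> \<exists>U V. openin X U \<and> x \<in> U \<and> V \<in> \<V> \<and> U \<subseteq> V \<and> r ` U \<subseteq> V \<inter> S"
    using approximate_retraction[OF X S, of \<V>] by blast
  have key: "\<exists>U. openin X U \<and> x \<in> U \<and>
      (\<forall>xs\<in>tuples p U. \<phi> xs = - list_coboundary (list_homotopy r \<phi>) xs)" if x: "x \<in> S" for x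
  proof -
    obtain U V where UV: "openin X U" "x \<in> U" "V \<in> \<V>" "U \<subseteq> V" "r ` U \<subseteq> V \<inter> S"
      using r(3)[OF x] by blast
    have "\<phi> xs = - list_coboundary (list_homotopy r \<phi>) xs" if xs: "xs \<in> tuples p U" for xs
    proof -
      have "list_homotopy r (list_coboundary \<phi>) xs = 0"
      proof (rule list_homotopy_vanish)
        fix ys assume "set ys \<subseteq> set xs \<union> r ` set xs" "length ys = Suc (length xs)"
        moreover have "set xs \<union> r ` set xs \<subseteq> V" using xs UV unfolding tuples_def by blast
        ultimately have "ys \<in> tuples (Suc p) V" using xs by (auto simp: tuples_def)
        then show "list_coboundary \<phi> ys = 0" using UV(3) by (simp add: \<V>_def)
      qed
      moreover have "r ` set xs \<subseteq> V \<inter> S" using xs UV unfolding tuples_def by blast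
      then have "map r xs \<in> tuples p (V \<inter> S)" using xs by (simp add: tuples_def)
      then have "\<phi> (map r xs) = 0" using UV(3) by (simp add: \<V>_def)
      ultimately show ?thesis using list_homotopy_identity[of r \<phi> xs] by simp
    qed
    then show ?thesis using UV by blast
  qed
  show "locally_zero p X (topspace X) S \<phi>" if p: "p = 0"
    unfolding locally_zero_def
  proof
    fix x assume "x \<in> S"
    then obtain U where U: "openin X U" "x \<in> U"
      "\<forall>xs\<in>tuples p U. \<phi> xs = - list_coboundary (list_homotopy r \<phi>) xs" using key by blast
    have "\<phi> xs = 0" if xs: "xs \<in> tuples p (U \<inter> topspace X)" for xs
    proof -
      have "xs \<in> tuples p U" using xs by (auto simp: tuples_def)
      \<comment> \<open>The only face of a one-entry list is \<open>[]\<close>, where the homotopy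
        is 0 by definition.\<close>
      moreover have "list_coboundary (list_homotopy r \<phi>) xs = 0"
        by (rule list_coboundary_vanish) (use xs p in \<open>auto simp: tuples_def\<close>)
      ultimately show ?thesis using U by simp
    qed
    then show "\<exists>V. openin X V \<and> x \<in> V \<and> (\<forall>xs\<in>tuples p (V \<inter> topspace X). \<phi> xs = 0)"
      using U by blast
  qed
  show "\<exists>\<psi>. finite (range \<psi>) \<and> (\<forall>xs. xs \<notin> tuples q (topspace X) \<longrightarrow> \<psi> xs = 0) \<and>
           locally_zero q X S S \<psi> \<and>
           locally_zero p X (topspace X) S (\<phi> - as_function_coboundary q X \<psi>)" if p: "p = Suc q"
  proof (intro exI conjI)
    let ?\<psi> = "restrict0 (tuples q (topspace X)) (\<lambda>xs. - list_homotopy r \<phi> xs)"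
    show "finite (range ?\<psi>)"
      by (rule finite_range_restrict0_list[OF fin]) (simp add: list_homotopy_bound)
    show "\<forall>xs. xs \<notin> tuples q (topspace X) \<longrightarrow> ?\<psi> xs = 0" by (simp add: restrict0_def)
    show "locally_zero q X S S ?\<psi>"
      unfolding locally_zero_def
    proof
      fix x assume x: "x \<in> S"
      obtain V where V: "openin X V" "x \<in> V" "\<forall>xs\<in>tuples p (V \<inter> S). \<phi> xs = 0"
        using \<phi> x unfolding locally_zero_def by blast
      have "?\<psi> xs = 0" if xs: "xs \<in> tuples q (V \<inter> S)" for xs
      proof -
        have "list_homotopy r \<phi> xs = 0"
        proof (rule list_homotopy_vanish)
          fix ys assume ys: "set ys \<subseteq> set xs \<union> r ` set xs" "length ys = Suc (length xs)"
          have "r ` set xs \<subseteq> set xs" using xs r(2) by (auto simp: tuples_def)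
          then have "set ys \<subseteq> set xs" using ys by blast
          then have "ys \<in> tuples p (V \<inter> S)" using ys xs p by (auto simp: tuples_def)
          then show "\<phi> ys = 0" using V(3) by blast
        qed
        then show ?thesis by (simp add: restrict0_def)
      qed
      then show "\<exists>V. openin X V \<and> x \<in> V \<and> (\<forall>xs\<in>tuples q (V \<inter> S). ?\<psi> xs = 0)" using V by blast
    qed
    show "locally_zero p X (topspace X) S (\<phi> - as_function_coboundary q X ?\<psi>)"
      unfolding locally_zero_def
    proof
      fix x assume "x \<in> S"
      then obtain U where U: "openin X U" "x \<in> U"
        "\<forall>xs\<in>tuples p U. \<phi> xs = - list_coboundary (list_homotopy r \<phi>) xs" using key by blast
      have "(\<phi> - as_function_coboundary q X ?\<psi>) xs = 0" if xs: "xs \<in> tuples p (U \<inter> topspace X)" for xs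
      proof -
        have xs': "xs \<in> tuples p U" "xs \<in> tuples p (topspace X)" using xs by (auto simp: tuples_def)
        \<comment> \<open>Cutting off to tuples of the space is invisible here, since all faces of
          \<open>xs\<close> are such tuples.\<close>
        have "list_coboundary ?\<psi> xs = list_coboundary (\<lambda>xs. - list_homotopy r \<phi> xs) xs"
          by (rule list_coboundary_cong) (use xs' p in \<open>auto simp: restrict0_def tuples_def\<close>)
        then show ?thesis
          using xs' U p by (simp add: as_function_coboundary_list restrict0_def list_coboundary_uminus)
      qed
      then show "\<exists>V. openin X V \<and> x \<in> V \<and>
          (\<forall>xs\<in>tuples p (V \<inter> topspace X). (\<phi> - as_function_coboundary q X ?\<psi>) xs = 0)"
        using U by blast
    qed
  qed
qed


section \<open>The dual complexes of a compact pair\<close>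

lemma as_function_coboundary_add:
  "as_function_coboundary p X (\<phi> + \<psi>) = as_function_coboundary p X \<phi> + as_function_coboundary p X \<psi>"
  by (auto simp: as_function_coboundary_list restrict0_def list_coboundary_add fun_eq_iff plus_fun_def)

lemma as_function_coboundary_diff:
  "as_function_coboundary p X (\<phi> - \<psi>) = as_function_coboundary p X \<phi> - as_function_coboundary p X \<psi>"
  by (auto simp: as_function_coboundary_list restrict0_def list_coboundary_diff fun_eq_iff fun_diff_def)

lemma as_function_coboundary_restrict0:
  "as_function_coboundary p (subtopology X A) (restrict0 (tuples p A) \<phi>) =
     restrict0 (tuples (Suc p) A) (as_function_coboundary p X \<phi>)" if "A \<subseteq> topspace X"
proof
  fix xs
  have "list_coboundary (restrict0 (tuples p A) \<phi>) xs = list_coboundary \<phi> xs"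
    if "xs \<in> tuples (Suc p) A"
    by (rule list_coboundary_cong) (use that in \<open>auto simp: restrict0_def tuples_def\<close>)
  moreover have "xs \<in> tuples (Suc p) (topspace X)" if "xs \<in> tuples (Suc p) A"
    using that \<open>A \<subseteq> topspace X\<close> by (auto simp: tuples_def)
  moreover have "topspace (subtopology X A) = A" using that by auto
  ultimately show "as_function_coboundary p (subtopology X A) (restrict0 (tuples p A) \<phi>) xs =
     restrict0 (tuples (Suc p) A) (as_function_coboundary p X \<phi>) xs"
    by (simp add: as_function_coboundary_list restrict0_def)
qed

lemma as_function_coboundary_twice:
  "as_function_coboundary (Suc p) X (as_function_coboundary p X \<phi>) = 0"
proof
  fix xs
  have "list_coboundary (restrict0 (tuples (Suc p) (topspace X)) (list_coboundary \<phi>)) xs =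
      list_coboundary (list_coboundary \<phi>) xs" if "xs \<in> tuples (Suc (Suc p)) (topspace X)"
    by (rule list_coboundary_cong) (use that in \<open>auto simp: restrict0_def tuples_def\<close>)
  then show "as_function_coboundary (Suc p) X (as_function_coboundary p X \<phi>) xs = 0 xs"
    by (simp add: as_function_coboundary_list restrict0_def list_coboundary_list_coboundary)
qed

text \<open>There is no support condition: supports are closed, hence compact when the space is, and
  then these functions represent all cochains.\<close>

definition as_functions :: "nat \<Rightarrow> 'a topology \<Rightarrow> ('a list \<Rightarrow> int) set" where
  "as_functions p X = {\<phi>. (\<forall>xs. xs \<notin> tuples p (topspace X) \<longrightarrow> \<phi> xs = 0) \<and> finite (range \<phi>)}"

lemma as_functions_subgroup: "add_subgroup (as_functions p X)"
  by (auto simp: add_subgroup_def as_functions_def zero_fun_def fun_diff_def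
      intro: finite_range_binop[where h = "(-)"])

lemma as_functions_coboundary:
  assumes "\<phi> \<in> as_functions p X" shows "as_function_coboundary p X \<phi> \<in> as_functions (Suc p) X"
proof -
  have "finite (range \<phi>)" using assms by (simp add: as_functions_def)
  then have "finite (range (as_function_coboundary p X \<phi>))"
    unfolding as_function_coboundary_list
    by (rule finite_range_restrict0_list) (rule list_coboundary_bound)
  then show ?thesis by (simp add: as_functions_def as_function_coboundary_list restrict0_def)
qed

text \<open>Being locally zero is a condition on the set of tuples where a function is nonzero.
  Expressing it by an ideal brings cochains under the splitting theorem.\<close>

definition vanishing_ideal :: "nat \<Rightarrow> 'a topology \<Rightarrow> 'a set \<Rightarrow> 'a set \<Rightarrow> 'a list set set" where
  "vanishing_ideal p X A B =
     {Z. \<forall>x\<in>B. \<exists>V. openin X V \<and> x \<in> V \<and> (\<forall>xs\<in>tuples p (V \<inter> A). xs \<notin> Z)}"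

lemma set_ideal_vanishing:
  assumes "B \<subseteq> topspace X" shows "set_ideal (vanishing_ideal p X A B)"
  unfolding set_ideal_def
proof (intro conjI ballI allI impI)
  show "{} \<in> vanishing_ideal p X A B"
    using assms by (auto simp: vanishing_ideal_def intro!: exI[of _ "topspace X"])
  fix Y assume Y: "Y \<in> vanishing_ideal p X A B"
  show "Z \<in> vanishing_ideal p X A B" if "Z \<subseteq> Y" for Z
    using Y that unfolding vanishing_ideal_def by blast
  fix Z assume Z: "Z \<in> vanishing_ideal p X A B"
  show "Y \<union> Z \<in> vanishing_ideal p X A B"
    unfolding vanishing_ideal_def
  proof (intro CollectI ballI)
    fix x assume "x \<in> B"
    then obtain V V' where "openin X V" "x \<in> V" "\<forall>xs\<in>tuples p (V \<inter> A). xs \<notin> Y"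
      "openin X V'" "x \<in> V'" "\<forall>xs\<in>tuples p (V' \<inter> A). xs \<notin> Z"
      using Y Z unfolding vanishing_ideal_def by blast
    then show "\<exists>V. openin X V \<and> x \<in> V \<and> (\<forall>xs\<in>tuples p (V \<inter> A). xs \<notin> Y \<union> Z)"
      by (intro exI[of _ "V \<inter> V'"]) (auto simp: tuples_def)
  qed
qed

lemma locally_zero_null_functions:
  "locally_zero p X A B \<phi> \<longleftrightarrow> \<phi> \<in> null_functions (vanishing_ideal p X A B)"
  by (auto simp: locally_zero_def null_functions_def vanishing_ideal_def)

lemma locally_zero_diff:
  assumes "B \<subseteq> topspace X" "locally_zero p X A B \<phi>" "locally_zero p X A B \<psi>"
  shows "locally_zero p X A B (\<phi> - \<psi>)"
  using null_functions_subgroup[OF set_ideal_vanishing[OF assms(1)]] assms(2,3)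
  unfolding locally_zero_null_functions by (rule add_subgroup_diff)

lemma locally_zero_coboundary:
  assumes "locally_zero p X A B \<phi>"
  shows "locally_zero (Suc p) X A B (as_function_coboundary p X \<phi>)"
  unfolding locally_zero_def
proof
  fix x assume "x \<in> B"
  then obtain V where V: "openin X V" "x \<in> V" "\<forall>xs\<in>tuples p (V \<inter> A). \<phi> xs = 0"
    using assms unfolding locally_zero_def by blast
  have "list_coboundary \<phi> xs = 0" if xs: "xs \<in> tuples (Suc p) (V \<inter> A)" for xs
  proof (rule list_coboundary_vanish)
    fix ys assume "set ys \<subseteq> set xs" "Suc (length ys) = length xs"
    then have "ys \<in> tuples p (V \<inter> A)" using xs by (auto simp: tuples_def)
    then show "\<phi> ys = 0" using V(3) by blast
  qed
  then show "\<exists>V. openin X V \<and> x \<in> V \<and> (\<forall>xs\<in>tuples (Suc p) (V \<inter> A). as_function_coboundary p X \<phi> xs = 0)"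
    using V by (intro exI[of _ V]) (auto simp: as_function_coboundary_list restrict0_def)
qed

definition local_null :: "nat \<Rightarrow> 'a topology \<Rightarrow> 'a set \<Rightarrow> 'a set \<Rightarrow> ('a list \<Rightarrow> int) set" where
  "local_null p X A B = {\<phi> \<in> as_functions p X. locally_zero p X A B \<phi>}"

lemma local_null_subgroup:
  assumes "B \<subseteq> topspace X" shows "add_subgroup (local_null p X A B)"
  using null_functions_subgroup[OF set_ideal_vanishing[OF assms, of p A]] as_functions_subgroup[of p X]
  unfolding add_subgroup_def local_null_def locally_zero_null_functions by blast

lemma local_null_coboundary:
  "\<phi> \<in> local_null p X A B \<Longrightarrow> as_function_coboundary p X \<phi> \<in> local_null (Suc p) X A B"
  by (simp add: local_null_def locally_zero_coboundary as_functions_coboundary)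

text \<open>Applied with the identity as \<delta> to split off null functions, and with the
  coboundary to split off cocycles.\<close>

lemma local_null_retract:
  assumes "B \<subseteq> topspace X" "add_subgroup H"
    and fin: "\<And>x. x \<in> H \<Longrightarrow> \<delta> x \<in> as_functions p X"
    and \<delta>: "additive_on H \<delta>"
  shows "add_retract H {x \<in> H. \<delta> (x :: 't \<Rightarrow> int) \<in> local_null p X A B}"
proof -
  have J: "set_ideal (vanishing_ideal p X A B)" by (rule set_ideal_vanishing[OF assms(1)])
  have eq: "{x \<in> H. \<delta> x \<in> local_null p X A B} =
      {x \<in> H. \<delta> x \<in> null_functions (vanishing_ideal p X A B)}"
    using fin unfolding local_null_def locally_zero_null_functions by blast
  show ?thesis unfolding eq
  proof (rule null_functions_preimage_retract[OF J assms(2)])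
    show "finite (range (\<delta> x))" if "x \<in> H" for x using fin[OF that] by (simp add: as_functions_def)
    show "additive_mod H (null_functions (vanishing_ideal p X A B)) \<delta>"
      using \<delta> add_subgroup_zero[OF null_functions_subgroup[OF J]]
      by (simp add: additive_mod_def additive_on_def)
  qed
qed

locale compact_pair =
  fixes X :: "'a topology" and S :: "'a set"
  assumes compact: "compact_space X" and Hausdorff: "Hausdorff_space X" and closed: "closedin X S"
begin

text \<open>
  \<open>N \<subseteq> W \<subseteq> T \<subseteq> F\<close>, where \<open>F/N = C(X)\<close>, \<open>W/N = C\<^sub>c(X - S)\<close>, \<open>F/T = C(S)\<close>, and \<open>F/W\<close> consists of germs
  at \<open>S\<close>; \<open>W\<close> and \<open>T\<close> differ because a function may vanish on tuples in \<open>S\<close> without vanishing on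
  nearby tuples with some entries outside \<open>S\<close>.
\<close>

abbreviation "F p \<equiv> as_functions p X"
abbreviation "N p \<equiv> local_null p X (topspace X) (topspace X)"
abbreviation "W p \<equiv> local_null p X (topspace X) S"
abbreviation "T p \<equiv> local_null p X S S"
abbreviation "\<delta> p \<equiv> as_function_coboundary p X"

lemma S_subset: "S \<subseteq> topspace X"
  using closed by (rule closedin_subset)

lemma N_W: "N p \<subseteq> W p"
  using S_subset by (auto simp: local_null_def locally_zero_def)

lemma W_T: "W p \<subseteq> T p"
proof -
  have "tuples p (V \<inter> S) \<subseteq> tuples p (V \<inter> topspace X)" for V
    using S_subset by (auto simp: tuples_def)
  then show ?thesis unfolding local_null_def locally_zero_def by blast
qed

lemma T_F: "T p \<subseteq> F p"
  by (auto simp: local_null_def)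

lemma W_F: "W p \<subseteq> F p"
  by (auto simp: local_null_def)

lemmas F_group = as_functions_subgroup[of _ X]
lemmas W_group = local_null_subgroup[OF S_subset, of _ "topspace X"]
lemmas T_group = local_null_subgroup[OF S_subset, of _ S]

lemma W_retract: "add_retract (F p) (W p)"
proof -
  have "add_retract (F p) {x \<in> F p. x \<in> W p}"
    by (rule local_null_retract[OF S_subset F_group]) (auto simp: additive_on_def)
  moreover have "{x \<in> F p. x \<in> W p} = W p" using W_F by blast
  ultimately show ?thesis by simp
qed

lemma T_retract: "add_retract (F p) (T p)"
proof -
  have "add_retract (F p) {x \<in> F p. x \<in> T p}"
    by (rule local_null_retract[OF S_subset F_group]) (auto simp: additive_on_def)
  moreover have "{x \<in> F p. x \<in> T p} = T p" using T_F by blast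
  ultimately show ?thesis by simp
qed

text \<open>These are the functions representing cocycles of the complex \<open>T/W\<close>. A
  functional defined on them through primitives has to be extended to all of
  \<open>F\<close>.\<close>

lemma relative_cocycles_retract: "add_retract (F p) {x \<in> T p. \<delta> p x \<in> W (Suc p)}"
proof (rule add_retract_trans[OF T_retract])
  show "add_retract (T p) {x \<in> T p. \<delta> p x \<in> W (Suc p)}"
    by (rule local_null_retract[OF S_subset T_group])
      (use T_F in \<open>auto simp: additive_on_def as_function_coboundary_add intro: as_functions_coboundary\<close>)
qed blast

lemma taut_0:
  assumes "\<phi> \<in> T 0" "\<delta> 0 \<phi> \<in> W (Suc 0)" shows "\<phi> \<in> W 0"
  using tautness(1)[OF compact Hausdorff closed, of \<phi> 0] assms
  by (auto simp: local_null_def as_functions_def)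

text \<open>Together with the case of degree 0: the complex \<open>T/W\<close> of germs at
  \<open>S\<close> that restrict to zero on \<open>S\<close> is exact.\<close>

lemma taut_Suc:
  assumes "\<phi> \<in> T (Suc p)" "\<delta> (Suc p) \<phi> \<in> W (Suc (Suc p))"
  obtains \<psi> where "\<psi> \<in> T p" "\<phi> - \<delta> p \<psi> \<in> W (Suc p)"
proof -
  obtain \<psi> where \<psi>: "finite (range \<psi>)" "\<forall>xs. xs \<notin> tuples p (topspace X) \<longrightarrow> \<psi> xs = 0"
    "locally_zero p X S S \<psi>" "locally_zero (Suc p) X (topspace X) S (\<phi> - \<delta> p \<psi>)"
    using tautness(2)[OF compact Hausdorff closed, of \<phi> "Suc p" p] assms
    by (auto simp: local_null_def as_functions_def)
  then have T: "\<psi> \<in> T p" by (simp add: local_null_def as_functions_def)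
  have "\<phi> - \<delta> p \<psi> \<in> F (Suc p)"
    using assms(1) T T_F by (intro add_subgroup_diff[OF F_group] as_functions_coboundary) blast+
  then show ?thesis using that[OF T] \<psi>(4) by (simp add: local_null_def)
qed

text \<open>Exactness of the dual complex \<open>Hom(F/K, \<int>)\<close> in degree \<open>p\<close>.\<close>

definition dual_acyclic :: "nat \<Rightarrow> (nat \<Rightarrow> ('a list \<Rightarrow> int) set) \<Rightarrow> bool" where
  "dual_acyclic p K \<longleftrightarrow>
     (\<forall>f :: ('a list \<Rightarrow> int) \<Rightarrow> int. additive_on (F p) f \<longrightarrow> (\<forall>\<phi>\<in>K p. f \<phi> = 0) \<longrightarrow>
        (\<forall>q. p = Suc q \<longrightarrow> (\<forall>\<phi>\<in>F q. f (\<delta> q \<phi>) = 0)) \<longrightarrow>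
        (\<exists>g. additive_on (F (Suc p)) g \<and> (\<forall>\<phi>\<in>K (Suc p). g \<phi> = 0) \<and> (\<forall>\<phi>\<in>F p. f \<phi> = g (\<delta> p \<phi>))))"

lemma dual_acyclicD:
  fixes f :: "('a list \<Rightarrow> int) \<Rightarrow> int"
  assumes "dual_acyclic p K" "additive_on (F p) f" "\<And>\<phi>. \<phi> \<in> K p \<Longrightarrow> f \<phi> = 0"
    "\<And>q \<phi>. p = Suc q \<Longrightarrow> \<phi> \<in> F q \<Longrightarrow> f (\<delta> q \<phi>) = 0"
  obtains g :: "('a list \<Rightarrow> int) \<Rightarrow> int" where "additive_on (F (Suc p)) g"
    "\<And>\<phi>. \<phi> \<in> K (Suc p) \<Longrightarrow> g \<phi> = 0" "\<And>\<phi>. \<phi> \<in> F p \<Longrightarrow> f \<phi> = g (\<delta> p \<phi>)"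
  using assms unfolding dual_acyclic_def by metis

lemma additive_on_coboundary:
  "additive_on (F (Suc p)) g \<Longrightarrow> additive_on (F p) (\<lambda>\<phi>. g (\<delta> p \<phi>))"
  by (auto simp: additive_on_def as_function_coboundary_add as_functions_coboundary)

text \<open>Dualizes the short exact sequence of \<open>T/W\<close>, \<open>F/W\<close> and
  \<open>F/T\<close>. Since \<open>T/W\<close> is exact, f vanishes on its cocycles, so on
  \<open>T\<close> it depends only on the coboundary; this dependence extends to a functional
  \<open>g1\<close> on \<open>F\<close>. The remainder, f minus \<open>g1\<close> after the
  coboundary, kills \<open>T\<close>, and acyclicity for \<open>T\<close> supplies
  \<open>g2\<close>.\<close>

lemma dual_acyclic_taut:
  assumes "dual_acyclic p T" shows "dual_acyclic p W"
  unfolding dual_acyclic_def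
proof (intro allI impI)
  fix f :: "('a list \<Rightarrow> int) \<Rightarrow> int"
  assume f: "additive_on (F p) f" and fW: "\<forall>\<phi>\<in>W p. f \<phi> = 0"
    and cyc: "\<forall>q. p = Suc q \<longrightarrow> (\<forall>\<phi>\<in>F q. f (\<delta> q \<phi>) = 0)"
  \<comment> \<open>By tautness \<psi> is a coboundary up to an element of \<open>W\<close>, and f
    kills both.\<close>
  have kill: "f \<psi> = 0" if \<psi>: "\<psi> \<in> T p" "\<delta> p \<psi> \<in> W (Suc p)" for \<psi>
  proof (cases p)
    case 0
    then show ?thesis using taut_0 \<psi> fW by simp
  next
    case (Suc q)
    then obtain \<psi>' where \<psi>': "\<psi>' \<in> T q" "\<psi> - \<delta> q \<psi>' \<in> W p" using taut_Suc \<psi> by blast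
    have F: "\<psi> \<in> F p" "\<delta> q \<psi>' \<in> F p" using \<psi> \<psi>' T_F Suc as_functions_coboundary by blast+
    then have "f (\<psi> - \<delta> q \<psi>') = f \<psi> - f (\<delta> q \<psi>')"
      using additive_on_diff[OF f F_group] by blast
    moreover have "f (\<delta> q \<psi>') = 0" using cyc Suc \<psi>' T_F by blast
    ultimately show ?thesis using fW \<psi>' by simp
  qed
  let ?Z = "{x \<in> T (Suc p). \<delta> (Suc p) x \<in> W (Suc (Suc p))}"
  have "\<forall>x\<in>?Z. \<exists>\<psi>. \<psi> \<in> T p \<and> x - \<delta> p \<psi> \<in> W (Suc p)" using taut_Suc by blast
  from bchoice[OF this] obtain h where h: "\<And>x. x \<in> ?Z \<Longrightarrow> h x \<in> T p"
    "\<And>x. x \<in> ?Z \<Longrightarrow> x - \<delta> p (h x) \<in> W (Suc p)" by blast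
  have Z: "add_subgroup ?Z"
    unfolding add_subgroup_def
    using T_group[of "Suc p"] W_group[of "Suc (Suc p)"] add_subgroup_zero[OF T_group[of "Suc p"]]
      add_subgroup_zero[OF W_group[of "Suc (Suc p)"]]
      as_function_coboundary_diff[of "Suc p" X 0 0]
    by (auto simp: as_function_coboundary_diff intro: add_subgroup_diff)
  \<comment> \<open>Two primitives of x differ by a relative cocycle, which f kills; so the value
    does not depend on the choice h, although h itself need not be additive.\<close>
  have wd: "f (h x) = f \<psi>" if "x \<in> ?Z" "\<psi> \<in> T p" "x - \<delta> p \<psi> \<in> W (Suc p)" for x \<psi>
  proof -
    have "\<delta> p (h x - \<psi>) = (x - \<delta> p \<psi>) - (x - \<delta> p (h x))"
      by (simp add: as_function_coboundary_diff)
    then have "\<delta> p (h x - \<psi>) \<in> W (Suc p)"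
      using add_subgroup_diff[OF W_group that(3) h(2)[OF that(1)]] by simp
    then have "f (h x - \<psi>) = 0" using kill add_subgroup_diff[OF T_group h(1)[OF that(1)] that(2)] by blast
    then show ?thesis using additive_on_diff[OF f F_group, of "h x" \<psi>] h(1)[OF that(1)] that(2) T_F by auto
  qed
  have "additive_on ?Z (\<lambda>x. f (h x))"
    unfolding additive_on_def
  proof (intro ballI)
    fix x y assume xy: "x \<in> ?Z" "y \<in> ?Z"
    have "x + y - \<delta> p (h x + h y) = (x - \<delta> p (h x)) + (y - \<delta> p (h y))"
      by (simp add: as_function_coboundary_add)
    then have "x + y - \<delta> p (h x + h y) \<in> W (Suc p)"
      using add_subgroup_add[OF W_group h(2)[OF xy(1)] h(2)[OF xy(2)]] by (simp only:)
    then have "f (h (x + y)) = f (h x + h y)"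
      using wd[OF add_subgroup_add[OF Z xy]] add_subgroup_add[OF T_group h(1)[OF xy(1)] h(1)[OF xy(2)]]
      by blast
    also have "\<dots> = f (h x) + f (h y)"
      by (rule additive_onD[OF f]) (use h(1) xy T_F in blast)+
    finally show "f (h (x + y)) = f (h x) + f (h y)" .
  qed
  from add_retract_extension[OF relative_cocycles_retract _ this]
  obtain g1 where g1: "additive_on (F (Suc p)) g1" "\<And>x. x \<in> ?Z \<Longrightarrow> g1 x = f (h x)"
    using T_F by blast
  have dd: "\<delta> (Suc p) (\<delta> p \<psi>) \<in> W (Suc (Suc p))" for \<psi>
    using add_subgroup_zero[OF W_group] by (simp add: as_function_coboundary_twice)
  have g1_d: "g1 (\<delta> p \<psi>) = f \<psi>" if "\<psi> \<in> T p" for \<psi>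
  proof -
    have Z: "\<delta> p \<psi> \<in> ?Z" using dd local_null_coboundary[OF that] by blast
    have "\<delta> p \<psi> - \<delta> p \<psi> \<in> W (Suc p)" using add_subgroup_zero[OF W_group] by simp
    then show ?thesis using wd[OF Z that] g1(2)[OF Z] by simp
  qed
  have g1_W: "g1 x = 0" if "x \<in> W (Suc p)" for x
  proof -
    have Z: "x \<in> ?Z" using that W_T local_null_coboundary[OF that] by blast
    have "\<delta> p 0 = 0" using as_function_coboundary_diff[of p X 0 0] by simp
    then have "x - \<delta> p 0 \<in> W (Suc p)" using that by simp
    then have "f (h x) = f 0" using wd[OF Z add_subgroup_zero[OF T_group]] by blast
    then show ?thesis using g1(2)[OF Z] additive_on_zero[OF f F_group] by simp
  qed
  obtain g2 :: "('a list \<Rightarrow> int) \<Rightarrow> int" where g2: "additive_on (F (Suc p)) g2" "\<And>\<phi>. \<phi> \<in> T (Suc p) \<Longrightarrow> g2 \<phi> = 0"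
    "\<And>\<phi>. \<phi> \<in> F p \<Longrightarrow> f \<phi> - g1 (\<delta> p \<phi>) = g2 (\<delta> p \<phi>)"
  proof (rule dual_acyclicD[OF assms, of "\<lambda>\<phi>. f \<phi> - g1 (\<delta> p \<phi>)"])
    show "additive_on (F p) (\<lambda>\<phi>. f \<phi> - g1 (\<delta> p \<phi>))"
      by (rule additive_on_minus[OF f additive_on_coboundary[OF g1(1)]])
    show "f \<phi> - g1 (\<delta> p \<phi>) = 0" if "\<phi> \<in> T p" for \<phi> using g1_d[OF that] by simp
    show "f (\<delta> q \<phi>) - g1 (\<delta> p (\<delta> q \<phi>)) = 0" if "p = Suc q" "\<phi> \<in> F q" for q \<phi>
      using cyc that additive_on_zero[OF g1(1) F_group] by (simp add: as_function_coboundary_twice)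
  qed blast
  show "\<exists>g. additive_on (F (Suc p)) g \<and> (\<forall>\<phi>\<in>W (Suc p). g \<phi> = 0) \<and> (\<forall>\<phi>\<in>F p. f \<phi> = g (\<delta> p \<phi>))"
    using additive_on_add[OF g1(1) g2(1)] g1_W g2(2,3) W_T
    by (intro exI[of _ "\<lambda>\<phi>. g1 \<phi> + g2 \<phi>"]) force
qed

text \<open>If the restriction of a cycle f to \<open>W\<close> bounds h, extend h to h' on
  \<open>F\<close>. Then f minus h' after the coboundary kills \<open>W\<close>, so it is a cycle in
  the dual of \<open>F/W\<close> and bounds there.\<close>

lemma restriction_injective:
  fixes f h :: "('a list \<Rightarrow> int) \<Rightarrow> int"
  assumes acyc: "dual_acyclic p W"
    and f: "additive_on (F p) f"
    and cyc: "\<And>q \<phi>. p = Suc q \<Longrightarrow> \<phi> \<in> F q \<Longrightarrow> f (\<delta> q \<phi>) = 0"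
    and h: "additive_on (W (Suc p)) h" "\<And>\<phi>. \<phi> \<in> N (Suc p) \<Longrightarrow> h \<phi> = 0"
    and fh: "\<And>\<phi>. \<phi> \<in> W p \<Longrightarrow> f \<phi> = h (\<delta> p \<phi>)"
  obtains g :: "('a list \<Rightarrow> int) \<Rightarrow> int" where "additive_on (F (Suc p)) g"
    "\<And>\<phi>. \<phi> \<in> N (Suc p) \<Longrightarrow> g \<phi> = 0" "\<And>\<phi>. \<phi> \<in> F p \<Longrightarrow> f \<phi> = g (\<delta> p \<phi>)"
proof -
  obtain h' where h': "additive_on (F (Suc p)) h'" "\<And>\<phi>. \<phi> \<in> W (Suc p) \<Longrightarrow> h' \<phi> = h \<phi>"
    using add_retract_extension[OF W_retract W_F h(1)] by blast
  obtain g where g: "additive_on (F (Suc p)) g" "\<And>\<phi>. \<phi> \<in> W (Suc p) \<Longrightarrow> g \<phi> = 0"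
    "\<And>\<phi>. \<phi> \<in> F p \<Longrightarrow> f \<phi> - h' (\<delta> p \<phi>) = g (\<delta> p \<phi>)"
  proof (rule dual_acyclicD[OF acyc, of "\<lambda>\<phi>. f \<phi> - h' (\<delta> p \<phi>)"])
    show "additive_on (F p) (\<lambda>\<phi>. f \<phi> - h' (\<delta> p \<phi>))"
      by (rule additive_on_minus[OF f additive_on_coboundary[OF h'(1)]])
    show "f \<phi> - h' (\<delta> p \<phi>) = 0" if "\<phi> \<in> W p" for \<phi>
      using fh[OF that] h'(2)[OF local_null_coboundary[OF that]] by simp
    show "f (\<delta> q \<phi>) - h' (\<delta> p (\<delta> q \<phi>)) = 0" if "p = Suc q" "\<phi> \<in> F q" for q \<phi>
      using cyc[OF that] additive_on_zero[OF h'(1) F_group] that by (simp add: as_function_coboundary_twice)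
  qed blast
  show ?thesis
  proof (rule that[of "\<lambda>\<phi>. h' \<phi> + g \<phi>"])
    show "additive_on (F (Suc p)) (\<lambda>\<phi>. h' \<phi> + g \<phi>)" by (rule additive_on_add[OF h'(1) g(1)])
    show "h' \<phi> + g \<phi> = 0" if "\<phi> \<in> N (Suc p)" for \<phi>
      using that N_W[of "Suc p"] h'(2) g(2) h(2) by (metis add.right_neutral subsetD)
    show "f \<phi> = h' (\<delta> p \<phi>) + g (\<delta> p \<phi>)" if "\<phi> \<in> F p" for \<phi> using g(3)[OF that] by simp
  qed
qed

text \<open>An arbitrary extension f' of f to \<open>F\<close> need not be a cycle. Its boundary
  kills \<open>W\<close> and represents the image of f under the connecting homomorphism, one degree
  lower. There it also bounds some g that kills \<open>W\<close>, and f' - g is a cycle with the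
  same restriction. In degree 0 there is no cycle condition to repair.\<close>

lemma restriction_surjective:
  fixes f :: "('a list \<Rightarrow> int) \<Rightarrow> int"
  assumes acyc: "\<And>q. p = Suc q \<Longrightarrow> dual_acyclic q W"
    and f: "additive_on (W p) f" "\<And>\<phi>. \<phi> \<in> N p \<Longrightarrow> f \<phi> = 0"
    and cyc: "\<And>q \<phi>. p = Suc q \<Longrightarrow> \<phi> \<in> W q \<Longrightarrow> f (\<delta> q \<phi>) = 0"
  obtains g :: "('a list \<Rightarrow> int) \<Rightarrow> int" where "additive_on (F p) g"
    "\<And>\<phi>. \<phi> \<in> N p \<Longrightarrow> g \<phi> = 0" "\<And>\<phi>. \<phi> \<in> W p \<Longrightarrow> g \<phi> = f \<phi>"
    "\<And>q \<phi>. p = Suc q \<Longrightarrow> \<phi> \<in> F q \<Longrightarrow> g (\<delta> q \<phi>) = 0"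
proof -
  obtain f' where f': "additive_on (F p) f'" "\<And>\<phi>. \<phi> \<in> W p \<Longrightarrow> f' \<phi> = f \<phi>"
    using add_retract_extension[OF W_retract W_F f(1)] by blast
  have f'N: "f' \<phi> = 0" if "\<phi> \<in> N p" for \<phi> using that N_W f'(2) f(2) by (metis subsetD)
  show ?thesis
  proof (cases p)
    case 0
    show ?thesis by (rule that[of f']) (use f' f'N 0 in auto)
  next
    case (Suc q)
    obtain g where g: "additive_on (F (Suc q)) g" "\<And>\<phi>. \<phi> \<in> W (Suc q) \<Longrightarrow> g \<phi> = 0"
      "\<And>\<phi>. \<phi> \<in> F q \<Longrightarrow> f' (\<delta> q \<phi>) = g (\<delta> q \<phi>)"
    proof (rule dual_acyclicD[OF acyc[OF Suc], of "\<lambda>\<phi>. f' (\<delta> q \<phi>)"])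
      show "additive_on (F q) (\<lambda>\<phi>. f' (\<delta> q \<phi>))" using additive_on_coboundary f'(1) Suc by blast
      show "f' (\<delta> q \<phi>) = 0" if "\<phi> \<in> W q" for \<phi>
        using cyc[OF Suc that] f'(2) local_null_coboundary[OF that] Suc by simp
      show "f' (\<delta> q (\<delta> q' \<phi>)) = 0" if "q = Suc q'" for q' \<phi>
        using additive_on_zero[OF f'(1) F_group] that by (simp add: as_function_coboundary_twice)
    qed blast
    show ?thesis
    proof (rule that[of "\<lambda>\<phi>. f' \<phi> - g \<phi>"])
      show "additive_on (F p) (\<lambda>\<phi>. f' \<phi> - g \<phi>)" using additive_on_minus f'(1) g(1) Suc by blast
      show "f' \<phi> - g \<phi> = 0" if "\<phi> \<in> N p" for \<phi> using that f'N g(2) N_W Suc by (metis diff_zero subsetD)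
      show "f' \<phi> - g \<phi> = f \<phi>" if "\<phi> \<in> W p" for \<phi> using that f'(2) g(2) Suc by simp
      show "f' (\<delta> q' \<phi>) - g (\<delta> q' \<phi>) = 0" if "p = Suc q'" "\<phi> \<in> F q'" for q' \<phi>
        using that g(3) Suc by simp
    qed
  qed
qed

end


section \<open>Cochain groups and chain groups by representatives\<close>

lemma as_support_iff:
  "x \<in> as_support p Y \<phi> \<longleftrightarrow> x \<in> topspace Y \<and> \<not> locally_zero p Y (topspace Y) {x} \<phi>"
proof -
  have "V \<inter> topspace Y = V" if "openin Y V" for V using openin_subset[OF that] by blast
  then show ?thesis unfolding as_support_def locally_zero_def by (auto 0 3)
qed

lemma locally_zero_pointwise: "locally_zero p X A B \<phi> \<longleftrightarrow> (\<forall>x\<in>B. locally_zero p X A {x} \<phi>)"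
  by (simp add: locally_zero_def)

lemma as_support_empty_iff: "as_support p Y \<phi> = {} \<longleftrightarrow> locally_zero p Y (topspace Y) (topspace Y) \<phi>"
  using locally_zero_pointwise[of p Y "topspace Y" "topspace Y" \<phi>] as_support_iff[of _ p Y \<phi>] by blast

lemma closedin_as_support: "closedin Y (as_support p Y \<phi>)"
proof -
  have "topspace Y - as_support p Y \<phi> = \<Union>{V. openin Y V \<and> (\<forall>xs\<in>tuples p V. \<phi> xs = 0)}"
    using openin_subset unfolding as_support_def by blast
  moreover have "openin Y (\<Union>{V. openin Y V \<and> (\<forall>xs\<in>tuples p V. \<phi> xs = 0)})" by blast
  moreover have "as_support p Y \<phi> \<subseteq> topspace Y" unfolding as_support_def by blast
  ultimately show ?thesis unfolding closedin_def by simp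
qed

definition as_cochains :: "nat \<Rightarrow> 'a topology \<Rightarrow> ('a list \<Rightarrow> int) set" where
  "as_cochains p Y = {\<phi> \<in> as_functions p Y. compactin Y (as_support p Y \<phi>)}"

text \<open>Replaces the record operations by those of the additive type class, so that facts about
  \<open>add_subgroup\<close> apply to the groups of the statement.\<close>

lemma as_function_group_eq:
  "as_function_group p (Y :: 'a topology) = \<lparr>carrier = as_cochains p Y, mult = (+), one = 0\<rparr>"
proof -
  have "(\<lambda>\<phi> \<psi> xs. \<phi> xs + \<psi> xs) = ((+) :: ('a list \<Rightarrow> int) \<Rightarrow> _)" by (intro ext) simp
  moreover have "(\<lambda>xs. 0) = (0 :: 'a list \<Rightarrow> int)" by (simp add: zero_fun_def)
  ultimately show ?thesis
    by (auto simp: as_function_group_def as_cochains_def as_functions_def)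
qed

lemma as_cochains_compact: "compact_space Y \<Longrightarrow> as_cochains p Y = as_functions p Y"
  unfolding as_cochains_def using closedin_as_support closedin_compact_space by blast

lemma compactin_as_support_subset:
  "compactin Y K \<Longrightarrow> as_support p Y \<phi> \<subseteq> K \<Longrightarrow> compactin Y (as_support p Y \<phi>)"
  using closed_compactin closedin_as_support by blast

lemma as_cochains_subgroup: "add_subgroup (as_cochains p Y)"
  unfolding add_subgroup_def
proof (intro conjI ballI)
  have "as_support p Y 0 = {}" unfolding as_support_def by auto
  then show "0 \<in> as_cochains p Y"
    using add_subgroup_zero[OF as_functions_subgroup] by (simp add: as_cochains_def)
  fix \<phi> \<psi> assume *: "\<phi> \<in> as_cochains p Y" "\<psi> \<in> as_cochains p Y"
  have "as_support p Y (\<phi> - \<psi>) \<subseteq> as_support p Y \<phi> \<union> as_support p Y \<psi>"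
  proof
    fix x assume x: "x \<in> as_support p Y (\<phi> - \<psi>)"
    then have "x \<in> topspace Y" "\<not> locally_zero p Y (topspace Y) {x} (\<phi> - \<psi>)"
      by (auto simp: as_support_iff)
    then show "x \<in> as_support p Y \<phi> \<union> as_support p Y \<psi>"
      using locally_zero_diff[of "{x}" Y p "topspace Y" \<phi> \<psi>] by (auto simp: as_support_iff)
  qed
  moreover have "compactin Y (as_support p Y \<phi> \<union> as_support p Y \<psi>)"
    using * by (auto simp: as_cochains_def intro: compactin_Un)
  ultimately have "compactin Y (as_support p Y (\<phi> - \<psi>))" by (intro compactin_as_support_subset)
  then show "\<phi> - \<psi> \<in> as_cochains p Y"
    using * add_subgroup_diff[OF as_functions_subgroup, of \<phi> p Y \<psi>] by (simp add: as_cochains_def)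
qed

lemmas as_cochains_add = add_subgroup_add[OF as_cochains_subgroup]

lemma as_cochains_coboundary:
  assumes "\<phi> \<in> as_cochains p Y" shows "as_function_coboundary p Y \<phi> \<in> as_cochains (Suc p) Y"
proof -
  have "as_support (Suc p) Y (as_function_coboundary p Y \<phi>) \<subseteq> as_support p Y \<phi>"
    using locally_zero_coboundary by (fastforce simp: as_support_iff)
  then show ?thesis
    using assms compactin_as_support_subset as_functions_coboundary by (auto simp: as_cochains_def)
qed

lemma as_null_eq:
  "as_null p Y = {\<phi> \<in> as_cochains p Y. locally_zero p Y (topspace Y) (topspace Y) \<phi>}"
  by (auto simp: as_null_def as_support_empty_iff as_function_group_eq)

lemma as_null_subgroup: "add_subgroup (as_null p Y)"
  using as_cochains_subgroup[of p Y] null_functions_subgroup[OF set_ideal_vanishing[OF order_refl, of p Y "topspace Y"]]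
  unfolding add_subgroup_def as_null_eq locally_zero_null_functions by blast

lemma as_null_coboundary:
  "\<phi> \<in> as_null p Y \<Longrightarrow> as_function_coboundary p Y \<phi> \<in> as_null (Suc p) Y"
  by (simp add: as_null_eq as_cochains_coboundary locally_zero_coboundary)

lemma comm_group_add_subgroup:
  assumes "add_subgroup H" shows "comm_group \<lparr>carrier = H, mult = (+), one = 0\<rparr>"
proof (rule comm_groupI)
  fix x assume "x \<in> carrier \<lparr>carrier = H, mult = (+), one = 0\<rparr>"
  then show "\<exists>y\<in>carrier \<lparr>carrier = H, mult = (+), one = 0\<rparr>.
      y \<otimes>\<^bsub>\<lparr>carrier = H, mult = (+), one = 0\<rparr>\<^esub> x = \<one>\<^bsub>\<lparr>carrier = H, mult = (+), one = 0\<rparr>\<^esub>"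
    using add_subgroup_uminus[OF assms] by (intro bexI[of _ "- x"]) auto
qed (use add_subgroup_zero[OF assms] add_subgroup_add[OF assms] in \<open>auto simp: algebra_simps\<close>)

lemma comm_group_as_function_group: "comm_group (as_function_group p Y)"
  unfolding as_function_group_eq by (rule comm_group_add_subgroup[OF as_cochains_subgroup])

lemma as_null_normal: "as_null p Y \<lhd> as_function_group p Y"
proof -
  interpret comm_group "as_function_group p Y" by (rule comm_group_as_function_group)
  have sub: "as_null p Y \<subseteq> as_cochains p Y" by (auto simp: as_null_eq)
  have "subgroup (as_null p Y) (as_function_group p Y)"
  proof (rule subgroupI)
    fix \<phi> assume \<phi>: "\<phi> \<in> as_null p Y"
    have "inv\<^bsub>as_function_group p Y\<^esub> \<phi> = - \<phi>"
      by (rule inv_equality) (use \<phi> sub add_subgroup_uminus[OF as_cochains_subgroup] in \<open>auto simp: as_function_group_eq\<close>)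
    then show "inv\<^bsub>as_function_group p Y\<^esub> \<phi> \<in> as_null p Y" using add_subgroup_uminus[OF as_null_subgroup \<phi>] by simp
  qed (use sub add_subgroup_zero[OF as_null_subgroup, of p Y] add_subgroup_add[OF as_null_subgroup] in
      \<open>auto simp: as_function_group_eq\<close>)
  then show ?thesis by (rule subgroup_imp_normal)
qed

lemma as_class_eq_set: "as_class p Y \<phi> = {\<nu> + \<phi> |\<nu>. \<nu> \<in> as_null p Y}"
  by (auto simp: as_class_def r_coset_def as_function_group_eq)

lemma mem_as_class_iff: "\<psi> \<in> as_class p Y \<phi> \<longleftrightarrow> \<psi> - \<phi> \<in> as_null p Y"
  unfolding as_class_eq_set by (force simp: algebra_simps)

lemma as_class_eq_iff: "as_class p Y \<phi> = as_class p Y \<psi> \<longleftrightarrow> \<phi> - \<psi> \<in> as_null p Y"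
proof
  assume "as_class p Y \<phi> = as_class p Y \<psi>"
  moreover have "\<phi> \<in> as_class p Y \<phi>"
    using add_subgroup_zero[OF as_null_subgroup] by (simp add: mem_as_class_iff)
  ultimately show "\<phi> - \<psi> \<in> as_null p Y" by (simp add: mem_as_class_iff)
next
  assume *: "\<phi> - \<psi> \<in> as_null p Y"
  have "\<omega> - \<phi> \<in> as_null p Y \<longleftrightarrow> \<omega> - \<psi> \<in> as_null p Y" for \<omega>
    using add_subgroup_add[OF as_null_subgroup _ *, of "\<omega> - \<phi>"]
      add_subgroup_diff[OF as_null_subgroup _ *, of "\<omega> - \<psi>"] by auto
  then show "as_class p Y \<phi> = as_class p Y \<psi>" by (auto simp: mem_as_class_iff)
qed

lemma carrier_as_cochain_group: "carrier (as_cochain_group p Y) = as_class p Y ` as_cochains p Y"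
  by (auto simp: as_cochain_group_def FactGroup_def RCOSETS_def as_class_def as_function_group_eq)

lemma as_class_in_carrier [simp]:
  "\<phi> \<in> as_cochains p Y \<Longrightarrow> as_class p Y \<phi> \<in> carrier (as_cochain_group p Y)"
  by (simp add: carrier_as_cochain_group)

lemma as_class_mult:
  assumes "\<phi> \<in> as_cochains p Y" "\<psi> \<in> as_cochains p Y"
  shows "as_class p Y \<phi> \<otimes>\<^bsub>as_cochain_group p Y\<^esub> as_class p Y \<psi> = as_class p Y (\<phi> + \<psi>)"
  using normal.rcos_sum[OF as_null_normal, of \<phi> p Y \<psi>] assms
  by (simp add: as_cochain_group_def FactGroup_def as_class_def as_function_group_eq)

lemma as_coboundary_class:
  "as_coboundary p Y (as_class p Y \<phi>) = as_class (Suc p) Y (as_function_coboundary p Y \<phi>)"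
proof -
  have "as_class (Suc p) Y (as_function_coboundary p Y \<psi>) = as_class (Suc p) Y (as_function_coboundary p Y \<phi>)"
    if "\<psi> \<in> as_class p Y \<phi>" for \<psi>
    using as_null_coboundary[of "\<psi> - \<phi>" p Y] that
    by (simp add: as_class_eq_iff mem_as_class_iff as_function_coboundary_diff)
  moreover have "\<phi> \<in> as_class p Y \<phi>"
    using add_subgroup_zero[OF as_null_subgroup] by (simp add: mem_as_class_iff)
  ultimately show ?thesis unfolding as_coboundary_def by blast
qed

section \<open>Chains as additive functions of representatives\<close>

abbreviation steenrod_chains :: "nat \<Rightarrow> 'a topology \<Rightarrow> ('a, int) steenrod_chain set" where
  "steenrod_chains p Y \<equiv> carrier (steenrod_chain_group p Y integer_group)"

lemma steenrod_chains_iff: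
  "f \<in> steenrod_chains p Y \<longleftrightarrow> f \<in> extensional (carrier (as_cochain_group p Y)) \<and>
     additive_on (as_cochains p Y) (\<lambda>\<phi>. f (as_class p Y \<phi>))"
  by (auto simp: steenrod_chain_group_def hom_def additive_on_def carrier_as_cochain_group as_class_mult)

lemma steenrod_chains_additive:
  "f \<in> steenrod_chains p Y \<Longrightarrow> additive_on (as_cochains p Y) (\<lambda>\<phi>. f (as_class p Y \<phi>))"
  by (simp add: steenrod_chains_iff)

lemma steenrod_chains_null:
  assumes "f \<in> steenrod_chains p Y" "\<phi> \<in> as_null p Y" shows "f (as_class p Y \<phi>) = 0"
proof -
  have "as_class p Y \<phi> = as_class p Y 0" using assms(2) by (simp add: as_class_eq_iff)
  then show ?thesis
    using additive_on_zero[OF steenrod_chains_additive[OF assms(1)] as_cochains_subgroup] by simp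
qed

lemma steenrod_chains_eqI:
  assumes "f \<in> extensional (carrier (as_cochain_group p Y))" "g \<in> extensional (carrier (as_cochain_group p Y))"
    "\<And>\<phi>. \<phi> \<in> as_cochains p Y \<Longrightarrow> f (as_class p Y \<phi>) = g (as_class p Y \<phi>)"
  shows "f = g"
  by (rule extensionalityI[OF assms(1,2)]) (use assms(3) in \<open>auto simp: carrier_as_cochain_group\<close>)

lemma steenrod_chains_extensional:
  "f \<in> steenrod_chains p Y \<Longrightarrow> f \<in> extensional (carrier (as_cochain_group p Y))"
  by (simp add: steenrod_chains_iff)

text \<open>Descent to the quotient: on a coset, f is evaluated at an arbitrary representative,
  which is legitimate because f kills null functions. This turns functionals built on functions back
  into chains.\<close>

lemma steenrod_chain_of_function:
  fixes f :: "('a list \<Rightarrow> int) \<Rightarrow> int"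
  assumes "additive_on (as_cochains p Y) f" "\<And>\<phi>. \<phi> \<in> as_null p Y \<Longrightarrow> f \<phi> = 0"
  obtains g where "g \<in> steenrod_chains p Y" "\<And>\<phi>. \<phi> \<in> as_cochains p Y \<Longrightarrow> g (as_class p Y \<phi>) = f \<phi>"
proof -
  define g where "g = (\<lambda>c\<in>carrier (as_cochain_group p Y). f (SOME \<phi>. \<phi> \<in> as_cochains p Y \<and> as_class p Y \<phi> = c))"
  have g: "g (as_class p Y \<phi>) = f \<phi>" if \<phi>: "\<phi> \<in> as_cochains p Y" for \<phi>
  proof -
    let ?\<psi> = "SOME \<psi>. \<psi> \<in> as_cochains p Y \<and> as_class p Y \<psi> = as_class p Y \<phi>"
    have "\<exists>\<psi>. \<psi> \<in> as_cochains p Y \<and> as_class p Y \<psi> = as_class p Y \<phi>" using \<phi> by blast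
    from someI_ex[OF this]
    have "?\<psi> \<in> as_cochains p Y \<and> as_class p Y ?\<psi> = as_class p Y \<phi>" .
    then have \<psi>: "?\<psi> \<in> as_cochains p Y" "?\<psi> - \<phi> \<in> as_null p Y" by (auto simp: as_class_eq_iff)
    have "f ?\<psi> - f \<phi> = 0"
      using assms(2)[OF \<psi>(2)] additive_on_diff[OF assms(1) as_cochains_subgroup \<psi>(1) \<phi>] by simp
    then show ?thesis using \<phi> by (simp add: g_def)
  qed
  have "additive_on (as_cochains p Y) (\<lambda>\<phi>. g (as_class p Y \<phi>))"
    using assms(1) by (auto simp: additive_on_def g as_cochains_add)
  then have "g \<in> steenrod_chains p Y" by (simp add: steenrod_chains_iff g_def)
  then show ?thesis using g that by blast
qed

lemma steenrod_chain_mult: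
  "\<phi> \<in> as_cochains p Y \<Longrightarrow>
   (f \<otimes>\<^bsub>steenrod_chain_group p Y integer_group\<^esub> g) (as_class p Y \<phi>) =
     f (as_class p Y \<phi>) + g (as_class p Y \<phi>)"
  by (simp add: steenrod_chain_group_def)

lemma steenrod_chain_one:
  "\<phi> \<in> as_cochains p Y \<Longrightarrow> \<one>\<^bsub>steenrod_chain_group p Y integer_group\<^esub> (as_class p Y \<phi>) = 0"
  by (simp add: steenrod_chain_group_def)

lemma steenrod_chain_mult_extensional:
  "f \<otimes>\<^bsub>steenrod_chain_group p Y integer_group\<^esub> g \<in> extensional (carrier (as_cochain_group p Y))"
  "\<one>\<^bsub>steenrod_chain_group p Y integer_group\<^esub> \<in> extensional (carrier (as_cochain_group p Y))"
  by (simp_all add: steenrod_chain_group_def)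

lemma comm_group_steenrod_chain_group: "comm_group (steenrod_chain_group p Y integer_group)"
proof (rule comm_groupI)
  let ?G = "steenrod_chain_group p Y integer_group"
  note ext = steenrod_chain_mult_extensional steenrod_chains_extensional
  show "f \<otimes>\<^bsub>?G\<^esub> g \<in> carrier ?G" if "f \<in> carrier ?G" "g \<in> carrier ?G" for f g
    using that by (auto simp: steenrod_chains_iff additive_on_def steenrod_chain_mult ext as_cochains_add)
  show "\<one>\<^bsub>?G\<^esub> \<in> carrier ?G"
    by (auto simp: steenrod_chains_iff additive_on_def steenrod_chain_one ext as_cochains_add)
  show "f \<otimes>\<^bsub>?G\<^esub> g \<otimes>\<^bsub>?G\<^esub> h = f \<otimes>\<^bsub>?G\<^esub> (g \<otimes>\<^bsub>?G\<^esub> h)" for f g h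
    by (rule steenrod_chains_eqI[OF ext(1,1)]) (simp add: steenrod_chain_mult)
  show "f \<otimes>\<^bsub>?G\<^esub> g = g \<otimes>\<^bsub>?G\<^esub> f" for f g
    by (rule steenrod_chains_eqI[OF ext(1,1)]) (simp add: steenrod_chain_mult)
  show "\<one>\<^bsub>?G\<^esub> \<otimes>\<^bsub>?G\<^esub> f = f" if "f \<in> carrier ?G" for f
    by (rule steenrod_chains_eqI[OF ext(1) ext(3)[OF that]])
      (simp add: steenrod_chain_mult steenrod_chain_one)
  fix f assume f: "f \<in> carrier ?G"
  obtain g where g: "g \<in> carrier ?G" "\<And>\<phi>. \<phi> \<in> as_cochains p Y \<Longrightarrow> g (as_class p Y \<phi>) = - f (as_class p Y \<phi>)"
  proof (rule steenrod_chain_of_function[of p Y "\<lambda>\<phi>. - f (as_class p Y \<phi>)"])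
    show "additive_on (as_cochains p Y) (\<lambda>\<phi>. - f (as_class p Y \<phi>))"
      using steenrod_chains_additive[OF f] by (simp add: additive_on_def)
  qed (use steenrod_chains_null[OF f] in auto)
  have "g \<otimes>\<^bsub>?G\<^esub> f = \<one>\<^bsub>?G\<^esub>"
    by (rule steenrod_chains_eqI[OF ext(1,2)]) (simp add: steenrod_chain_mult steenrod_chain_one g(2))
  then show "\<exists>g\<in>carrier ?G. g \<otimes>\<^bsub>?G\<^esub> f = \<one>\<^bsub>?G\<^esub>" using g(1) by blast
qed

section \<open>Boundaries, cycles and homology classes\<close>

lemma steenrod_boundary_class:
  "\<phi> \<in> as_cochains p Y \<Longrightarrow>
   steenrod_boundary p Y f (as_class p Y \<phi>) = f (as_class (Suc p) Y (as_function_coboundary p Y \<phi>))"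
  by (simp add: steenrod_boundary_def as_coboundary_class)

lemma steenrod_boundary_in_chains:
  assumes "f \<in> steenrod_chains (Suc p) Y" shows "steenrod_boundary p Y f \<in> steenrod_chains p Y"
proof -
  have "additive_on (as_cochains p Y) (\<lambda>\<phi>. steenrod_boundary p Y f (as_class p Y \<phi>))"
    using steenrod_chains_additive[OF assms]
    by (auto simp: additive_on_def steenrod_boundary_class as_function_coboundary_add
        as_cochains_coboundary as_cochains_add)
  then show ?thesis by (simp add: steenrod_chains_iff steenrod_boundary_def)
qed

lemma steenrod_boundariesI:
  fixes g :: "('a list \<Rightarrow> int) \<Rightarrow> int"
  assumes "f \<in> steenrod_chains p Y" "additive_on (as_cochains (Suc p) Y) g"
    "\<And>\<phi>. \<phi> \<in> as_null (Suc p) Y \<Longrightarrow> g \<phi> = 0"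
    "\<And>\<phi>. \<phi> \<in> as_cochains p Y \<Longrightarrow> f (as_class p Y \<phi>) = g (as_function_coboundary p Y \<phi>)"
  shows "f \<in> steenrod_boundaries p Y integer_group"
proof -
  obtain g' where g': "g' \<in> steenrod_chains (Suc p) Y"
    "\<And>\<phi>. \<phi> \<in> as_cochains (Suc p) Y \<Longrightarrow> g' (as_class (Suc p) Y \<phi>) = g \<phi>"
    using steenrod_chain_of_function[OF assms(2,3)] by blast
  have "f = steenrod_boundary p Y g'"
    by (rule steenrod_chains_eqI[OF steenrod_chains_extensional[OF assms(1)]
          steenrod_chains_extensional[OF steenrod_boundary_in_chains[OF g'(1)]]])
      (simp add: steenrod_boundary_class assms(4) g'(2) as_cochains_coboundary)
  then show ?thesis using g'(1) unfolding steenrod_boundaries_def by blast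
qed

lemma steenrod_boundariesE:
  assumes "f \<in> steenrod_boundaries p Y integer_group"
  obtains g where "g \<in> steenrod_chains (Suc p) Y" "f = steenrod_boundary p Y g"
  using assms unfolding steenrod_boundaries_def by blast

lemma steenrod_boundary_mult:
  assumes "f \<in> steenrod_chains (Suc p) Y" "g \<in> steenrod_chains (Suc p) Y"
  shows "steenrod_boundary p Y (f \<otimes>\<^bsub>steenrod_chain_group (Suc p) Y integer_group\<^esub> g) =
    steenrod_boundary p Y f \<otimes>\<^bsub>steenrod_chain_group p Y integer_group\<^esub> steenrod_boundary p Y g"
  by (rule steenrod_chains_eqI[OF _ steenrod_chain_mult_extensional(1)])
    (auto simp: steenrod_boundary_class steenrod_chain_mult as_cochains_coboundary,
     simp add: steenrod_boundary_def)

lemma steenrod_boundaries_subgroup: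
  "subgroup (steenrod_boundaries p Y integer_group) (steenrod_chain_group p Y integer_group)"
proof -
  have "group_hom (steenrod_chain_group (Suc p) Y integer_group) (steenrod_chain_group p Y integer_group)
      (steenrod_boundary p Y)"
    using comm_group_steenrod_chain_group
    by (intro group_hom.intro group_hom_axioms.intro homI)
      (auto simp: comm_group_def steenrod_boundary_in_chains steenrod_boundary_mult)
  then show ?thesis unfolding steenrod_boundaries_def by (rule group_hom.img_is_subgroup)
qed

lemma steenrod_cycles_iff:
  "f \<in> steenrod_cycles p Y integer_group \<longleftrightarrow> f \<in> steenrod_chains p Y \<and>
     (\<forall>q. p = Suc q \<longrightarrow> (\<forall>\<phi>\<in>as_cochains q Y. f (as_class p Y (as_function_coboundary q Y \<phi>)) = 0))"
proof -
  have "steenrod_boundary q Y f = \<one>\<^bsub>steenrod_chain_group q Y integer_group\<^esub> \<longleftrightarrow>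
      (\<forall>\<phi>\<in>as_cochains q Y. f (as_class (Suc q) Y (as_function_coboundary q Y \<phi>)) = 0)" for q
  proof
    assume *: "steenrod_boundary q Y f = \<one>\<^bsub>steenrod_chain_group q Y integer_group\<^esub>"
    show "\<forall>\<phi>\<in>as_cochains q Y. f (as_class (Suc q) Y (as_function_coboundary q Y \<phi>)) = 0"
      using steenrod_boundary_class[of _ q Y f] steenrod_chain_one[of _ q Y] unfolding * by simp
  next
    assume *: "\<forall>\<phi>\<in>as_cochains q Y. f (as_class (Suc q) Y (as_function_coboundary q Y \<phi>)) = 0"
    show "steenrod_boundary q Y f = \<one>\<^bsub>steenrod_chain_group q Y integer_group\<^esub>"
      by (rule steenrod_chains_eqI[OF _ steenrod_chain_mult_extensional(2)])
        (use * in \<open>auto simp: steenrod_boundary_class steenrod_chain_one\<close>, simp add: steenrod_boundary_def)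
  qed
  then show ?thesis unfolding steenrod_cycles_def by auto
qed

abbreviation steenrod_class ::
    "nat \<Rightarrow> 'a topology \<Rightarrow> ('a, int) steenrod_chain \<Rightarrow> ('a, int) steenrod_chain set" where
  "steenrod_class p Y f \<equiv>
     steenrod_boundaries p Y integer_group #>\<^bsub>steenrod_chain_group p Y integer_group\<^esub> f"

lemma carrier_steenrod_homology_group:
  "carrier (steenrod_homology_group p Y integer_group) =
     steenrod_class p Y ` steenrod_cycles p Y integer_group"
  by (auto simp: steenrod_homology_group_def FactGroup_def RCOSETS_def r_coset_def)

lemma steenrod_class_eqI:
  assumes "f \<in> steenrod_chains p Y" "b \<in> steenrod_boundaries p Y integer_group"
  shows "steenrod_class p Y (b \<otimes>\<^bsub>steenrod_chain_group p Y integer_group\<^esub> f) = steenrod_class p Y f"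
proof -
  interpret comm_group "steenrod_chain_group p Y integer_group" by (rule comm_group_steenrod_chain_group)
  have "b \<otimes>\<^bsub>steenrod_chain_group p Y integer_group\<^esub> f \<in> steenrod_class p Y f"
    using assms(2) by (auto simp: r_coset_def)
  from repr_independence[OF this assms(1) steenrod_boundaries_subgroup] show ?thesis by simp
qed

lemma steenrod_class_eqE:
  assumes "f \<in> steenrod_chains p Y" "steenrod_class p Y f = steenrod_class p Y g"
  obtains b where "b \<in> steenrod_boundaries p Y integer_group"
    "f = b \<otimes>\<^bsub>steenrod_chain_group p Y integer_group\<^esub> g"
proof -
  interpret comm_group "steenrod_chain_group p Y integer_group" by (rule comm_group_steenrod_chain_group)
  have "f \<in> steenrod_class p Y g"
    using rcos_self[OF assms(1) steenrod_boundaries_subgroup] assms(2) by simp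
  then show ?thesis using that by (auto simp: r_coset_def)
qed

text \<open>The unit of the quotient group is the subgroup of boundaries itself, and a coset equal
  to it consists of boundaries.\<close>

lemma trivial_steenrod_homology:
  assumes "trivial_group (steenrod_homology_group p Y integer_group)"
    "f \<in> steenrod_cycles p Y integer_group"
  shows "f \<in> steenrod_boundaries p Y integer_group"
proof -
  interpret comm_group "steenrod_chain_group p Y integer_group" by (rule comm_group_steenrod_chain_group)
  have "steenrod_class p Y f = steenrod_boundaries p Y integer_group"
    using assms unfolding trivial_group_def carrier_steenrod_homology_group
    by (simp add: steenrod_homology_group_def FactGroup_def) blast
  then show ?thesis
    using coset_join1[OF _ _ steenrod_boundaries_subgroup] assms(2) by (simp add: steenrod_cycles_iff)
qed


section \<open>Restriction to the complement\<close>

lemma locally_zero_subtopology: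
  assumes "B \<subseteq> A"
  shows "locally_zero p (subtopology X A) A B (restrict0 (tuples p A) \<phi>) \<longleftrightarrow> locally_zero p X A B \<phi>"
proof -
  have eq: "(\<forall>xs\<in>tuples p (V \<inter> A \<inter> A). restrict0 (tuples p A) \<phi> xs = 0) \<longleftrightarrow>
      (\<forall>xs\<in>tuples p (V \<inter> A). \<phi> xs = 0)" for V
    by (auto simp: restrict0_def tuples_def)
  show ?thesis
    unfolding locally_zero_def
  proof (intro ball_cong refl iffI)
    fix x assume "x \<in> B"
    then have x: "x \<in> A" using assms by blast
    show "\<exists>V. openin X V \<and> x \<in> V \<and> (\<forall>xs\<in>tuples p (V \<inter> A). \<phi> xs = 0)"
      if "\<exists>V. openin (subtopology X A) V \<and> x \<in> V \<and> (\<forall>xs\<in>tuples p (V \<inter> A). restrict0 (tuples p A) \<phi> xs = 0)"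
    proof -
      from that obtain V where V: "openin X V" "x \<in> V \<inter> A"
        "\<forall>xs\<in>tuples p (V \<inter> A \<inter> A). restrict0 (tuples p A) \<phi> xs = 0"
        unfolding openin_subtopology by blast
      then show ?thesis using eq by blast
    qed
    show "\<exists>V. openin (subtopology X A) V \<and> x \<in> V \<and> (\<forall>xs\<in>tuples p (V \<inter> A). restrict0 (tuples p A) \<phi> xs = 0)"
      if "\<exists>V. openin X V \<and> x \<in> V \<and> (\<forall>xs\<in>tuples p (V \<inter> A). \<phi> xs = 0)"
    proof -
      from that obtain V where "openin X V" "x \<in> V" "\<forall>xs\<in>tuples p (V \<inter> A). \<phi> xs = 0" by blast
      then show ?thesis using eq x by (intro exI[of _ "V \<inter> A"]) (auto simp: openin_subtopology)
    qed
  qed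
qed

lemma as_functions_restrict0:
  assumes "\<phi> \<in> as_functions p X" "A \<subseteq> topspace X"
  shows "restrict0 (tuples p A) \<phi> \<in> as_functions p (subtopology X A)"
  using assms(1) finite_range_restrict0[of \<phi> "tuples p A"]
  by (simp add: as_functions_def Int_absorb1[OF assms(2)]) (simp add: restrict0_def)

lemma as_functions_subtopology:
  assumes "A \<subseteq> topspace X" "\<phi> \<in> as_functions p (subtopology X A)"
  shows "\<phi> \<in> as_functions p X" "restrict0 (tuples p A) \<phi> = \<phi>"
proof -
  have "tuples p A \<subseteq> tuples p (topspace X)" using assms(1) by (auto simp: tuples_def)
  then show "\<phi> \<in> as_functions p X" "restrict0 (tuples p A) \<phi> = \<phi>"
    using assms(2) by (auto simp: as_functions_def Int_absorb1[OF assms(1)] restrict0_def fun_eq_iff)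
qed

text \<open>The two functions agree on every tuple in \<open>A\<close>, so the whole space serves as
  neighborhood.\<close>

lemma locally_zero_restrict0_diff:
  "B \<subseteq> topspace X \<Longrightarrow> locally_zero p X A B (\<phi> - restrict0 (tuples p A) \<phi>)"
  unfolding locally_zero_def
  by (auto simp: restrict0_def tuples_def intro!: exI[of _ "topspace X"])

section \<open>Homology of the closed subset through functions on the whole space\<close>

context compact_pair
begin

lemma as_null_subtopology_S:
  assumes "\<phi> \<in> F p"
  shows "restrict0 (tuples p S) \<phi> \<in> as_null p (subtopology X S) \<longleftrightarrow> \<phi> \<in> T p"
proof -
  have "compact_space (subtopology X S)"
    using closedin_compact_space[OF compact closed] by (rule compact_space_subtopology)
  then show ?thesis
    using as_functions_restrict0[OF assms S_subset] locally_zero_subtopology[of S S p X \<phi>] assms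
    by (simp add: as_null_eq as_cochains_compact Int_absorb1[OF S_subset] local_null_def)
qed

text \<open>Restriction of tuples identifies \<open>F/T\<close> with the cochain group of
  \<open>S\<close>; extension by zero is a section of it, as no continuity is asked of functions.
  Thus f descends to a cycle on \<open>S\<close>, which bounds by triviality, and the bounding chain
  is pulled back along restriction.\<close>

lemma dual_acyclic_trivial:
  assumes "trivial_group (steenrod_homology_group p (subtopology X S) integer_group)"
  shows "dual_acyclic p T"
  unfolding dual_acyclic_def
proof (intro allI impI)
  fix f :: "('a list \<Rightarrow> int) \<Rightarrow> int"
  assume f: "additive_on (F p) f" and fT: "\<forall>\<phi>\<in>T p. f \<phi> = 0"
    and cyc: "\<forall>q. p = Suc q \<longrightarrow> (\<forall>\<phi>\<in>F q. f (\<delta> q \<phi>) = 0)"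
  let ?Y = "subtopology X S"
  have "compact_space ?Y" using closedin_compact_space[OF compact closed] by (rule compact_space_subtopology)
  then have Y: "as_cochains q ?Y = as_functions q ?Y" for q by (rule as_cochains_compact)
  have sub: "as_cochains q ?Y \<subseteq> F q" for q unfolding Y using as_functions_subtopology(1)[OF S_subset] by blast
  have r: "restrict0 (tuples q S) \<phi> = \<phi>" if "\<phi> \<in> as_cochains q ?Y" for q \<phi>
    using that as_functions_subtopology(2)[OF S_subset] unfolding Y by blast
  have rF: "restrict0 (tuples q S) \<phi> \<in> as_cochains q ?Y" if "\<phi> \<in> F q" for q \<phi>
    unfolding Y by (rule as_functions_restrict0[OF that S_subset])
  have f_restrict: "f (restrict0 (tuples p S) \<phi>) = f \<phi>" if \<phi>: "\<phi> \<in> F p" for \<phi>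
  proof -
    have r\<phi>: "restrict0 (tuples p S) \<phi> \<in> F p" using rF[OF \<phi>] sub by blast
    then have "\<phi> - restrict0 (tuples p S) \<phi> \<in> T p"
      using add_subgroup_diff[OF F_group \<phi>] locally_zero_restrict0_diff[OF S_subset]
      by (simp add: local_null_def)
    then show ?thesis using fT additive_on_diff[OF f F_group \<phi> r\<phi>] by simp
  qed
  obtain c where c: "c \<in> steenrod_chains p ?Y" "\<And>\<phi>. \<phi> \<in> as_cochains p ?Y \<Longrightarrow> c (as_class p ?Y \<phi>) = f \<phi>"
  proof (rule steenrod_chain_of_function)
    show "additive_on (as_cochains p ?Y) f" by (rule additive_on_subset[OF f sub])
    show "f \<phi> = 0" if "\<phi> \<in> as_null p ?Y" for \<phi>
    proof -
      have \<phi>: "\<phi> \<in> as_cochains p ?Y" using that by (simp add: as_null_eq)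
      then have "\<phi> \<in> T p" using as_null_subtopology_S[of \<phi> p] that r sub by auto
      then show ?thesis using fT by blast
    qed
  qed blast
  \<comment> \<open>Extension by zero is not a cochain map: the coboundary taken on the whole space
    may be nonzero on tuples with an entry outside \<open>S\<close>, and these have to be cut
    off.\<close>
  have d: "as_function_coboundary q ?Y \<phi> = restrict0 (tuples (Suc q) S) (\<delta> q \<phi>)"
    if "\<phi> \<in> as_cochains q ?Y" for q \<phi>
    using as_function_coboundary_restrict0[OF S_subset, of q \<phi>] r[OF that] by simp
  have "c \<in> steenrod_cycles p ?Y integer_group"
    unfolding steenrod_cycles_iff
  proof (intro conjI allI impI ballI c(1))
    fix q \<phi> assume q: "p = Suc q" and \<phi>: "\<phi> \<in> as_cochains q ?Y"
    have \<delta>\<phi>: "\<delta> q \<phi> \<in> F p" using as_functions_coboundary \<phi> sub q by blast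
    have "c (as_class p ?Y (as_function_coboundary q ?Y \<phi>)) = f (restrict0 (tuples p S) (\<delta> q \<phi>))"
      using c(2) as_cochains_coboundary[OF \<phi>] d[OF \<phi>] q by simp
    also have "\<dots> = 0" using f_restrict[OF \<delta>\<phi>] cyc q \<phi> sub by auto
    finally show "c (as_class p ?Y (as_function_coboundary q ?Y \<phi>)) = 0" .
  qed
  from trivial_steenrod_homology[OF assms this]
  obtain g where g: "g \<in> steenrod_chains (Suc p) ?Y" "c = steenrod_boundary p ?Y g"
    by (rule steenrod_boundariesE)
  show "\<exists>g. additive_on (F (Suc p)) g \<and> (\<forall>\<phi>\<in>T (Suc p). g \<phi> = 0) \<and> (\<forall>\<phi>\<in>F p. f \<phi> = g (\<delta> p \<phi>))"
  proof (intro exI conjI ballI)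
    let ?g = "\<lambda>\<phi>. g (as_class (Suc p) ?Y (restrict0 (tuples (Suc p) S) \<phi>))"
    show "additive_on (F (Suc p)) ?g"
      using steenrod_chains_additive[OF g(1)] rF by (auto simp: additive_on_def restrict0_add)
    show "?g \<phi> = 0" if "\<phi> \<in> T (Suc p)" for \<phi>
      using steenrod_chains_null[OF g(1)] as_null_subtopology_S[of \<phi> "Suc p"] that T_F by blast
    show "f \<phi> = ?g (\<delta> p \<phi>)" if \<phi>: "\<phi> \<in> F p" for \<phi>
    proof -
      have "f \<phi> = c (as_class p ?Y (restrict0 (tuples p S) \<phi>))"
        using c(2)[OF rF[OF \<phi>]] f_restrict[OF \<phi>] by simp
      also have "\<dots> = ?g (\<delta> p \<phi>)"
        unfolding g(2) steenrod_boundary_class[OF rF[OF \<phi>]]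
        by (simp add: as_function_coboundary_restrict0[OF S_subset])
      finally show ?thesis .
    qed
  qed
qed

section \<open>The complement, with W/N as its compactly supported cochains\<close>

definition "U = topspace X - S"
abbreviation "Y \<equiv> subtopology X U"
abbreviation "res p \<equiv> restrict0 (tuples p U)"

lemma U_subset: "U \<subseteq> topspace X"
  by (auto simp: U_def)

lemma openin_U: "openin X U"
  unfolding U_def using closed by blast

lemma topspace_Int_U [simp]: "topspace X \<inter> U = U"
  using U_subset by (rule Int_absorb1)

text \<open>As \<open>U\<close> is open, a neighborhood of one of its points can be shrunk into
  \<open>U\<close>, after which tuples in \<open>U\<close> are all the tuples there are.\<close>

lemma locally_zero_U:
  assumes "B \<subseteq> U" shows "locally_zero p X U B \<phi> \<longleftrightarrow> locally_zero p X (topspace X) B \<phi>"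
  unfolding locally_zero_def
proof (intro ball_cong refl iffI)
  fix x assume "x \<in> B"
  then have x: "x \<in> U" using assms by blast
  show "\<exists>V. openin X V \<and> x \<in> V \<and> (\<forall>xs\<in>tuples p (V \<inter> topspace X). \<phi> xs = 0)"
    if "\<exists>V. openin X V \<and> x \<in> V \<and> (\<forall>xs\<in>tuples p (V \<inter> U). \<phi> xs = 0)"
  proof -
    from that obtain V where V: "openin X V" "x \<in> V" "\<forall>xs\<in>tuples p (V \<inter> U). \<phi> xs = 0" by blast
    have "V \<inter> U \<inter> topspace X = V \<inter> U" using U_subset by blast
    then show ?thesis using V x openin_U by (intro exI[of _ "V \<inter> U"]) auto
  qed
  show "\<exists>V. openin X V \<and> x \<in> V \<and> (\<forall>xs\<in>tuples p (V \<inter> U). \<phi> xs = 0)"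
    if "\<exists>V. openin X V \<and> x \<in> V \<and> (\<forall>xs\<in>tuples p (V \<inter> topspace X). \<phi> xs = 0)"
  proof -
    have "tuples p (V \<inter> U) \<subseteq> tuples p (V \<inter> topspace X)" for V using U_subset by (auto simp: tuples_def)
    then show ?thesis using that by blast
  qed
qed

lemma N_iff:
  assumes "\<phi> \<in> W p" shows "\<phi> \<in> N p \<longleftrightarrow> locally_zero p X U U \<phi>"
proof -
  have "S \<union> U = topspace X" using S_subset by (auto simp: U_def)
  then have "locally_zero p X (topspace X) (topspace X) \<phi> \<longleftrightarrow>
      locally_zero p X (topspace X) S \<phi> \<and> locally_zero p X (topspace X) U \<phi>"
    unfolding locally_zero_pointwise[of p X "topspace X" "topspace X"]
      locally_zero_pointwise[of p X "topspace X" S] locally_zero_pointwise[of p X "topspace X" U]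
    by blast
  then show ?thesis
    using assms by (simp add: locally_zero_U local_null_def)
qed

text \<open>The germ of \<phi> at \<open>S\<close> is zero, so its support in the whole space avoids
  \<open>S\<close> and coincides with the support in \<open>U\<close>; being closed in a compact
  space, it is compact.\<close>

lemma res_cochain:
  assumes \<phi>: "\<phi> \<in> W p" shows "res p \<phi> \<in> as_cochains p Y"
proof -
  have "x \<in> as_support p Y (res p \<phi>) \<longleftrightarrow> x \<in> as_support p X \<phi>" for x
  proof (cases "x \<in> U")
    case True
    then show ?thesis
      using locally_zero_subtopology[of "{x}" U p X \<phi>] locally_zero_U[of "{x}" p \<phi>] U_subset
      by (auto simp: as_support_iff)
  next
    case False
    then show ?thesis
      using \<phi> locally_zero_pointwise[of p X "topspace X" S \<phi>]
      by (auto simp: as_support_iff local_null_def U_def)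
  qed
  then have "as_support p Y (res p \<phi>) = as_support p X \<phi>" by blast
  moreover have "as_support p Y (res p \<phi>) \<subseteq> U" by (auto simp: as_support_iff)
  ultimately have "compactin Y (as_support p Y (res p \<phi>))"
    using closedin_compact_space[OF compact closedin_as_support] by (simp add: compactin_subtopology)
  then show ?thesis
    using as_functions_restrict0[OF _ U_subset] \<phi> by (simp add: as_cochains_def local_null_def)
qed

lemma res_null:
  assumes \<phi>: "\<phi> \<in> W p" shows "res p \<phi> \<in> as_null p Y \<longleftrightarrow> \<phi> \<in> N p"
  using res_cochain[OF \<phi>] N_iff[OF \<phi>] locally_zero_subtopology[OF order_refl, of p X U \<phi>]
  by (simp add: as_null_eq)

lemma res_coboundary: "as_function_coboundary p Y (res p \<phi>) = res (Suc p) (\<delta> p \<phi>)"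
  by (rule as_function_coboundary_restrict0[OF U_subset])

lemma compactly_based_W:
  assumes "\<psi> \<in> as_functions p Y" "compactin X K" "K \<subseteq> U" "\<And>xs. xs \<notin> tuples p K \<Longrightarrow> \<psi> xs = 0"
  shows "\<psi> \<in> W p" "res p \<psi> = \<psi>"
proof -
  show "res p \<psi> = \<psi>" by (rule as_functions_subtopology(2)[OF U_subset assms(1)])
  have K: "openin X (topspace X - K)"
    using compactin_imp_closedin[OF Hausdorff assms(2)] by blast
  have "locally_zero p X (topspace X) S \<psi>"
    unfolding locally_zero_def
  proof
    fix x assume "x \<in> S"
    \<comment> \<open>Uses that a tuple has at least one entry, here one outside
      \<open>K\<close>.\<close>
    moreover have "xs \<notin> tuples p K" if "xs \<in> tuples p ((topspace X - K) \<inter> topspace X)" for xs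
      using that by (cases xs) (auto simp: tuples_def)
    ultimately show "\<exists>V. openin X V \<and> x \<in> V \<and> (\<forall>xs\<in>tuples p (V \<inter> topspace X). \<psi> xs = 0)"
      using K assms(3,4) S_subset by (intro exI[of _ "topspace X - K"]) (auto simp: U_def)
  qed
  then show "\<psi> \<in> W p"
    using as_functions_subtopology(1)[OF U_subset assms(1)] by (simp add: local_null_def)
qed

text \<open>Separate the support from \<open>S\<close> by disjoint open sets and let
  \<open>K\<close> be the complement of the one around \<open>S\<close>. Cutting \<psi> off to
  tuples in \<open>K\<close> changes nothing near its support, and at the other points of
  \<open>U\<close> both functions are locally zero.\<close>

lemma compactly_based_representative:
  assumes \<psi>: "\<psi> \<in> as_cochains p Y"
  obtains K \<phi> where "compactin X K" "K \<subseteq> U" "\<And>xs. xs \<notin> tuples p K \<Longrightarrow> \<phi> xs = 0"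
    "\<phi> \<in> as_functions p Y" "\<phi> - \<psi> \<in> as_null p Y"
proof -
  let ?\<sigma> = "as_support p Y \<psi>"
  have \<sigma>: "compactin X ?\<sigma>" "?\<sigma> \<subseteq> U"
    using \<psi> by (auto simp: as_cochains_def compactin_subtopology)
  have "disjnt ?\<sigma> S" using \<sigma>(2) by (auto simp: disjnt_def U_def)
  then obtain O1 O2 where O: "openin X O1" "openin X O2" "?\<sigma> \<subseteq> O1" "S \<subseteq> O2" "disjnt O1 O2"
    using Hausdorff_space_compact_separation[OF Hausdorff \<sigma>(1) closedin_compact_space[OF compact closed]]
    by blast
  define K where "K = topspace X - O2"
  have K: "compactin X K" "K \<subseteq> U"
    unfolding K_def using O by (auto simp: U_def intro!: closedin_compact_space[OF compact])
  have O1: "O1 \<subseteq> K" using O openin_subset unfolding K_def disjnt_def by blast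
  define \<phi> where "\<phi> = restrict0 (tuples p K) \<psi>"
  have \<phi>: "\<phi> \<in> as_functions p Y"
    using \<psi> finite_range_restrict0 by (auto simp: \<phi>_def as_cochains_def as_functions_def restrict0_def)
  have lz: "locally_zero p Y U U (\<phi> - \<psi>)"
    unfolding locally_zero_pointwise[of p Y U U]
  proof
    fix x assume x: "x \<in> U"
    show "locally_zero p Y U {x} (\<phi> - \<psi>)"
    proof (cases "x \<in> ?\<sigma>")
      case True
      have "openin Y O1" using O1 K O by (simp add: openin_open_subtopology[OF openin_U])
      moreover have "(\<phi> - \<psi>) xs = 0" if "xs \<in> tuples p (O1 \<inter> U)" for xs
        using that O1 by (auto simp: \<phi>_def restrict0_def tuples_def)
      ultimately show ?thesis using True O unfolding locally_zero_def by blast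
    next
      case False
      then obtain V where "openin Y V" "x \<in> V" "\<forall>xs\<in>tuples p (V \<inter> U). \<psi> xs = 0"
        using x by (auto simp: as_support_iff locally_zero_def)
      then show ?thesis unfolding locally_zero_def by (auto simp: \<phi>_def restrict0_def)
    qed
  qed
  have "as_support p Y \<phi> \<subseteq> ?\<sigma>"
  proof
    fix x assume x: "x \<in> as_support p Y \<phi>"
    show "x \<in> ?\<sigma>"
    proof (rule ccontr)
      assume "x \<notin> ?\<sigma>"
      then have "locally_zero p Y U {x} \<psi>" using x by (auto simp: as_support_iff)
      then have "locally_zero p Y U {x} \<phi>" unfolding locally_zero_def by (auto simp: \<phi>_def restrict0_def)
      then show False using x by (auto simp: as_support_iff)
    qed
  qed
  then have "\<phi> \<in> as_cochains p Y"
    using \<phi> \<psi> compactin_as_support_subset by (auto simp: as_cochains_def)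
  then have "\<phi> - \<psi> \<in> as_null p Y"
    using lz add_subgroup_diff[OF as_cochains_subgroup _ \<psi>] by (simp add: as_null_eq)
  then show ?thesis using that[OF K _ \<phi>] by (simp add: \<phi>_def restrict0_def)
qed

text \<open>With \<open>res_null\<close>, this shows that restriction induces an isomorphism from
  \<open>W/N\<close> onto the compactly supported cochains of \<open>U\<close>.\<close>

lemma as_class_res:
  assumes "\<psi> \<in> as_cochains p Y"
  obtains \<phi> where "\<phi> \<in> W p" "as_class p Y \<psi> = as_class p Y (res p \<phi>)"
proof -
  obtain K \<phi> where \<phi>: "compactin X K" "K \<subseteq> U" "\<And>xs. xs \<notin> tuples p K \<Longrightarrow> \<phi> xs = 0"
    "\<phi> \<in> as_functions p Y" "\<phi> - \<psi> \<in> as_null p Y"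
    using compactly_based_representative[OF assms] by blast
  have "as_class p Y \<phi> = as_class p Y \<psi>" using \<phi>(5) by (simp add: as_class_eq_iff)
  then show ?thesis using that compactly_based_W[OF \<phi>(4,1,2,3)] by metis
qed

text \<open>All representatives based on a compact subset of \<open>U\<close> lie in
  \<open>W\<close> and differ from \<phi> by elements of \<open>N\<close>, so the union in
  \<open>as_extension\<close> runs over copies of one coset; at least one such representative
  exists. Extension is thus inverse to restriction from \<open>W/N\<close>, followed by the
  inclusion into \<open>F/N\<close>.\<close>

lemma as_extension_res:
  assumes \<phi>: "\<phi> \<in> W p" shows "as_extension p X U (as_class p Y (res p \<phi>)) = as_class p X \<phi>"
proof -
  let ?R = "{\<psi> \<in> as_class p Y (res p \<phi>). \<exists>K. compactin X K \<and> K \<subseteq> U \<and> (\<forall>xs. xs \<notin> tuples p K \<longrightarrow> \<psi> xs = 0)}"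
  have "as_class p X \<psi> = as_class p X \<phi>" if "\<psi> \<in> ?R" for \<psi>
  proof -
    have n: "\<psi> - res p \<phi> \<in> as_null p Y" using that by (simp add: mem_as_class_iff)
    then have "(\<psi> - res p \<phi>) + res p \<phi> \<in> as_cochains p Y"
      using res_cochain[OF \<phi>] by (intro as_cochains_add) (auto simp: as_null_eq)
    then have "\<psi> \<in> as_functions p Y" by (simp add: as_cochains_def)
    then have W: "\<psi> \<in> W p" "res p \<psi> = \<psi>" using compactly_based_W that by blast+
    have "res p (\<psi> - \<phi>) \<in> as_null p Y" using n W(2) by (simp add: restrict0_diff)
    then have "\<psi> - \<phi> \<in> N p" using res_null add_subgroup_diff[OF W_group W(1) \<phi>] by blast
    then have "\<psi> - \<phi> \<in> as_null p X"
      by (simp add: as_null_eq as_cochains_compact[OF compact] local_null_def)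
    then show ?thesis by (simp add: as_class_eq_iff)
  qed
  moreover have "?R \<noteq> {}"
  proof -
    obtain K \<psi> where K: "compactin X K" "K \<subseteq> U" "\<And>xs. xs \<notin> tuples p K \<Longrightarrow> \<psi> xs = 0"
      "\<psi> \<in> as_functions p Y" "\<psi> - res p \<phi> \<in> as_null p Y"
      using compactly_based_representative[OF res_cochain[OF \<phi>]] by blast
    then have "\<psi> \<in> ?R" by (simp only: mem_Collect_eq mem_as_class_iff) blast
    then show ?thesis by blast
  qed
  ultimately show ?thesis unfolding as_extension_def by blast
qed

lemma chain_restriction_res:
  "\<phi> \<in> W p \<Longrightarrow> steenrod_chain_restriction p X U f (as_class p Y (res p \<phi>)) = f (as_class p X \<phi>)"
  by (simp add: steenrod_chain_restriction_def res_cochain as_extension_res)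

lemma chain_restriction_extensional:
  "steenrod_chain_restriction p X U f \<in> extensional (carrier (as_cochain_group p Y))"
  by (simp add: steenrod_chain_restriction_def)

lemma chains_eqI_res:
  assumes "f \<in> extensional (carrier (as_cochain_group p Y))" "g \<in> extensional (carrier (as_cochain_group p Y))"
    "\<And>\<phi>. \<phi> \<in> W p \<Longrightarrow> f (as_class p Y (res p \<phi>)) = g (as_class p Y (res p \<phi>))"
  shows "f = g"
  by (rule steenrod_chains_eqI[OF assms(1,2)]) (metis as_class_res assms(3))

lemma cochains_X: "as_cochains p X = F p"
  by (rule as_cochains_compact[OF compact])

lemma null_X: "as_null p X = N p"
  by (simp add: as_null_eq cochains_X local_null_def)

lemma chain_restriction_chain:
  assumes f: "f \<in> steenrod_chains p X" shows "steenrod_chain_restriction p X U f \<in> steenrod_chains p Y"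
proof -
  have "additive_on (as_cochains p Y) (\<lambda>\<psi>. steenrod_chain_restriction p X U f (as_class p Y \<psi>))"
    unfolding additive_on_def
  proof (intro ballI)
    fix \<psi> \<psi>' assume \<psi>: "\<psi> \<in> as_cochains p Y" "\<psi>' \<in> as_cochains p Y"
    obtain \<phi> where \<phi>: "\<phi> \<in> W p" "as_class p Y \<psi> = as_class p Y (res p \<phi>)" using as_class_res[OF \<psi>(1)] .
    obtain \<phi>' where \<phi>': "\<phi>' \<in> W p" "as_class p Y \<psi>' = as_class p Y (res p \<phi>')" using as_class_res[OF \<psi>(2)] .
    have "as_class p Y (\<psi> + \<psi>') = as_class p Y (res p (\<phi> + \<phi>'))"
      using as_class_mult[OF \<psi>] as_class_mult[OF res_cochain[OF \<phi>(1)] res_cochain[OF \<phi>'(1)]]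
      by (simp add: \<phi> \<phi>' restrict0_add)
    moreover have "\<phi> + \<phi>' \<in> W p" using add_subgroup_add[OF W_group \<phi>(1) \<phi>'(1)] .
    moreover have "f (as_class p X (\<phi> + \<phi>')) = f (as_class p X \<phi>) + f (as_class p X \<phi>')"
      using additive_onD[OF steenrod_chains_additive[OF f]] \<phi>(1) \<phi>'(1) W_F unfolding cochains_X by blast
    ultimately show "steenrod_chain_restriction p X U f (as_class p Y (\<psi> + \<psi>')) =
        steenrod_chain_restriction p X U f (as_class p Y \<psi>) + steenrod_chain_restriction p X U f (as_class p Y \<psi>')"
      by (simp add: \<phi> \<phi>' chain_restriction_res)
  qed
  then show ?thesis by (simp add: steenrod_chains_iff chain_restriction_extensional)
qed

lemma chain_restriction_mult:
  "steenrod_chain_restriction p X U (f \<otimes>\<^bsub>steenrod_chain_group p X integer_group\<^esub> g) =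
     steenrod_chain_restriction p X U f \<otimes>\<^bsub>steenrod_chain_group p Y integer_group\<^esub>
     steenrod_chain_restriction p X U g"
proof (rule chains_eqI_res[OF chain_restriction_extensional steenrod_chain_mult_extensional(1)])
  fix \<phi> assume \<phi>: "\<phi> \<in> W p"
  then have "\<phi> \<in> as_cochains p X" using W_F cochains_X by blast
  with \<phi> show "steenrod_chain_restriction p X U (f \<otimes>\<^bsub>steenrod_chain_group p X integer_group\<^esub> g)
        (as_class p Y (res p \<phi>)) =
      (steenrod_chain_restriction p X U f \<otimes>\<^bsub>steenrod_chain_group p Y integer_group\<^esub>
       steenrod_chain_restriction p X U g) (as_class p Y (res p \<phi>))"
    by (simp add: chain_restriction_res steenrod_chain_mult res_cochain)
qed

lemma chain_restriction_boundary:
  "steenrod_chain_restriction p X U (steenrod_boundary p X g) =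
     steenrod_boundary p Y (steenrod_chain_restriction (Suc p) X U g)"
proof (rule chains_eqI_res[OF chain_restriction_extensional])
  show "steenrod_boundary p Y (steenrod_chain_restriction (Suc p) X U g)
      \<in> extensional (carrier (as_cochain_group p Y))"
    by (simp add: steenrod_boundary_def)
  fix \<phi> assume \<phi>: "\<phi> \<in> W p"
  then have "\<phi> \<in> as_cochains p X" using W_F cochains_X by blast
  with \<phi> show "steenrod_chain_restriction p X U (steenrod_boundary p X g) (as_class p Y (res p \<phi>)) =
      steenrod_boundary p Y (steenrod_chain_restriction (Suc p) X U g) (as_class p Y (res p \<phi>))"
    by (simp add: chain_restriction_res steenrod_boundary_class res_cochain res_coboundary
        local_null_coboundary)
qed

text \<open>Representatives of one class differ by boundaries, and restriction is a chain map, so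
  the union in the definition collapses to a single coset.\<close>

lemma steenrod_restriction_class:
  assumes h: "h \<in> steenrod_chains p X"
  shows "steenrod_restriction p X U integer_group (steenrod_class p X h) =
           steenrod_class p Y (steenrod_chain_restriction p X U h)"
proof -
  have "steenrod_class p Y (steenrod_chain_restriction p X U f) =
      steenrod_class p Y (steenrod_chain_restriction p X U h)" if "f \<in> steenrod_class p X h" for f
  proof -
    obtain b where b: "b \<in> steenrod_boundaries p X integer_group"
      "f = b \<otimes>\<^bsub>steenrod_chain_group p X integer_group\<^esub> h"
      using \<open>f \<in> steenrod_class p X h\<close> by (auto simp: r_coset_def)
    obtain g where g: "g \<in> steenrod_chains (Suc p) X" "b = steenrod_boundary p X g"
      using steenrod_boundariesE[OF b(1)] by blast
    have "steenrod_chain_restriction p X U b \<in> steenrod_boundaries p Y integer_group"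
      unfolding steenrod_boundaries_def g(2) chain_restriction_boundary
      by (rule imageI[OF chain_restriction_chain[OF g(1)]])
    then show ?thesis
      unfolding b(2) chain_restriction_mult by (rule steenrod_class_eqI[OF chain_restriction_chain[OF h]])
  qed
  moreover have "h \<in> steenrod_class p X h"
    using comm_group_steenrod_chain_group[of p X] group.rcos_self[OF _ h steenrod_boundaries_subgroup]
    by (simp add: comm_group_def)
  ultimately show ?thesis unfolding steenrod_restriction_def by blast
qed

text \<open>A cycle on \<open>U\<close> is read as a functional on \<open>W\<close> that kills
  \<open>N\<close>, lifted there to a cycle on \<open>F\<close>, and turned back into a
  chain.\<close>

lemma steenrod_restriction_surj:
  assumes acyc: "\<And>q. p = Suc q \<Longrightarrow> dual_acyclic q W"
    and \<mu>: "\<mu> \<in> carrier (steenrod_homology_group p Y integer_group)"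
  obtains \<nu> where "\<nu> \<in> carrier (steenrod_homology_group p X integer_group)"
    "steenrod_restriction p X U integer_group \<nu> = \<mu>"
proof -
  obtain f where f: "f \<in> steenrod_cycles p Y integer_group" "\<mu> = steenrod_class p Y f"
    using \<mu> unfolding carrier_steenrod_homology_group by blast
  have fc: "f \<in> steenrod_chains p Y" using f by (simp add: steenrod_cycles_iff)
  obtain g :: "('a list \<Rightarrow> int) \<Rightarrow> int" where g: "additive_on (F p) g" "\<And>\<phi>. \<phi> \<in> N p \<Longrightarrow> g \<phi> = 0"
    "\<And>\<phi>. \<phi> \<in> W p \<Longrightarrow> g \<phi> = f (as_class p Y (res p \<phi>))"
    "\<And>q \<phi>. p = Suc q \<Longrightarrow> \<phi> \<in> F q \<Longrightarrow> g (\<delta> q \<phi>) = 0"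
  proof (rule restriction_surjective[OF acyc, of p "\<lambda>\<phi>. f (as_class p Y (res p \<phi>))"])
    show "additive_on (W p) (\<lambda>\<phi>. f (as_class p Y (res p \<phi>)))"
      using steenrod_chains_additive[OF fc] res_cochain by (auto simp: additive_on_def restrict0_add)
    show "f (as_class p Y (res p \<phi>)) = 0" if "\<phi> \<in> N p" for \<phi>
      using steenrod_chains_null[OF fc] res_null that N_W by blast
    show "f (as_class p Y (res p (\<delta> q \<phi>))) = 0" if "p = Suc q" "\<phi> \<in> W q" for q \<phi>
      using f(1) that res_cochain[OF that(2)] unfolding steenrod_cycles_iff by (auto simp: res_coboundary)
  qed blast+
  obtain h where h: "h \<in> steenrod_chains p X" "\<And>\<phi>. \<phi> \<in> F p \<Longrightarrow> h (as_class p X \<phi>) = g \<phi>"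
    using steenrod_chain_of_function[of p X g] g(1,2) unfolding cochains_X null_X by blast
  have "h (as_class p X (\<delta> q \<phi>)) = 0" if "p = Suc q" "\<phi> \<in> F q" for q \<phi>
    using h(2)[of "\<delta> q \<phi>"] g(4)[OF that] as_functions_coboundary[OF that(2)] that(1) by simp
  then have "h \<in> steenrod_cycles p X integer_group"
    using h(1) by (simp add: steenrod_cycles_iff cochains_X)
  moreover have "steenrod_chain_restriction p X U h = f"
    by (rule chains_eqI_res[OF chain_restriction_extensional steenrod_chains_extensional[OF fc]])
      (use h(2)[OF subsetD[OF W_F]] g(3) in \<open>auto simp: chain_restriction_res\<close>)
  ultimately show ?thesis
    using that[of "steenrod_class p X h"] steenrod_restriction_class[OF h(1)] f(2)
    unfolding carrier_steenrod_homology_group by blast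
qed

text \<open>The difference of two representing cycles is a functional on \<open>F\<close> whose
  restriction to \<open>W\<close> bounds; hence it bounds on \<open>F\<close>, by functionals that
  kill \<open>N\<close>.\<close>

lemma steenrod_restriction_inj:
  assumes acyc: "dual_acyclic p W"
    and \<nu>: "\<nu> \<in> carrier (steenrod_homology_group p X integer_group)"
      "\<nu>' \<in> carrier (steenrod_homology_group p X integer_group)"
    and eq: "steenrod_restriction p X U integer_group \<nu> = steenrod_restriction p X U integer_group \<nu>'"
  shows "\<nu> = \<nu>'"
proof -
  obtain h h' where h: "h \<in> steenrod_cycles p X integer_group" "\<nu> = steenrod_class p X h"
    "h' \<in> steenrod_cycles p X integer_group" "\<nu>' = steenrod_class p X h'"
    using \<nu> unfolding carrier_steenrod_homology_group by blast
  have hc: "h \<in> steenrod_chains p X" "h' \<in> steenrod_chains p X" using h by (simp_all add: steenrod_cycles_iff)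
  have "steenrod_class p Y (steenrod_chain_restriction p X U h) =
      steenrod_class p Y (steenrod_chain_restriction p X U h')"
    using eq hc by (simp add: h steenrod_restriction_class)
  then obtain b where b: "b \<in> steenrod_boundaries p Y integer_group" "steenrod_chain_restriction p X U h =
      b \<otimes>\<^bsub>steenrod_chain_group p Y integer_group\<^esub> steenrod_chain_restriction p X U h'"
    by (rule steenrod_class_eqE[OF chain_restriction_chain[OF hc(1)]])
  obtain k where k: "k \<in> steenrod_chains (Suc p) Y" "b = steenrod_boundary p Y k"
    using steenrod_boundariesE[OF b(1)] by blast
  let ?f = "\<lambda>\<phi>. h (as_class p X \<phi>) - h' (as_class p X \<phi>)"
  let ?k = "\<lambda>\<phi>. k (as_class (Suc p) Y (res (Suc p) \<phi>))"
  have f: "additive_on (F p) ?f"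
    using additive_on_minus[OF steenrod_chains_additive[OF hc(1)] steenrod_chains_additive[OF hc(2)]]
    by (simp add: cochains_X)
  obtain g :: "('a list \<Rightarrow> int) \<Rightarrow> int" where g: "additive_on (F (Suc p)) g"
    "\<And>\<phi>. \<phi> \<in> N (Suc p) \<Longrightarrow> g \<phi> = 0" "\<And>\<phi>. \<phi> \<in> F p \<Longrightarrow> ?f \<phi> = g (\<delta> p \<phi>)"
  proof (rule restriction_injective[OF acyc f, where h = ?k])
    show "?f (\<delta> q \<phi>) = 0" if "p = Suc q" "\<phi> \<in> F q" for q \<phi>
      using h that by (auto simp: steenrod_cycles_iff cochains_X)
    show "additive_on (W (Suc p)) ?k"
      using steenrod_chains_additive[OF k(1)] res_cochain by (auto simp: additive_on_def restrict0_add)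
    show "?k \<phi> = 0" if "\<phi> \<in> N (Suc p)" for \<phi>
      using steenrod_chains_null[OF k(1)] res_null that N_W by blast
    show "?f \<phi> = ?k (\<delta> p \<phi>)" if \<phi>: "\<phi> \<in> W p" for \<phi>
    proof -
      have "h (as_class p X \<phi>) = b (as_class p Y (res p \<phi>)) + h' (as_class p X \<phi>)"
        using arg_cong[OF b(2), of "\<lambda>f. f (as_class p Y (res p \<phi>))"] \<phi>
        by (simp add: chain_restriction_res steenrod_chain_mult res_cochain)
      then show ?thesis using \<phi> by (simp add: k(2) steenrod_boundary_class res_cochain res_coboundary)
    qed
  qed blast
  obtain c where c: "c \<in> steenrod_chains p X" "\<And>\<phi>. \<phi> \<in> F p \<Longrightarrow> c (as_class p X \<phi>) = ?f \<phi>"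
  proof (rule steenrod_chain_of_function[of p X ?f])
    show "additive_on (as_cochains p X) ?f" using f by (simp add: cochains_X)
    show "?f \<phi> = 0" if "\<phi> \<in> as_null p X" for \<phi>
      using steenrod_chains_null[OF hc(1) that] steenrod_chains_null[OF hc(2) that] by simp
  qed (auto simp: cochains_X)
  have "c \<in> steenrod_boundaries p X integer_group"
    by (rule steenrod_boundariesI[OF c(1), of g]) (use g c(2) in \<open>auto simp: cochains_X null_X\<close>)
  moreover have "h = c \<otimes>\<^bsub>steenrod_chain_group p X integer_group\<^esub> h'"
    by (rule steenrod_chains_eqI[OF steenrod_chains_extensional[OF hc(1)] steenrod_chain_mult_extensional(1)])
      (use c(2) in \<open>simp add: steenrod_chain_mult cochains_X\<close>)
  ultimately show ?thesis using steenrod_class_eqI[OF hc(2)] h by simp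
qed

end

theorem theorem2p4:
  fixes d :: nat and M X :: "'a topology"
    and ori :: "'a set \<Rightarrow> ('a, int) steenrod_chain set"
    and \<mu> :: "('a, int) steenrod_chain set"
  assumes "topological_manifold d M"
    and "manifold_orientation d M ori"
    and "fundamental_class d M ori \<mu>"
    and "thin_compactification d M X"
  shows "\<exists>!\<nu>. \<nu> \<in> carrier (steenrod_homology_group d X integer_group) \<and>
              steenrod_restriction d X (topspace M) integer_group \<nu> = \<mu>"
proof -
  let ?S = "topspace X - topspace M"
  have thin: "compact_space X" "Hausdorff_space X" "topspace M \<subseteq> topspace X"
    "subtopology X (topspace M) = M" "closedin X ?S"
    and trivial: "\<And>p. int p > int d - 2 \<Longrightarrow>
      trivial_group (steenrod_homology_group p (subtopology X ?S) integer_group)"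
    using assms(4) by (auto simp: thin_compactification_def)
  interpret compact_pair X ?S using thin by unfold_locales
  have acyc: "dual_acyclic p W" if "int p > int d - 2" for p
    by (rule dual_acyclic_taut[OF dual_acyclic_trivial[OF trivial[OF that]]])
  have U: "U = topspace M" using thin(3) by (auto simp: U_def)
  have \<mu>: "\<mu> \<in> carrier (steenrod_homology_group d Y integer_group)"
    using assms(3) thin(4) by (simp add: fundamental_class_def U)
  \<comment> \<open>Lifting uses acyclicity in degree d - 1, the lowest degree allowed by p > d - 2,
    and is unconditional for d = 0; uniqueness uses degree d.\<close>
  obtain \<nu> where "\<nu> \<in> carrier (steenrod_homology_group d X integer_group)"
    "steenrod_restriction d X U integer_group \<nu> = \<mu>"
    by (rule steenrod_restriction_surj[OF _ \<mu>]) (use acyc in auto)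
  then show ?thesis
    using steenrod_restriction_inj[OF acyc[of d]] unfolding U by (intro ex1I[of _ \<nu>]) auto
qed

end
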